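(* Let $(\mathcal{X},\ \rho^{B_1B_2}_x,\ \mathcal{H}^{B_1}\otimes\mathcal{H}^{B_2})$ be a classical-quantum broadcast channel, let $\mathcal{W}$ be a finite set and $p=p_W(w)p_{X|W}(x|w)$ a distribution on $\mathcal{W}\times\mathcal{X}$. Then every rate pair $(R_1,R)\in\mathbb{R}_+^2$ with $$R_1\le I(X;B_1|W)_\theta,\qquad R\le I(W;B_2)_\theta,\qquad R_1+R\le I(X;B_1)_\theta$$ is achievable, in the sense that the rate triple $(R_1,R,0)$ (personal rate $R_1$ to Receiver 1, common rate $R$, personal rate $0$ to Receiver 2) is achievable for the broadcast channel. Here $\theta^{WXB_1B_2}=\sum_{w,x}p_W(w)p_{X|W}(x|w)|w\rangle\langle w|^W\otimes|x\rangle\langle x|^X\otimes\rho^{B_1B_2}_x$.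
   Context: A classical-quantum broadcast channel: finite input alphabet $\mathcal{X}$ and density operators $\rho^{B_1B_2}_x$ on finite-dimensional $\mathcal{H}^{B_1}\otimes\mathcal{H}^{B_2}$; Receiver $j$ holds $B_j$; $n$ uses give $\rho^{B_1^nB_2^n}_{x^n}=\bigotimes_i\rho^{B_1B_2}_{x_i}$. An $(n,R_1,R,R_2,\epsilon)$ code consists of a codebook $\{x^n(m_1,m,m_2)\}$ with $m_1\in\mathcal{M}_1,m\in\mathcal{M},m_2\in\mathcal{M}_2$, $|\mathcal{M}_1|=2^{nR_1},|\mathcal{M}|=2^{nR},|\mathcal{M}_2|=2^{nR_2}$, a POVM $\{\Lambda_{m_1,m}\}$ on $B_1^n$ and a POVM $\{\Gamma_{m,m_2}\}$ on $B_2^n$, with $\frac{1}{|\mathcal{M}_1||\mathcal{M}||\mathcal{M}_2|}\sum_{m_1,m,m_2}\mathrm{Tr}[(I-\Lambda_{m_1,m}\otimes\Gamma_{m,m_2})\rho^{B_1^nB_2^n}_{x^n(m_1,m,m_2)}]\le\epsilon$. A triple $(R_1,R,R_2)$ is achievable if an $(n,R_1-\delta,R-\delta,R_2-\delta,\epsilon)$ code exists for all $\epsilon,\delta>0$ and sufficiently large $n$. Mutual informations are quantum (base 2). *)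

theory Defs
  imports Complex_Main "Jordan_Normal_Form.Char_Poly"
begin

text \<open>A Hilbert space of dimension d is C^d; operators are d x d complex matrices.
  Composite systems are described by a list of local dimensions ds; the basis
  index of the composite system is the mixed-radix number whose k-th digit
  (most significant first) is the basis index of subsystem k; this agrees with
  the Kronecker product below.\<close>

definition mtrace :: "complex mat \<Rightarrow> complex" where
  "mtrace A = (\<Sum>i<dim_row A. A $$ (i, i))"

definition hermitian_mat :: "nat \<Rightarrow> complex mat \<Rightarrow> bool" where
  "hermitian_mat d A \<longleftrightarrow> A \<in> carrier_mat d d \<and>
     (\<forall>i<d. \<forall>j<d. A $$ (i, j) = cnj (A $$ (j, i)))"

definition psd_mat :: "nat \<Rightarrow> complex mat \<Rightarrow> bool" where
  "psd_mat d A \<longleftrightarrow> hermitian_mat d A \<and>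
     (\<forall>v \<in> carrier_vec d. 0 \<le> Re (conjugate v \<bullet> (A *\<^sub>v v)))"

definition density_op :: "nat \<Rightarrow> complex mat \<Rightarrow> bool" where
  "density_op d \<rho> \<longleftrightarrow> psd_mat d \<rho> \<and> mtrace \<rho> = 1"

definition povm :: "nat \<Rightarrow> 'm set \<Rightarrow> ('m \<Rightarrow> complex mat) \<Rightarrow> bool" where
  "povm d M E \<longleftrightarrow> finite M \<and> (\<forall>m\<in>M. psd_mat d (E m)) \<and>
     (\<forall>i<d. \<forall>j<d. (\<Sum>m\<in>M. E m $$ (i, j)) = (1\<^sub>m d) $$ (i, j))"

definition kron :: "complex mat \<Rightarrow> complex mat \<Rightarrow> complex mat" where
  "kron A B = mat (dim_row A * dim_row B) (dim_col A * dim_col B)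
     (\<lambda>(i, j). A $$ (i div dim_row B, j div dim_col B) * B $$ (i mod dim_row B, j mod dim_col B))"

definition kron_list :: "complex mat list \<Rightarrow> complex mat" where
  "kron_list As = foldr kron As (1\<^sub>m 1)"

definition ket_bra :: "nat \<Rightarrow> nat \<Rightarrow> complex mat" where
  "ket_bra n w = mat n n (\<lambda>(i, j). if i = w \<and> j = w then 1 else 0)"

definition digit :: "nat list \<Rightarrow> nat \<Rightarrow> nat \<Rightarrow> nat" where
  "digit ds i k = (i div prod_list (drop (Suc k) ds)) mod (ds ! k)"

text \<open>Reduced state on the subsystems listed in ks (in that order):
  partial trace over all other subsystems. If ks is a permutation of all
  subsystems, this just reorders the tensor factors.\<close>
definition marginal :: "nat list \<Rightarrow> nat list \<Rightarrow> complex mat \<Rightarrow> complex mat" where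
  "marginal ds ks \<rho> =
    (let es = map (\<lambda>k. ds ! k) ks; D = prod_list es; N = prod_list ds in
     mat D D (\<lambda>(a, b). \<Sum>i<N. \<Sum>j<N.
       if (\<forall>t<length ks. digit ds i (ks ! t) = digit es a t \<and> digit ds j (ks ! t) = digit es b t)
          \<and> (\<forall>k<length ds. k \<notin> set ks \<longrightarrow> digit ds i k = digit ds j k)
       then \<rho> $$ (i, j) else 0))"

text \<open>von Neumann entropy (base 2): - sum over eigenvalues (with algebraic
  multiplicity, as roots of the characteristic polynomial) of l log2 l,
  with the convention 0 log 0 = 0.\<close>
definition vn_entropy :: "complex mat \<Rightarrow> real" where
  "vn_entropy \<rho> = - (\<Sum>z\<in>{z. poly (char_poly \<rho>) z = 0}.
      real (order z (char_poly \<rho>)) * (if Re z \<le> 0 then 0 else Re z * log 2 (Re z)))"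

definition ent :: "nat list \<Rightarrow> nat list \<Rightarrow> complex mat \<Rightarrow> real" where
  "ent ds ks \<rho> = vn_entropy (marginal ds ks \<rho>)"

definition qmi :: "nat list \<Rightarrow> nat list \<Rightarrow> nat list \<Rightarrow> complex mat \<Rightarrow> real" where
  "qmi ds A B \<rho> = ent ds A \<rho> + ent ds B \<rho> - ent ds (A @ B) \<rho>"

definition qcmi :: "nat list \<Rightarrow> nat list \<Rightarrow> nat list \<Rightarrow> nat list \<Rightarrow> complex mat \<Rightarrow> real" where
  "qcmi ds A B C \<rho> = ent ds (A @ C) \<rho> + ent ds (B @ C) \<rho> - ent ds (A @ B @ C) \<rho> - ent ds C \<rho>"

text \<open>Input alphabet {0..<nX}; rho x is a density operator on C^d1 (x) C^d2 (B1 (x) B2).\<close>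
definition cq_bc :: "nat \<Rightarrow> nat \<Rightarrow> nat \<Rightarrow> (nat \<Rightarrow> complex mat) \<Rightarrow> bool" where
  "cq_bc nX d1 d2 \<rho> \<longleftrightarrow> 0 < nX \<and> 0 < d1 \<and> 0 < d2 \<and> (\<forall>x<nX. density_op (d1 * d2) (\<rho> x))"

text \<open>Output state rho_{x^n} on B1^n B2^n: tensor product of rho_{x_i} on
  (B1 B2)^n, with factors reordered to B1_1..B1_n B2_1..B2_n.\<close>
definition out_state :: "nat \<Rightarrow> nat \<Rightarrow> (nat \<Rightarrow> complex mat) \<Rightarrow> nat \<Rightarrow> (nat \<Rightarrow> nat) \<Rightarrow> complex mat" where
  "out_state d1 d2 \<rho> n xn =
     marginal (concat (replicate n [d1, d2]))
       (map (\<lambda>k. 2 * k) [0..<n] @ map (\<lambda>k. 2 * k + 1) [0..<n])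
       (kron_list (map (\<lambda>i. \<rho> (xn i)) [0..<n]))"

definition msg_size :: "nat \<Rightarrow> real \<Rightarrow> nat" where
  "msg_size n r = nat \<lceil>2 powr (real n * r)\<rceil>"

definition has_code :: "nat \<Rightarrow> nat \<Rightarrow> nat \<Rightarrow> (nat \<Rightarrow> complex mat) \<Rightarrow>
    nat \<Rightarrow> real \<Rightarrow> real \<Rightarrow> real \<Rightarrow> real \<Rightarrow> bool" where
  "has_code nX d1 d2 \<rho> n R1 R R2 \<epsilon> \<longleftrightarrow>
    (let M1 = msg_size n R1; M = msg_size n R; M2 = msg_size n R2 in
     \<exists>(c :: nat \<Rightarrow> nat \<Rightarrow> nat \<Rightarrow> nat \<Rightarrow> nat) (\<Lambda> :: nat \<times> nat \<Rightarrow> complex mat)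
        (\<Gamma> :: nat \<times> nat \<Rightarrow> complex mat).
       (\<forall>m1<M1. \<forall>m<M. \<forall>m2<M2. \<forall>i<n. c m1 m m2 i < nX) \<and>
       povm (d1 ^ n) ({..<M1} \<times> {..<M}) \<Lambda> \<and>
       povm (d2 ^ n) ({..<M} \<times> {..<M2}) \<Gamma> \<and>
       (1 / (real M1 * real M * real M2)) *
         (\<Sum>m1<M1. \<Sum>m<M. \<Sum>m2<M2.
            Re (mtrace ((1\<^sub>m (d1 ^ n * d2 ^ n) - kron (\<Lambda> (m1, m)) (\<Gamma> (m, m2)))
                        * out_state d1 d2 \<rho> n (c m1 m m2)))) \<le> \<epsilon>)"

definition achievable :: "nat \<Rightarrow> nat \<Rightarrow> nat \<Rightarrow> (nat \<Rightarrow> complex mat) \<Rightarrow> real \<Rightarrow> real \<Rightarrow> real \<Rightarrow> bool" where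
  "achievable nX d1 d2 \<rho> R1 R R2 \<longleftrightarrow>
    (\<forall>\<epsilon>>0. \<forall>\<delta>>0. \<exists>N. \<forall>n\<ge>N. has_code nX d1 d2 \<rho> n (R1 - \<delta>) (R - \<delta>) (R2 - \<delta>) \<epsilon>)"

definition theta :: "nat \<Rightarrow> nat \<Rightarrow> nat \<Rightarrow> nat \<Rightarrow> (nat \<Rightarrow> real) \<Rightarrow> (nat \<Rightarrow> nat \<Rightarrow> real)
    \<Rightarrow> (nat \<Rightarrow> complex mat) \<Rightarrow> complex mat" where
  "theta nW nX d1 d2 pW pXW \<rho> =
     (let D = nW * nX * (d1 * d2) in
      mat D D (\<lambda>ij. \<Sum>w<nW. \<Sum>x<nX.
        complex_of_real (pW w * pXW w x) * kron (ket_bra nW w) (kron (ket_bra nX x) (\<rho> x)) $$ ij))"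

end

theory Submission
  imports Defs "Jordan_Normal_Form.Schur_Decomposition" "HOL-Library.FuncSet"
begin

text \<open>
  Superposition coding. Cloud centres \<open>w\<^sup>n(m)\<close> are drawn from \<open>p\<^sub>W\<close> and satellites
  \<open>x\<^sup>n(m\<^sub>1, m)\<close> from \<open>p\<^sub>X\<^sub>|\<^sub>W\<close>. Receiver 1 applies the square-root measurement built from
  the tests \<open>Q R\<^sub>w P\<^sub>x R\<^sub>w Q\<close>, where \<open>P\<^sub>x\<close> projects onto the large eigenvalues of \<open>\<rho>\<^sub>x\<close>,
  while \<open>R\<^sub>w\<close> and \<open>Q\<close> cut off the large eigenvalues of \<open>\<rho>\<^sub>w\<close> and of the average state. A
  wrong cloud centre is accepted with probability at most \<open>tr P\<^sub>x\<close> times the cut-off of \<open>Q\<close>,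
  which gives the constraint on \<open>R\<^sub>1 + R\<close>. For a wrong satellite of the right cloud, \<open>P\<^sub>x\<close>
  is bounded by a multiple of \<open>\<rho>\<^sub>x\<close>, and averaging over \<open>x\<close> leaves \<open>R\<^sub>w \<rho>\<^sub>w R\<^sub>w\<close>, which
  gives the constraint on \<open>R\<^sub>1\<close>. Receiver 2 uses \<open>Q P\<^sub>w Q\<close> for the states averaged over \<open>x\<close>.
  All tail probabilities are products, so Chernoff's bound replaces typical sets.
\<close>

section \<open>Finitely supported matrices as a ring\<close>

text \<open>Both receivers must be served by one codebook, so the random code is derandomised once,
  for the sum of their error bounds; a union bound splits the joint error into one local error for
  each reduced state. The Hayashi-Nagaoka inequality bounds each local error by a miss term plus a
  sum over wrong messages, so the average over codes only ever involves pairs of codewords.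

  Every cut-off is a spectral projection of a product state, diagonal in a product of single-letter
  eigenbases. Its error is therefore a tail of a sum of independent log-eigenvalues, whose mean is
  minus the entropy. Chernoff needs exponents strictly off the mean; the rate loss \<delta> in the
  definition of achievability pays for this and also covers the boundary of the region.

  Operators carry no dimension: letters, pairs and words index instances of one type, so block
  operators are built by consing letters and the analysis never reorders tensor factors. Mixed-radix
  indices enter only through the entropies and in the final transfer to a code.\<close>

typedef 'a op = "{A :: 'a \<Rightarrow> 'a \<Rightarrow> complex. finite {(i, j). A i j \<noteq> 0}}"
  morphisms entry Op
  by (rule exI[of _ "\<lambda>_ _. 0"]) simp

definition mk :: "'a set \<Rightarrow> ('a \<Rightarrow> 'a \<Rightarrow> complex) \<Rightarrow> 'a op" where
  "mk I f = Op (\<lambda>i j. if finite I \<and> i \<in> I \<and> j \<in> I then f i j else 0)"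

lemma entry_mk: "entry (mk I f) i j = (if finite I \<and> i \<in> I \<and> j \<in> I then f i j else 0)"
proof -
  have "finite {(i, j). (if finite I \<and> i \<in> I \<and> j \<in> I then f i j else 0) \<noteq> 0}"
  proof (cases "finite I")
    case True
    show ?thesis by (rule finite_subset[of _ "I \<times> I"]) (use True in \<open>auto split: if_splits\<close>)
  qed simp
  then show ?thesis unfolding mk_def by (subst Op_inverse) auto
qed

lemma op_eqI: "(\<And>i j. entry A i j = entry B i j) \<Longrightarrow> A = B"
  by (simp add: entry_inject[symmetric] fun_eq_iff)

definition supp :: "'a op \<Rightarrow> 'a set" where
  "supp A = {i. \<exists>j. entry A i j \<noteq> 0 \<or> entry A j i \<noteq> 0}"

lemma finite_supp [simp, intro]: "finite (supp A)"
proof -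
  have f: "finite {(i, j). entry A i j \<noteq> 0}" using entry[of A] by simp
  have "supp A \<subseteq> fst ` {(i, j). entry A i j \<noteq> 0} \<union> snd ` {(i, j). entry A i j \<noteq> 0}"
    unfolding supp_def by force
  then show ?thesis using f by (meson finite_Un finite_imageI finite_subset)
qed

lemma entry_supp: "i \<notin> supp A \<Longrightarrow> entry A i j = 0" "j \<notin> supp A \<Longrightarrow> entry A i j = 0"
  unfolding supp_def by auto

lemma supp_mk: "supp (mk I f) \<subseteq> I"
  unfolding supp_def by (auto simp: entry_mk split: if_splits)

instantiation op :: (type) "{zero, plus, minus, uminus, times, scaleR}"
begin
definition "0 = mk {} (\<lambda>_ _. 0)"
definition "A + B = mk (supp A \<union> supp B) (\<lambda>i j. entry A i j + entry B i j)"
definition "A - B = mk (supp A \<union> supp B) (\<lambda>i j. entry A i j - entry B i j)"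
definition "- A = mk (supp A) (\<lambda>i j. - entry A i j)"
definition "A * B = mk (supp A \<union> supp B) (\<lambda>i j. \<Sum>k\<in>supp A \<union> supp B. entry A i k * entry B k j)"
definition "r *\<^sub>R A = mk (supp A) (\<lambda>i j. of_real r * entry A i j)"
instance ..
end

lemma entry_zero [simp]: "entry 0 i j = 0" by (simp add: zero_op_def entry_mk)
lemma entry_plus [simp]: "entry (A + B) i j = entry A i j + entry B i j"
  by (auto simp: plus_op_def entry_mk entry_supp)
lemma entry_minus [simp]: "entry (A - B) i j = entry A i j - entry B i j"
  by (auto simp: minus_op_def entry_mk entry_supp)
lemma entry_uminus [simp]: "entry (- A) i j = - entry A i j"
  by (auto simp: uminus_op_def entry_mk entry_supp)
lemma entry_scaleR [simp]: "entry (r *\<^sub>R A) i j = of_real r * entry A i j"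
  by (auto simp: scaleR_op_def entry_mk entry_supp)

text \<open>A term with \<open>k\<close> outside \<open>S\<close> vanishes as soon as one factor has
  its support in \<open>S\<close>. The freedom in \<open>S\<close> lets several products be expanded
  over one common set.\<close>

lemma entry_times:
  assumes "finite S" "supp A \<subseteq> S \<or> supp B \<subseteq> S"
  shows "entry (A * B) i j = (\<Sum>k\<in>S. entry A i k * entry B k j)"
proof -
  have z: "entry A i k * entry B k j = 0" if "k \<notin> S" for k
    using assms(2) that by (auto dest: subsetD intro: entry_supp)
  have "entry (A * B) i j = (\<Sum>k\<in>supp A \<union> supp B. entry A i k * entry B k j)"
    by (auto simp: times_op_def entry_mk entry_supp)
  also have "\<dots> = (\<Sum>k\<in>S \<union> supp A \<union> supp B. entry A i k * entry B k j)"
    by (rule sum.mono_neutral_left) (use assms in \<open>auto simp: entry_supp\<close>)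
  also have "\<dots> = (\<Sum>k\<in>S. entry A i k * entry B k j)"
    by (rule sum.mono_neutral_right) (use assms z in auto)
  finally show ?thesis .
qed


instance op :: (type) real_algebra
proof
  fix A B C :: "'a op" and r s :: real
  let ?S = "supp A \<union> supp B \<union> supp C"
  note t = entry_times[where S = ?S]
  show "A * B * C = A * (B * C)"
  proof (rule op_eqI)
    fix i j
    have "entry (A * B * C) i j = (\<Sum>k\<in>?S. \<Sum>l\<in>?S. entry A i l * entry B l k * entry C k j)"
      by (subst t, simp, blast, rule sum.cong[OF refl], subst t) (auto simp: sum_distrib_right)
    also have "\<dots> = (\<Sum>l\<in>?S. \<Sum>k\<in>?S. entry A i l * entry B l k * entry C k j)"
      by (rule sum.swap)
    also have "\<dots> = entry (A * (B * C)) i j"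
      by (subst t, simp, blast, rule sum.cong[OF refl], subst t) (auto simp: sum_distrib_left mult.assoc)
    finally show "entry (A * B * C) i j = entry (A * (B * C)) i j" .
  qed
  show "(A + B) * C = A * C + B * C"
    by (rule op_eqI) (simp add: entry_times[where S = "supp C"] distrib_right sum.distrib)
  show "A * (B + C) = A * B + A * C"
    by (rule op_eqI) (simp add: entry_times[where S = "supp A"] distrib_left sum.distrib)
  show "r *\<^sub>R A * B = r *\<^sub>R (A * B)"
    by (rule op_eqI) (simp add: entry_times[where S = "supp B"] sum_distrib_left mult_ac)
  show "A * r *\<^sub>R B = r *\<^sub>R (A * B)"
    by (rule op_eqI) (simp add: entry_times[where S = "supp A"] sum_distrib_left mult_ac)
qed (auto intro!: op_eqI simp: algebra_simps)

lemma entry_sum: "entry (sum F X) i j = (\<Sum>x\<in>X. entry (F x) i j)"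
  by (induction X rule: infinite_finite_induct) auto

section \<open>Trace and adjoint\<close>

definition tr :: "'a op \<Rightarrow> complex" where
  "tr A = (\<Sum>i\<in>supp A. entry A i i)"

lemma tr_eq: "finite S \<Longrightarrow> supp A \<subseteq> S \<Longrightarrow> tr A = (\<Sum>i\<in>S. entry A i i)"
  unfolding tr_def by (rule sum.mono_neutral_left) (auto simp: entry_supp)

lemma supp_plus: "supp (A + B) \<subseteq> supp A \<union> supp B"
  by (auto simp: supp_def) 
lemma supp_times: "supp (A * B) \<subseteq> supp A \<union> supp B"
  unfolding times_op_def by (rule supp_mk)

lemma tr_zero [simp]: "tr 0 = 0" by (simp add: tr_def)
lemma tr_add [simp]: "tr (A + B) = tr A + tr B"
  using supp_plus[of A B] by (simp add: tr_eq[where S = "supp A \<union> supp B"] sum.distrib)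
lemma tr_scaleR [simp]: "tr (r *\<^sub>R A) = of_real r * tr A"
proof -
  have "supp (r *\<^sub>R A) \<subseteq> supp A" by (auto simp: supp_def)
  then show ?thesis by (simp add: tr_eq[where S = "supp A"] sum_distrib_left)
qed
lemma tr_uminus [simp]: "tr (- A) = - tr A"
  using tr_scaleR[of "-1" A] by simp
lemma tr_diff [simp]: "tr (A - B) = tr A - tr B"
  using tr_add[of A "- B"] by simp
lemma tr_sum: "tr (sum F X) = (\<Sum>x\<in>X. tr (F x))"
  by (induction X rule: infinite_finite_induct) auto

lemma tr_times: "finite S \<Longrightarrow> supp A \<union> supp B \<subseteq> S \<Longrightarrow>
   tr (A * B) = (\<Sum>i\<in>S. \<Sum>k\<in>S. entry A i k * entry B k i)"
  using supp_times[of A B]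
  by (subst tr_eq[where S = S]) (auto intro!: sum.cong simp: entry_times[where S = S])

lemma tr_comm: "tr (A * B) = tr (B * A)"
proof -
  let ?S = "supp A \<union> supp B"
  have "tr (A * B) = (\<Sum>i\<in>?S. \<Sum>k\<in>?S. entry A i k * entry B k i)" by (rule tr_times) auto
  also have "\<dots> = (\<Sum>k\<in>?S. \<Sum>i\<in>?S. entry B k i * entry A i k)"
    by (subst sum.swap) (simp add: mult.commute)
  also have "\<dots> = tr (B * A)" by (rule tr_times[symmetric]) auto
  finally show ?thesis .
qed

definition star :: "'a op \<Rightarrow> 'a op" where
  "star A = mk (supp A) (\<lambda>i j. cnj (entry A j i))"

lemma entry_star [simp]: "entry (star A) i j = cnj (entry A j i)"
  by (auto simp: star_def entry_mk entry_supp)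

lemma star_star [simp]: "star (star A) = A" by (rule op_eqI) simp
lemma star_zero [simp]: "star 0 = 0" by (rule op_eqI) simp
lemma star_add [simp]: "star (A + B) = star A + star B" by (rule op_eqI) simp
lemma star_diff [simp]: "star (A - B) = star A - star B" by (rule op_eqI) simp
lemma star_scaleR [simp]: "star (r *\<^sub>R A) = r *\<^sub>R star A" by (rule op_eqI) simp
lemma star_sum: "star (sum F X) = (\<Sum>x\<in>X. star (F x))"
  by (induction X rule: infinite_finite_induct) auto
lemma supp_star [simp]: "supp (star A) = supp A" by (auto simp: supp_def)
lemma star_times [simp]: "star (A * B) = star B * star A"
  by (rule op_eqI) (simp add: entry_times[where S = "supp A"] mult.commute)

abbreviation rtr :: "'a op \<Rightarrow> real" where "rtr A \<equiv> Re (tr A)"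

lemma tr_star_times_self: "tr (star B * B) = (\<Sum>i\<in>supp B. \<Sum>k\<in>supp B. of_real ((cmod (entry B k i))\<^sup>2))"
  by (subst tr_times[where S = "supp B"])
    (auto intro!: sum.cong simp: complex_norm_square mult.commute simp del: of_real_power)

lemma rtr_star_times_self: "0 \<le> rtr (star B * B)"
  unfolding tr_star_times_self by (simp flip: of_real_sum of_real_power add: sum_nonneg)

text \<open>Faithfulness of the trace: the trace of \<open>star B * B\<close> is the sum of the
  squared absolute values of all entries. It gives antisymmetry of the order and completeness of
  eigenbases.\<close>

lemma rtr_star_times_self_zero: "rtr (star B * B) = 0 \<Longrightarrow> B = 0"
proof -
  assume "rtr (star B * B) = 0"
  then have "(\<Sum>i\<in>supp B. \<Sum>k\<in>supp B. (cmod (entry B k i))\<^sup>2) = 0"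
    unfolding tr_star_times_self by (simp flip: of_real_sum of_real_power)
  then have "\<forall>i\<in>supp B. \<forall>k\<in>supp B. entry B k i = 0"
    by (subst (asm) sum_nonneg_eq_0_iff) (auto simp: sum_nonneg sum_nonneg_eq_0_iff)
  then show "B = 0" by (intro op_eqI) (metis entry_supp entry_zero)
qed

text \<open>Positivity is defined algebraically, as being a finite sum of operators \<open>B\<^sup>* B\<close>. All closure
  properties are then identities in the ring, and no vectors are needed.\<close>

inductive pos :: "'a op \<Rightarrow> bool" where
  pos_zero: "pos 0"
| pos_step: "pos A \<Longrightarrow> pos (A + star B * B)"

lemma pos_self: "pos (star B * B)"
  using pos_step[OF pos_zero, of B] by simp

lemma pos_add: "pos B \<Longrightarrow> pos A \<Longrightarrow> pos (A + B)"
  by (induction B rule: pos.induct) (auto simp flip: add.assoc intro: pos_step)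

lemma pos_conj: "pos A \<Longrightarrow> pos (star C * A * C)"
proof (induction A rule: pos.induct)
  case (pos_step A B)
  have "star C * (A + star B * B) * C = star C * A * C + star (B * C) * (B * C)"
    by (simp add: algebra_simps)
  with pos_step show ?case by (metis pos.pos_step)
qed (simp add: pos_zero)

lemma pos_scaleR: "pos A \<Longrightarrow> 0 \<le> r \<Longrightarrow> pos (r *\<^sub>R A)"
proof (induction A rule: pos.induct)
  case (pos_step A B)
  have "r *\<^sub>R (A + star B * B) = r *\<^sub>R A + star (sqrt r *\<^sub>R B) * (sqrt r *\<^sub>R B)"
    using pos_step.prems by (simp add: scaleR_add_right)
  with pos_step show ?case by (metis pos.pos_step)
qed (simp add: pos_zero)

lemma pos_star: "pos A \<Longrightarrow> star A = A"
  by (induction A rule: pos.induct) auto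

lemma rtr_pos: "pos A \<Longrightarrow> 0 \<le> rtr A"
  by (induction A rule: pos.induct) (auto simp: rtr_star_times_self)

lemma pos_rtr_zero: "pos A \<Longrightarrow> rtr A = 0 \<Longrightarrow> A = 0"
proof (induction A rule: pos.induct)
  case (pos_step A B)
  then have "rtr A = 0" "rtr (star B * B) = 0"
    using rtr_pos[of A] rtr_star_times_self[of B] by auto
  with pos_step show ?case by (auto dest: rtr_star_times_self_zero)
qed simp

text \<open>The product of two positive operators need not be positive, but its trace is: cyclicity
  turns \<open>A * (star C * C)\<close> into the conjugate \<open>C * A * star C\<close>.\<close>

lemma rtr_mult_pos: "pos B \<Longrightarrow> pos A \<Longrightarrow> 0 \<le> rtr (A * B)"
proof (induction B rule: pos.induct)
  case (pos_step B C)
  have "tr (A * (star C * C)) = tr (C * A * star C)"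
    by (metis mult.assoc tr_comm)
  moreover have "0 \<le> rtr (C * A * star C)"
    using rtr_pos[OF pos_conj[OF pos_step.prems, of "star C"]] by simp
  ultimately show ?case using pos_step by (simp add: algebra_simps)
qed simp

text \<open>The Loewner order. Antisymmetry comes from the trace: if both differences are positive,
  their traces are opposite, hence zero, and a positive operator of trace zero vanishes.\<close>

instantiation op :: (type) ordered_real_vector
begin
definition "A \<le> B \<longleftrightarrow> pos (B - A)"
definition "A < B \<longleftrightarrow> pos (B - A) \<and> A \<noteq> B" for A B :: "'a op"
instance
proof
  fix A B C :: "'a op" and r s :: real
  have anti: "A = B" if "pos (B - A)" "pos (A - B)" for A B :: "'a op"
  proof -
    have "rtr (B - A) = 0" using rtr_pos[OF that(1)] rtr_pos[OF that(2)] by simp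
    with that have "B - A = 0" by (blast intro: pos_rtr_zero)
    then show ?thesis by simp
  qed
  show "(A < B) = (A \<le> B \<and> \<not> B \<le> A)"
    using anti[of B A] by (auto simp: less_eq_op_def less_op_def pos_zero)
  show "A \<le> A" by (simp add: less_eq_op_def pos_zero)
  show "A \<le> B \<Longrightarrow> B \<le> C \<Longrightarrow> A \<le> C" using pos_add[of "C - B" "B - A"] by (simp add: less_eq_op_def)
  show "A \<le> B \<Longrightarrow> B \<le> A \<Longrightarrow> A = B" using anti[of B A] by (simp add: less_eq_op_def)
  show "A \<le> B \<Longrightarrow> C + A \<le> C + B" by (simp add: less_eq_op_def)
  show "A \<le> B \<Longrightarrow> 0 \<le> r \<Longrightarrow> r *\<^sub>R A \<le> r *\<^sub>R B"
    using pos_scaleR[of "B - A" r] by (simp add: less_eq_op_def scaleR_diff_right)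
  show "r \<le> s \<Longrightarrow> 0 \<le> A \<Longrightarrow> r *\<^sub>R A \<le> s *\<^sub>R A"
    using pos_scaleR[of A "s - r"] by (simp add: less_eq_op_def scaleR_diff_left)
qed
end

lemma nonneg_iff_pos: "0 \<le> A \<longleftrightarrow> pos A" by (simp add: less_eq_op_def)

lemma self_nonneg [simp]: "0 \<le> star B * B" by (simp add: nonneg_iff_pos pos_self)

lemma nonneg_star: "0 \<le> A \<Longrightarrow> star A = A" by (simp add: nonneg_iff_pos pos_star)

lemma conj_mono: "A \<le> B \<Longrightarrow> star C * A * C \<le> star C * B * C"
  using pos_conj[of "B - A" C] by (simp add: less_eq_op_def algebra_simps)

lemma rtr_mono: "A \<le> B \<Longrightarrow> rtr A \<le> rtr B"
  using rtr_pos[of "B - A"] by (simp add: less_eq_op_def)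

lemma rtr_mult_mono: "A \<le> B \<Longrightarrow> 0 \<le> C \<Longrightarrow> rtr (A * C) \<le> rtr (B * C)"
  using rtr_mult_pos[of C "B - A"] by (simp add: less_eq_op_def algebra_simps)

lemma rtr_mult_nonneg: "0 \<le> A \<Longrightarrow> 0 \<le> C \<Longrightarrow> 0 \<le> rtr (A * C)"
  using rtr_mult_mono[of 0 A C] by simp

text \<open>\<open>unit_op I\<close> is the identity of the corner of operators supported on \<open>I\<close>; there is no global unit.\<close>

definition unit_op :: "'a set \<Rightarrow> 'a op" where
  "unit_op I = mk I (\<lambda>i j. if i = j then 1 else 0)"

lemma supp_unit: "supp (unit_op I) \<subseteq> I" unfolding unit_op_def by (rule supp_mk)

lemma star_unit [simp]: "star (unit_op I) = unit_op I"
  by (rule op_eqI) (auto simp: unit_op_def entry_mk)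

lemma entry_unit_mult: "finite I \<Longrightarrow> entry (unit_op I * A) i j = (if i \<in> I then entry A i j else 0)"
proof -
  assume f: "finite I"
  have "entry (unit_op I * A) i j = (\<Sum>k\<in>I. entry (unit_op I) i k * entry A k j)"
    by (rule entry_times[OF f]) (simp add: supp_unit)
  also have "\<dots> = (\<Sum>k\<in>I. if i = k then entry A i j else 0)"
    using f by (intro sum.cong) (auto simp: unit_op_def entry_mk)
  finally show ?thesis using f by (simp add: sum.delta)
qed

lemma unit_mult: "finite I \<Longrightarrow> supp A \<subseteq> I \<Longrightarrow> unit_op I * A = A"
  using entry_supp(1) by (intro op_eqI) (fastforce simp: entry_unit_mult)

lemma mult_unit: "finite I \<Longrightarrow> supp A \<subseteq> I \<Longrightarrow> A * unit_op I = A"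
  by (metis star_star star_times star_unit supp_star unit_mult)

lemma unit_infinite: "infinite I \<Longrightarrow> unit_op I = 0"
  by (rule op_eqI) (simp add: unit_op_def entry_mk)

lemma unit_idem [simp]: "unit_op I * unit_op I = unit_op I"
  by (cases "finite I") (simp_all add: unit_mult[OF _ supp_unit] unit_infinite)

text \<open>Turns inclusions of supports into ring identities, which rewriting then carries through
  sums and products.\<close>

lemma supp_subset_iff: 
  assumes "finite I" shows "supp A \<subseteq> I \<longleftrightarrow> unit_op I * A = A \<and> A * unit_op I = A"
proof
  assume r: "unit_op I * A = A \<and> A * unit_op I = A"
  have "entry A i j = 0" if "i \<notin> I" for i j
    using entry_unit_mult[OF assms, of A i j] r that by simp
  moreover have "entry A i j = 0" if "j \<notin> I" for i j
    using entry_unit_mult[OF assms, of "star A" j i] r that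
    by (metis complex_cnj_zero_iff entry_star star_times star_unit)
  ultimately show "supp A \<subseteq> I" unfolding supp_def by blast
qed (use assms unit_mult mult_unit in auto)

lemma tr_unit: "finite I \<Longrightarrow> tr (unit_op I) = of_nat (card I)"
  by (simp add: tr_eq[where S = I, OF _ supp_unit]) (simp add: unit_op_def entry_mk)

section \<open>The spectral theorem\<close>

lemma mtrace_comm:
  assumes "A \<in> carrier_mat n n" "B \<in> carrier_mat n n"
  shows "mtrace (A * B) = mtrace (B * A)"
proof -
  have "mtrace (A * B) = (\<Sum>i<n. \<Sum>k<n. A $$ (i, k) * B $$ (k, i))"
    using assms by (auto simp: mtrace_def scalar_prod_def lessThan_atLeast0 intro!: sum.cong)
  also have "\<dots> = (\<Sum>k<n. \<Sum>i<n. A $$ (i, k) * B $$ (k, i))" by (rule sum.swap)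
  also have "\<dots> = mtrace (B * A)"
    using assms by (auto simp: mtrace_def scalar_prod_def lessThan_atLeast0 mult.commute intro!: sum.cong)
  finally show ?thesis .
qed

text \<open>If all eigenvalues vanished, the Schur form would be strictly upper triangular, and the trace
  of the square, which is the sum of all squared absolute values of the entries, would be zero.\<close>

lemma hermitian_mat_nonzero_eigenvalue:
  assumes h: "hermitian_mat n A" and nz: "i0 < n" "j0 < n" "A $$ (i0, j0) \<noteq> 0"
  obtains v z where "eigenvector A v z" "z \<noteq> 0"
proof -
  have A: "A \<in> carrier_mat n n" using h by (simp add: hermitian_mat_def)
  obtain as where as: "char_poly A = (\<Prod>a\<leftarrow>as. [:- a, 1:])" "length as = n"
    using char_poly_factorized[OF A] by blast
  obtain B P Q where B: "schur_decomposition A as = (B, P, Q)" by (metis prod_cases3)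
  from schur_decomposition[OF A as(1) B]
  have sim: "similar_mat_wit A B P Q" and ut: "upper_triangular B" and dg: "diag_mat B = as" by auto
  note w = similar_mat_witD2[OF A sim]
  have c: "B \<in> carrier_mat n n" "P \<in> carrier_mat n n" "Q \<in> carrier_mat n n"
    and QP: "Q * P = 1\<^sub>m n" and eq: "A = P * B * Q" by (fact w)+
  have "\<exists>a\<in>set as. a \<noteq> 0"
  proof (rule ccontr)
    assume "\<not> ?thesis"
    then have z: "B $$ (i, i) = 0" if "i < n" for i
      using dg that c by (auto simp: diag_mat_def)
    have BB: "(B * B) $$ (i, i) = 0" if i: "i < n" for i
    proof -
      \<comment> \<open>For \<open>k\<close> different from \<open>i\<close> one of the two
        positions lies below the diagonal; for \<open>k = i\<close> the diagonal entry is zero by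
        assumption.\<close>
      have "B $$ (i, k) * B $$ (k, i) = 0" if "k < n" for k
        using z[OF i] upper_triangularD[OF ut, of k i] upper_triangularD[OF ut, of i k] c i that
        by (cases k i rule: linorder_cases) auto
      then show ?thesis using c i by (auto simp: scalar_prod_def intro!: sum.neutral)
    qed
    have "A * A = P * (B * (Q * P) * B * Q)"
      unfolding eq using c by (simp add: assoc_mult_mat[of _ n n _ n _ n])
    also have "\<dots> = P * (B * B * Q)" using c QP by simp
    finally have "mtrace (A * A) = mtrace (B * B * Q * P)"
      using c by (simp add: mtrace_comm[of P n])
    also have "\<dots> = mtrace (B * B)"
      using c QP by (simp add: assoc_mult_mat[of _ n n _ n _ n])
    also have "\<dots> = 0"
    proof -
      have "dim_row (B * B) = n" using c by simp
      then show ?thesis unfolding mtrace_def using BB by (intro sum.neutral) auto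
    qed
    finally have 0: "mtrace (A * A) = 0" .
    have "mtrace (A * A) = (\<Sum>i<n. \<Sum>k<n. A $$ (i, k) * A $$ (k, i))"
      using A by (auto simp: mtrace_def scalar_prod_def lessThan_atLeast0 intro!: sum.cong)
    also have "\<dots> = (\<Sum>i<n. \<Sum>k<n. of_real ((cmod (A $$ (i, k)))\<^sup>2))"
    proof (intro sum.cong refl)
      fix i k assume "i \<in> {..<n}" "k \<in> {..<n}"
      then have "A $$ (k, i) = cnj (A $$ (i, k))" using h unfolding hermitian_mat_def by blast
      then show "A $$ (i, k) * A $$ (k, i) = of_real ((cmod (A $$ (i, k)))\<^sup>2)"
        by (simp add: complex_norm_square del: of_real_power)
    qed
    finally have "of_real (\<Sum>i<n. \<Sum>k<n. (cmod (A $$ (i, k)))\<^sup>2) = (0::complex)"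
      unfolding 0 of_real_sum by (rule sym)
    then have "(\<Sum>i<n. \<Sum>k<n. (cmod (A $$ (i, k)))\<^sup>2) = 0" by (simp only: of_real_eq_0_iff)
    moreover have "(cmod (A $$ (i0, j0)))\<^sup>2 \<le> (\<Sum>k<n. (cmod (A $$ (i0, k)))\<^sup>2)"
      by (rule member_le_sum[where f = "\<lambda>k. (cmod (A $$ (i0, k)))\<^sup>2"]) (use nz in simp_all)
    moreover have "\<dots> \<le> (\<Sum>i<n. \<Sum>k<n. (cmod (A $$ (i, k)))\<^sup>2)"
      by (rule member_le_sum[where f = "\<lambda>i. \<Sum>k<n. (cmod (A $$ (i, k)))\<^sup>2"]) (use nz in \<open>simp_all add:
          sum_nonneg\<close>)
    moreover have "0 < (cmod (A $$ (i0, j0)))\<^sup>2" using nz(3) by simp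
    ultimately show False by linarith
  qed
  then obtain a where a: "a \<in> set as" "a \<noteq> 0" by blast
  have "poly (char_poly A) a = 0" unfolding as(1) using a(1)
    by (simp add: poly_prod_list prod_list_zero_iff image_iff)
  then have "eigenvalue A a" using eigenvalue_root_char_poly[OF A] by simp
  then obtain v where "eigenvector A v a" unfolding eigenvalue_def ..
  then show thesis using a(2) by (rule that)
qed

definition proj :: "'a set \<Rightarrow> ('a \<Rightarrow> complex) \<Rightarrow> 'a op" where
  "proj I u = mk I (\<lambda>i j. u i * cnj (u j))"

lemma supp_proj: "supp (proj I u) \<subseteq> I" unfolding proj_def by (rule supp_mk)

lemma star_proj [simp]: "star (proj I u) = proj I u"
  by (rule op_eqI) (auto simp: proj_def entry_mk)

lemma tr_proj: "finite I \<Longrightarrow> tr (proj I u) = of_real (\<Sum>i\<in>I. (cmod (u i))\<^sup>2)"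
  by (subst tr_eq[OF _ supp_proj])
    (auto simp: proj_def entry_mk complex_norm_square simp del: of_real_power intro!: sum.cong)

lemma proj_idem:
  assumes "finite I" "(\<Sum>i\<in>I. (cmod (u i))\<^sup>2) = 1" shows "proj I u * proj I u = proj I u"
proof (rule op_eqI)
  fix i j
  have s: "(\<Sum>k\<in>I. cnj (u k) * u k) = 1"
    using assms(2) by (simp add: complex_norm_square[symmetric] mult.commute flip: of_real_sum of_real_power)
  have "entry (proj I u * proj I u) i j = (\<Sum>k\<in>I. entry (proj I u) i k * entry (proj I u) k j)"
    using assms by (subst entry_times[where S = I]) (auto simp: supp_proj)
  also have "\<dots> = entry (proj I u) i j * (\<Sum>k\<in>I. cnj (u k) * u k)"
    unfolding sum_distrib_left using assms(1)
    by (intro sum.cong refl) (auto simp: proj_def entry_mk mult_ac)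
  finally show "entry (proj I u * proj I u) i j = entry (proj I u) i j" by (simp add: s)
qed

lemma mult_proj_eigen:
  assumes "finite I" "supp A \<subseteq> I" "\<And>i. i \<in> I \<Longrightarrow> (\<Sum>k\<in>I. entry A i k * u k) = of_real r * u i"
  shows "A * proj I u = r *\<^sub>R proj I u"
proof (rule op_eqI)
  fix i j
  have "entry (A * proj I u) i j = (\<Sum>k\<in>I. entry A i k * entry (proj I u) k j)"
    using assms by (subst entry_times[where S = I]) auto
  also have "\<dots> = (\<Sum>k\<in>I. entry A i k * u k) * (if j \<in> I then cnj (u j) else 0)"
    unfolding sum_distrib_right using assms(1) by (intro sum.cong) (auto simp: proj_def entry_mk)
  also have "\<dots> = entry (r *\<^sub>R proj I u) i j"
  proof (cases "i \<in> I")
    case False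
    then have "entry A i k = 0" for k by (meson assms(2) entry_supp(1) subsetD)
    then show ?thesis using False by (simp add: proj_def entry_mk)
  qed (use assms in \<open>simp add: proj_def entry_mk\<close>)
  finally show "entry (A * proj I u) i j = entry (r *\<^sub>R proj I u) i j" .
qed

text \<open>The eigenvalue must be nonzero because the eigenvector then lies in the range of
  \<open>A\<close>; this is what keeps it orthogonal to eigenvectors already found when
  \<open>A\<close> is a compression.\<close>

lemma hermitian_nonzero_eigenprojection:
  assumes I: "finite I" "supp A \<subseteq> I" and h: "star A = A" and nz: "A \<noteq> 0"
  obtains u r where "r \<noteq> 0" "(\<Sum>i\<in>I. (cmod (u i))\<^sup>2) = 1" "A * proj I u = r *\<^sub>R proj I u"
proof -
  obtain e where e: "bij_betw e {0..<card I} I" using ex_bij_betw_nat_finite[OF I(1)] by blast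
  define n where "n = card I"
  have e: "bij_betw e {..<n} I" using e by (simp add: n_def lessThan_atLeast0)
  define M where "M = mat n n (\<lambda>(i, j). entry A (e i) (e j))"
  have hA: "cnj (entry A j i) = entry A i j" for i j using h by (metis entry_star)
  have M: "M \<in> carrier_mat n n" by (simp add: M_def)
  have hM: "hermitian_mat n M" by (auto simp: hermitian_mat_def M_def hA)
  from nz obtain a b where ab: "entry A a b \<noteq> 0" by (metis entry_zero op_eqI)
  then have "a \<in> I" "b \<in> I" using I(2) unfolding supp_def by blast+
  then obtain i0 j0 where "i0 < n" "j0 < n" "e i0 = a" "e j0 = b"
    using e unfolding bij_betw_def by auto
  then obtain v z where ev: "eigenvector M v z" and z: "z \<noteq> 0"
    using hermitian_mat_nonzero_eigenvalue[OF hM, of i0 j0] ab by (auto simp: M_def)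
  from ev M have v: "v \<in> carrier_vec n" "v \<noteq> 0\<^sub>v n" and Mv: "M *\<^sub>v v = z \<cdot>\<^sub>v v"
    by (auto simp: eigenvector_def)
  have Mv': "(\<Sum>k<n. entry A (e i) (e k) * v $ k) = z * v $ i" if "i < n" for i
    using arg_cong[OF Mv, of "\<lambda>w. w $ i"] v(1) that
    by (simp add: M_def scalar_prod_def lessThan_atLeast0)
  define s where "s = (\<Sum>i<n. (cmod (v $ i))\<^sup>2)"
  have "s > 0"
  proof -
    obtain i where "i < n" "v $ i \<noteq> 0" using v by (metis carrier_vecD eq_vecI index_zero_vec)
    then show ?thesis unfolding s_def by (intro sum_pos2[of _ i]) auto
  qed
  \<comment> \<open>The quadratic form at the eigenvector equals \<open>z\<close> times the squared
    norm \<open>s\<close> and is its own conjugate, so \<open>z\<close> is real.\<close>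
  define q where "q = (\<Sum>i<n. \<Sum>k<n. cnj (v $ i) * entry A (e i) (e k) * v $ k)"
  have q: "q = z * of_real s"
  proof -
    have "q = (\<Sum>i<n. cnj (v $ i) * (z * v $ i))"
      unfolding q_def by (intro sum.cong) (auto simp: Mv'[symmetric] sum_distrib_left mult.assoc)
    also have "\<dots> = z * (\<Sum>i<n. of_real ((cmod (v $ i))\<^sup>2))"
      unfolding complex_norm_square sum_distrib_left by (intro sum.cong) (auto simp: mult_ac)
    finally show ?thesis by (simp add: s_def)
  qed
  have "cnj q = q"
    unfolding q_def by (subst sum.swap) (auto simp: hA mult_ac intro!: sum.cong)
  then have zr: "z = of_real (Re z)" using q \<open>s > 0\<close>
    by (auto simp: complex_eq_iff)
  define d where "d i = inv_into {..<n} e i" for i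
  have de: "d (e i) = i" if "i < n" for i
    using e that unfolding d_def by (simp add: bij_betw_def)
  define u where "u i = v $ d i / of_real (sqrt s)" for i
  show thesis
  proof (rule that[of "Re z" u])
    show "Re z \<noteq> 0" using z zr by auto
    have "(\<Sum>i\<in>I. (cmod (u i))\<^sup>2) = (\<Sum>i<n. (cmod (u (e i)))\<^sup>2)"
      by (rule sum.reindex_bij_betw[OF e, symmetric])
    also have "\<dots> = (\<Sum>i<n. (cmod (v $ i))\<^sup>2 / s)"
      using \<open>s > 0\<close> by (intro sum.cong) (auto simp: u_def de norm_divide power_divide)
    also have "\<dots> = 1" using \<open>s > 0\<close> by (simp flip: sum_divide_distrib add: s_def[symmetric])
    finally show "(\<Sum>i\<in>I. (cmod (u i))\<^sup>2) = 1" .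
    show "A * proj I u = Re z *\<^sub>R proj I u"
    proof (rule mult_proj_eigen[OF I])
      fix i assume "i \<in> I"
      then obtain i' where i': "i = e i'" "i' < n" using e unfolding bij_betw_def by auto
      have "(\<Sum>k\<in>I. entry A i k * u k) = (\<Sum>k<n. entry A i (e k) * u (e k))"
        by (rule sum.reindex_bij_betw[OF e, symmetric])
      also have "\<dots> = (\<Sum>k<n. entry A i (e k) * v $ k) / of_real (sqrt s)"
        unfolding sum_divide_distrib by (intro sum.cong) (auto simp: u_def de)
      also have "\<dots> = of_real (Re z) * u i"
        using i' by (simp add: Mv' u_def de flip: zr)
      finally show "(\<Sum>k\<in>I. entry A i k * u k) = of_real (Re z) * u i" .
    qed
  qed
qed

text \<open>Deflation: with \<open>k\<close> eigenprojections found, \<open>A\<close> is compressed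
  to their orthogonal complement \<open>F\<close>, which commutes with \<open>A\<close>, and one
  more eigenvector is taken there.\<close>

lemma hermitian_eigenprojections:
  assumes I: "finite I" "supp A \<subseteq> I" and h: "star A = A" and "k \<le> card I"
  shows "\<exists>u r. (\<forall>i<k. \<forall>j<k. proj I (u i) * proj I (u j) = (if i = j then proj I (u i) else 0)) \<and>
    (\<forall>i<k. A * proj I (u i) = r i *\<^sub>R proj I (u i) \<and> tr (proj I (u i)) = 1)"
  using \<open>k \<le> card I\<close>
proof (induction k)
  case (Suc k)
  then have "k \<le> card I" by simp
  from Suc.IH[OF this] obtain u r where
    H: "\<forall>i<k. \<forall>j<k. proj I (u i) * proj I (u j) = (if i = j then proj I (u i) else 0)"
      "\<forall>i<k. A * proj I (u i) = r i *\<^sub>R proj I (u i) \<and> tr (proj I (u i)) = 1" by (elim exE conjE)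
  note o = H(1)[rule_format] and Ap = H(2)[rule_format, THEN conjunct1]
    and tp = H(2)[rule_format, THEN conjunct2]
  define P where "P = (\<Sum>i<k. proj I (u i))"
  define F where "F = unit_op I - P"
  note um = unit_mult[OF I(1)] mult_unit[OF I(1)] supp_proj
  have EP: "unit_op I * P = P" "P * unit_op I = P"
    by (simp_all add: P_def sum_distrib_left sum_distrib_right um)
  have pP: "proj I (u i) * P = proj I (u i)" "P * proj I (u i) = proj I (u i)" if "i < k" for i
  proof -
    have "proj I (u i) * P = (\<Sum>n<k. if i = n then proj I (u i) else 0)"
      unfolding P_def sum_distrib_left using that o by (intro sum.cong) auto
    then show "proj I (u i) * P = proj I (u i)" using that by simp
    have "P * proj I (u i) = (\<Sum>n<k. if n = i then proj I (u i) else 0)"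
      unfolding P_def sum_distrib_right using that o by (intro sum.cong) auto
    then show "P * proj I (u i) = proj I (u i)" using that by simp
  qed
  have PP: "P * P = P"
  proof -
    have "P * P = (\<Sum>i<k. proj I (u i) * P)" by (simp add: P_def sum_distrib_right)
    then show ?thesis using pP by (simp add: P_def)
  qed
  have sP: "star P = P" by (simp add: P_def star_sum)
  have AP: "A * P = (\<Sum>i<k. r i *\<^sub>R proj I (u i))" by (simp add: P_def sum_distrib_left Ap)
  \<comment> \<open>\<open>A * P\<close> is a real combination of projections, hence hermitian, and
    this says that \<open>P\<close> commutes with \<open>A\<close>.\<close>
  then have "star (A * P) = A * P" by (simp add: star_sum)
  then have comm: "P * A = A * P" by (simp add: h sP)
  have EA: "unit_op I * A = A" "A * unit_op I = A" using I by (simp_all add: um)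
  have sF: "star F = F" by (simp add: F_def sP)
  have FF: "F * F = F" by (simp add: F_def algebra_simps EP PP)
  have commF: "F * A = A * F" by (simp add: F_def algebra_simps EA comm)
  have pF: "proj I (u i) * F = 0" "F * proj I (u i) = 0" if "i < k" for i
    using that by (simp_all add: F_def algebra_simps um pP)
  \<comment> \<open>Counting dimensions by the trace: fewer than \<open>card I\<close> projections
    leave room.\<close>
  have "tr F = of_nat (card I) - of_nat k"
    using I by (simp add: F_def P_def tr_sum tr_unit tp)
  then have "F \<noteq> 0" using Suc.prems by (auto simp flip: of_nat_diff)
  \<comment> \<open>If the compression vanishes there is no nonzero eigenvalue to find; shifting by
    \<open>F\<close> creates one, and its eigenvector still lies in the range of \<open>F\<close>.
    The shift is undone in the eigenvalue \<open>m - t\<close>.\<close>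
  obtain t where nz: "F * A * F + t *\<^sub>R F \<noteq> 0"
  proof (cases "F * A * F = 0")
    case True then show thesis using that[of 1] \<open>F \<noteq> 0\<close> by simp
  next
    case False then show thesis using that[of 0] by simp
  qed
  define B where "B = F * A * F + t *\<^sub>R F"
  have EF: "unit_op I * F = F" "F * unit_op I = F" by (simp_all add: F_def algebra_simps EP)
  have FB: "F * B = B" by (simp add: B_def algebra_simps FF flip: mult.assoc)
  have "star B = B" by (simp add: B_def sF h mult.assoc)
  moreover have "supp B \<subseteq> I"
    unfolding supp_subset_iff[OF I(1)] by (simp add: B_def algebra_simps EF flip: mult.assoc)
        (simp add: mult.assoc EF)
  ultimately obtain v m where m: "m \<noteq> 0" and v: "(\<Sum>i\<in>I. (cmod (v i))\<^sup>2) = 1"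
    and Bv: "B * proj I v = m *\<^sub>R proj I v"
    using hermitian_nonzero_eigenprojection[OF I(1), of B] nz by (metis B_def)
  have "m *\<^sub>R (F * proj I v) = F * (B * proj I v)" by (simp add: Bv)
  also have "\<dots> = m *\<^sub>R proj I v" by (metis FB Bv mult.assoc)
  finally have Fv: "F * proj I v = proj I v" using m by simp
  then have vF: "proj I v * F = proj I v" by (metis sF star_proj star_times)
  have "A * proj I v = F * A * F * proj I v"
    by (metis Fv commF mult.assoc)
  also have "\<dots> = (B - t *\<^sub>R F) * proj I v" by (simp add: B_def)
  also have "\<dots> = (m - t) *\<^sub>R proj I v" by (simp add: left_diff_distrib Bv Fv scaleR_diff_left)
  finally have Av: "A * proj I v = (m - t) *\<^sub>R proj I v" .
  have ov: "proj I v * proj I (u i) = 0" "proj I (u i) * proj I v = 0" if "i < k" for i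
    by (metis Fv vF mult.assoc mult_zero_left mult_zero_right pF that)+
  have tv: "tr (proj I v) = 1" by (simp only: tr_proj[OF I(1)] v of_real_1)
  show ?case
    by (rule exI[of _ "u(k := v)"], rule exI[of _ "r(k := m - t)"])
      (use I v tv in \<open>auto simp: less_Suc_eq o Ap tp Av ov proj_idem\<close>)
qed simp

text \<open>Rank-one spectral resolutions. The resolved operator \<open>E\<close> is a parameter
  since there is no global unit, and the index type is open so that tensor products can be indexed
  by words.\<close>

locale resolution =
  fixes K :: "'k set" and p :: "'k \<Rightarrow> 'a op" and E :: "'a op"
  assumes fin: "finite K"
    and star_p: "k \<in> K \<Longrightarrow> star (p k) = p k"
    and orth: "k \<in> K \<Longrightarrow> l \<in> K \<Longrightarrow> p k * p l = (if k = l then p k else 0)"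
    and sum_p: "(\<Sum>k\<in>K. p k) = E"
    and tr_p: "k \<in> K \<Longrightarrow> tr (p k) = 1"
begin

text \<open>The functional calculus of the resolution: operators diagonal in it multiply and compare
  like the real functions of their eigenvalues, so inequalities between them become pointwise
  ones.\<close>

definition fc :: "('k \<Rightarrow> real) \<Rightarrow> 'a op" where "fc f = (\<Sum>k\<in>K. f k *\<^sub>R p k)"

lemma p_nonneg: "k \<in> K \<Longrightarrow> 0 \<le> p k"
  using self_nonneg[of "p k"] by (simp add: star_p orth)

lemma fc_cong: "(\<And>k. k \<in> K \<Longrightarrow> f k = g k) \<Longrightarrow> fc f = fc g"
  unfolding fc_def by (rule sum.cong) auto

lemma fc_one: "fc (\<lambda>_. 1) = E" by (simp add: fc_def sum_p)
lemma fc_diff: "fc f - fc g = fc (\<lambda>k. f k - g k)"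
  by (simp add: fc_def scaleR_diff_left sum_subtractf)
lemma fc_scaleR: "r *\<^sub>R fc f = fc (\<lambda>k. r * f k)"
  by (simp add: fc_def scaleR_sum_right)
lemma fc_mult_p: "k \<in> K \<Longrightarrow> fc f * p k = f k *\<^sub>R p k"
  unfolding fc_def sum_distrib_right
  by (simp add: orth fin if_distrib cong: sum.cong if_cong)
lemma p_mult_fc: "k \<in> K \<Longrightarrow> p k * fc f = f k *\<^sub>R p k"
  unfolding fc_def sum_distrib_left
  by (simp add: orth fin if_distrib cong: sum.cong if_cong)
lemma fc_mult: "fc f * fc g = fc (\<lambda>k. f k * g k)"
  by (subst (2) fc_def) (simp add: sum_distrib_left fc_mult_p, simp add: fc_def mult.commute)
lemma star_fc: "star (fc f) = fc f" by (simp add: fc_def star_sum star_p)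
lemma fc_mono: "(\<And>k. k \<in> K \<Longrightarrow> f k \<le> g k) \<Longrightarrow> fc f \<le> fc g"
  unfolding fc_def by (rule sum_mono) (auto intro: scaleR_right_mono p_nonneg)
lemma fc_nonneg: "(\<And>k. k \<in> K \<Longrightarrow> 0 \<le> f k) \<Longrightarrow> 0 \<le> fc f"
  using fc_mono[of "\<lambda>_. 0" f] by (simp add: fc_def)
lemma tr_fc: "tr (fc f) = of_real (\<Sum>k\<in>K. f k)"
  by (simp add: fc_def tr_sum tr_p)
lemma E_fc: "E * fc f = fc f" "fc f * E = fc f"
  by (simp_all add: fc_one[symmetric] fc_mult)

end

text \<open>With \<open>card I\<close> eigenprojections the complement of their sum is a projection
  of trace zero, hence zero by faithfulness of the trace.\<close>

lemma spectral_theorem: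
  assumes I: "finite I" "supp A \<subseteq> I" and h: "star A = A"
  obtains u r where "resolution {..<card I} (\<lambda>k. proj I (u k)) (unit_op I)"
    "A = (\<Sum>k<card I. r k *\<^sub>R proj I (u k))"
proof -
  let ?n = "card I"
  obtain u r where
    H: "\<forall>i<?n. \<forall>j<?n. proj I (u i) * proj I (u j) = (if i = j then proj I (u i) else 0)"
      "\<forall>i<?n. A * proj I (u i) = r i *\<^sub>R proj I (u i) \<and> tr (proj I (u i)) = 1"
    using hermitian_eigenprojections[OF I h order_refl] by (elim exE conjE)
  note o = H(1)[rule_format] and Ap = H(2)[rule_format, THEN conjunct1]
    and tp = H(2)[rule_format, THEN conjunct2]
  define P where "P = (\<Sum>i<?n. proj I (u i))"
  have "P * P = (\<Sum>i<?n. \<Sum>j<?n. proj I (u j) * proj I (u i))"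
    by (simp add: P_def sum_distrib_left sum_distrib_right)
  also have "\<dots> = (\<Sum>i<?n. \<Sum>j<?n. if j = i then proj I (u j) else 0)"
    using o by (intro sum.cong) auto
  also have "\<dots> = P" by (simp add: P_def)
  finally have PP: "P * P = P" .
  have sP: "star P = P" by (simp add: P_def star_sum)
  have EP: "unit_op I * P = P" "P * unit_op I = P"
    by (simp_all add: P_def sum_distrib_left sum_distrib_right unit_mult[OF I(1)] mult_unit[OF I(1)] supp_proj)
  let ?F = "unit_op I - P"
  have "tr (star ?F * ?F) = 0"
    using I by (simp add: sP algebra_simps EP PP) (simp add: P_def tr_sum tr_unit tp)
  then have PE: "P = unit_op I" using rtr_star_times_self_zero[of ?F] by simp
  show thesis
  proof (rule that)
    show "resolution {..<?n} (\<lambda>k. proj I (u k)) (unit_op I)"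
      by unfold_locales (use o tp PE in \<open>auto simp: P_def\<close>)
    have "A = A * P" using I by (simp add: PE mult_unit)
    then show "A = (\<Sum>k<?n. r k *\<^sub>R proj I (u k))" by (simp add: P_def sum_distrib_left Ap)
  qed
qed

section \<open>Square-root measurements\<close>

lemma resolution_exists:
  assumes "finite I" "supp A \<subseteq> I" "star A = A"
  obtains K :: "nat set" and p r where "resolution K p (unit_op I)" "A = resolution.fc K p r"
proof -
  obtain u r where r: "resolution {..<card I} (\<lambda>k. proj I (u k)) (unit_op I)"
    "A = (\<Sum>k<card I. r k *\<^sub>R proj I (u k))" using spectral_theorem[OF assms] .
  show thesis by (rule that[OF r(1), of r]) (simp add: resolution.fc_def[OF r(1)] r(2))
qed

context resolution
begin

text \<open>Both sides are tested in the trace against the rank-one projection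
  \<open>p k\<close>.\<close>

lemma fc_lower_bound:
  assumes "c *\<^sub>R E \<le> fc r" "k \<in> K" shows "c \<le> r k"
proof -
  have "rtr (c *\<^sub>R E * p k) \<le> rtr (fc r * p k)"
    using assms p_nonneg by (intro rtr_mult_mono) auto
  moreover have "E * p k = p k"
    using assms(2) fc_mult_p[of k "\<lambda>_. 1"] by (simp add: fc_one)
  ultimately show ?thesis using assms(2) by (simp add: fc_mult_p tr_p)
qed

lemma fc_nonneg_iff: "0 \<le> fc r \<longleftrightarrow> (\<forall>k\<in>K. 0 \<le> r k)"
  using fc_lower_bound[of 0 r] fc_nonneg[of r] by auto

end

lemma nonneg_sqrt:
  assumes "finite I" "supp A \<subseteq> I" "0 \<le> A"
  obtains X where "star X = X" "X * X = A" "supp X \<subseteq> I"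
proof -
  obtain K :: "nat set" and p r where R: "resolution K p (unit_op I)" and A: "A = resolution.fc K p r"
    using resolution_exists[OF assms(1,2)] nonneg_star[OF assms(3)] by metis
  interpret resolution K p "unit_op I" by (rule R)
  let ?X = "fc (\<lambda>k. sqrt (r k))"
  have "?X * ?X = A"
    using assms(3) unfolding A fc_nonneg_iff fc_mult by (intro fc_cong) auto
  moreover have "supp ?X \<subseteq> I" by (simp add: supp_subset_iff[OF assms(1)] E_fc)
  ultimately show thesis using that star_fc by blast
qed

text \<open>This is operator monotonicity of the square root in the only instance that is needed.\<close>

lemma square_root_mono:
  assumes I: "finite I" "supp X \<subseteq> I" "supp T \<subseteq> I"
    and X: "c *\<^sub>R unit_op I \<le> X" "c > 0" and T: "0 \<le> T" and sq: "T * T \<le> X * X"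
  shows "T \<le> X"
proof -
  have Xn: "0 \<le> X"
  proof -
    have "0 \<le> c *\<^sub>R unit_op I"
      using X(2) self_nonneg[of "unit_op I"] by (simp add: scaleR_nonneg_nonneg)
    with X(1) show ?thesis by simp
  qed
  define D where "D = X - T"
  have sD: "star D = D" by (simp add: D_def nonneg_star Xn T)
  have "supp D \<subseteq> I" using I by (auto simp: supp_subset_iff D_def algebra_simps)
  then obtain K :: "nat set" and p r where R: "resolution K p (unit_op I)" and D: "D = resolution.fc K p r"
    using resolution_exists[OF I(1) _ sD] by metis
  interpret resolution K p "unit_op I" by (rule R)
  have "0 \<le> r k" if k: "k \<in> K" for k
  proof (rule ccontr)
    assume neg: "\<not> 0 \<le> r k"
    \<comment> \<open>On an eigenvector of \<open>D\<close> with negative eigenvalue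
      \<open>r k\<close>, this identity gives the trace \<open>r k\<close> times a quantity that is
      at least \<open>c > 0\<close>, contradicting \<open>T * T \<le> X * X\<close>.\<close>
    have XX: "X * X - T * T = X * D + D * T" by (simp add: D_def algebra_simps)
    have "0 \<le> rtr ((X * X - T * T) * p k)"
      using sq p_nonneg[OF k] by (intro rtr_mult_nonneg) auto
    also have "(X * X - T * T) * p k = X * (D * p k) + D * (T * p k)"
      by (simp add: XX algebra_simps)
    also have "tr \<dots> = tr (X * (D * p k)) + tr (T * (p k * D))"
      by (simp add: tr_comm[of D] mult.assoc)
    also have "\<dots> = r k * (tr (X * p k) + tr (T * p k))"
      using k by (simp add: D fc_mult_p p_mult_fc algebra_simps)
    finally have "0 \<le> r k * (rtr (X * p k) + rtr (T * p k))" by simp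
    moreover have "0 \<le> rtr (T * p k)" using T p_nonneg[OF k] by (rule rtr_mult_nonneg)
    moreover have "c \<le> rtr (X * p k)"
    proof -
      have "unit_op I * p k = p k" using k fc_mult_p[of k "\<lambda>_. 1"] by (simp add: fc_one)
      then show ?thesis using rtr_mult_mono[OF X(1) p_nonneg[OF k]] k by (simp add: tr_p)
    qed
    ultimately show False using neg X(2) by (simp add: zero_le_mult_iff)
  qed
  then have "0 \<le> D" unfolding D by (simp add: fc_nonneg_iff)
  then show ?thesis by (simp add: D_def)
qed

text \<open>\<open>T - T * T\<close> is the sum of the conjugate of \<open>1 - T\<close> by
  \<open>T\<close> and the conjugate of \<open>T\<close> by \<open>1 - T\<close>; the cubic terms
  cancel.\<close>

lemma nonneg_le_unit_square:
  assumes "finite I" "supp T \<subseteq> I" "0 \<le> T" "T \<le> unit_op I"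
  shows "T * T \<le> T"
proof -
  let ?E = "unit_op I"
  have sT: "star T = T" using assms(3) by (rule nonneg_star)
  have TE: "T * ?E = T" "?E * T = T" using assms by (simp_all add: supp_subset_iff)
  have "0 \<le> star T * (?E - T) * T + star (?E - T) * T * (?E - T)"
    using conj_mono[of 0 "?E - T" T] conj_mono[of 0 T "?E - T"] assms by simp
  also have "\<dots> = T - T * T" by (simp add: sT algebra_simps TE)
  finally show ?thesis by simp
qed

text \<open>With \<open>Z = S\<^sup>-\<^sup>1\<^sup>/\<^sup>2 - 1\<close> the left-hand side is
  \<open>(1 + Z) N (1 + Z) \<le> 2 N + 2 Z S Z\<close>, and \<open>Z S Z = (S\<^sup>1\<^sup>/\<^sup>2 - 1)\<^sup>2 = S - 2 S\<^sup>1\<^sup>/\<^sup>2 + 1\<close>.\<close>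

lemma hayashi_nagaoka:
  assumes I: "finite I" "supp X \<subseteq> I" "supp Y \<subseteq> I" "supp T \<subseteq> I" "supp N \<subseteq> I"
    and T: "0 \<le> T" "T \<le> unit_op I" and N: "0 \<le> N"
    and X: "star X = X" "star Y = Y" "X * X = T + N" "X * Y = unit_op I" "Y * X = unit_op I"
    and c: "c *\<^sub>R unit_op I \<le> X" "c > 0"
  shows "unit_op I - Y * T * Y \<le> 2 *\<^sub>R (unit_op I - T) + 4 *\<^sub>R N"
proof -
  let ?E = "unit_op I"
  define Z where "Z = Y - ?E"
  have u: "?E * X = X" "X * ?E = X" "?E * Y = Y" "Y * ?E = Y" "?E * T = T" "T * ?E = T"
    "?E * N = N" "N * ?E = N" using I by (simp_all add: supp_subset_iff)
  have sZ: "star Z = Z" by (simp add: Z_def X)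
  have Y_eq: "Y = ?E + Z" by (simp add: Z_def)
  have EZ: "?E * Z = Z" "Z * ?E = Z" by (simp_all add: Z_def algebra_simps u)
  have "Y * (T + N) * Y = (Y * X) * (X * Y)" by (simp add: X(3)[symmetric] mult.assoc)
  then have "Y * (T + N) * Y = ?E" by (simp add: X)
  then have "?E - Y * T * Y = Y * N * Y" by (simp add: algebra_simps)
  also have "\<dots> \<le> 2 *\<^sub>R N + 2 *\<^sub>R (Z * N * Z)"
  proof -
    \<comment> \<open>Parallelogram identity: the conjugates of \<open>N\<close> by
      \<open>1 + Z\<close> and \<open>1 - Z\<close> add up to \<open>2 N + 2 Z N Z\<close>, so
      dropping the second one bounds the first.\<close>
    have "0 \<le> star (?E - Z) * N * (?E - Z)" using conj_mono[OF N, of "?E - Z"] by simp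
    also have "\<dots> = 2 *\<^sub>R N + 2 *\<^sub>R (Z * N * Z) - Y * N * Y"
      unfolding Y_eq by (simp add: sZ algebra_simps u EZ scaleR_2)
    finally show ?thesis by simp
  qed
  also have "\<dots> \<le> 2 *\<^sub>R N + 2 *\<^sub>R (Z * (T + N) * Z)"
  proof -
    have "Z * N * Z \<le> Z * (T + N) * Z" using conj_mono[of N "T + N" Z] T by (simp add: sZ)
    then show ?thesis by (intro add_left_mono scaleR_left_mono) auto
  qed
  also have "Z * (T + N) * Z = (Z * X) * (X * Z)" by (simp add: X(3)[symmetric] mult.assoc)
  also have "\<dots> = ?E - 2 *\<^sub>R X + X * X"
    by (simp add: Z_def algebra_simps u X scaleR_2)
  also have "2 *\<^sub>R N + 2 *\<^sub>R (?E - 2 *\<^sub>R X + X * X) \<le> 2 *\<^sub>R N + 2 *\<^sub>R (?E - 2 *\<^sub>R T + X * X)"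
  proof -
    \<comment> \<open>\<open>T * T \<le> T \<le> T + N = X * X\<close>; by monotonicity of the root
      \<open>X\<close> may be replaced by the smaller \<open>T\<close>, which makes the bound linear
      in the tests.\<close>
    have "T * T \<le> X * X"
      using nonneg_le_unit_square[OF I(1,4) T] N by (simp add: X add_increasing2)
    from square_root_mono[OF I(1,2,4) c T(1) this] have "T \<le> X" .
    then show ?thesis
      by (intro add_left_mono scaleR_left_mono add_right_mono diff_left_mono) auto
  qed
  also have "\<dots> = 2 *\<^sub>R (?E - T) + 4 *\<^sub>R N"
    by (simp add: X(3) algebra_simps) (simp flip: scaleR_add_left)
  finally show ?thesis .
qed

text \<open>The term \<open>\<eta>\<close> makes the sum of the tests invertible.\<close>

lemma square_root_measurement:
  fixes T :: "'m \<Rightarrow> 'a op"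
  assumes I: "finite I" and M: "finite M" "M \<noteq> {}" and \<eta>: "\<eta> > 0"
    and T: "\<And>m. m \<in> M \<Longrightarrow> supp (T m) \<subseteq> I" "\<And>m. m \<in> M \<Longrightarrow> 0 \<le> T m" "\<And>m. m \<in> M \<Longrightarrow> T m \<le> unit_op I"
  obtains L where "\<And>m. m \<in> M \<Longrightarrow> 0 \<le> L m" "\<And>m. m \<in> M \<Longrightarrow> supp (L m) \<subseteq> I" "(\<Sum>m\<in>M. L m) = unit_op I"
    "\<And>m. m \<in> M \<Longrightarrow> unit_op I - L m \<le>
       2 *\<^sub>R (unit_op I - T m) + 4 *\<^sub>R ((\<Sum>m'\<in>M - {m}. T m') + \<eta> *\<^sub>R unit_op I)"
proof -
  let ?E = "unit_op I"
  have E0: "0 \<le> ?E" using self_nonneg[of ?E] by simp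
  define S where "S = (\<Sum>m\<in>M. T m) + \<eta> *\<^sub>R ?E"
  have uT: "?E * T m = T m" "T m * ?E = T m" if "m \<in> M" for m
    using T(1)[OF that] I by (simp_all add: supp_subset_iff)
  have ES: "?E * S = S" "S * ?E = S" by (simp_all add: S_def algebra_simps sum_distrib_left
      sum_distrib_right uT)
  have S0: "\<eta> *\<^sub>R ?E \<le> S" using T(2) by (simp add: S_def sum_nonneg)
  have "0 \<le> S" using S0 \<eta> E0 by (meson order_trans scaleR_nonneg_nonneg less_imp_le)
  then have "star S = S" by (rule nonneg_star)
  then obtain K :: "nat set" and p r where R: "resolution K p ?E" and S: "S = resolution.fc K p r"
    using resolution_exists[OF I, of S] ES I by (metis supp_subset_iff)
  interpret resolution K p ?E by (rule R)
  have r: "\<eta> \<le> r k" if "k \<in> K" for k using fc_lower_bound that S0 S by metis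
  have r0: "0 < r k" if "k \<in> K" for k using r[OF that] \<eta> by simp
  define X where "X = fc (\<lambda>k. sqrt (r k))"
  define Y where "Y = fc (\<lambda>k. 1 / sqrt (r k))"
  have XX: "X * X = S" unfolding X_def S fc_mult by (rule fc_cong) (use r0 in \<open>auto simp: less_imp_le\<close>)
  have XY: "X * Y = ?E" "Y * X = ?E"
    unfolding X_def Y_def fc_mult fc_one[symmetric] by (rule fc_cong, use r0 in force)+
  have Xc: "sqrt \<eta> *\<^sub>R ?E \<le> X"
    unfolding X_def fc_one[symmetric] fc_scaleR by (rule fc_mono) (use r in auto)
  have sX: "star X = X" "star Y = Y" unfolding X_def Y_def by (simp_all add: star_fc)
  have uX: "?E * X = X" "X * ?E = X" "?E * Y = Y" "Y * ?E = Y" by (simp_all add: X_def Y_def E_fc)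
  define L where "L m = Y * T m * Y" for m
  have L0: "0 \<le> L m" if "m \<in> M" for m
    using conj_mono[OF T(2)[OF that], of Y] by (simp add: L_def sX)
  have uL: "?E * L m = L m" "L m * ?E = L m" for m
    by (simp_all add: L_def uX mult.assoc) (simp add: uX flip: mult.assoc)
  have Lle: "(\<Sum>m\<in>M. L m) \<le> ?E"
  proof -
    have "(\<Sum>m\<in>M. L m) = Y * (\<Sum>m\<in>M. T m) * Y"
      by (simp add: L_def sum_distrib_left sum_distrib_right)
    also have "\<dots> \<le> Y * S * Y"
      using conj_mono[of "\<Sum>m\<in>M. T m" S Y] \<eta> E0 by (simp add: sX S_def scaleR_nonneg_nonneg)
    also have "\<dots> = (Y * X) * (X * Y)" by (simp add: XX[symmetric] mult.assoc)
    also have "\<dots> = ?E" by (simp add: XY)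
    finally show ?thesis .
  qed
  have HN: "?E - L m \<le> 2 *\<^sub>R (?E - T m) + 4 *\<^sub>R ((\<Sum>m'\<in>M - {m}. T m') + \<eta> *\<^sub>R ?E)" if m: "m \<in> M" for m
    unfolding L_def
  proof (rule hayashi_nagaoka[where X = X and c = "sqrt \<eta>"])
    let ?N = "(\<Sum>m'\<in>M - {m}. T m') + \<eta> *\<^sub>R ?E"
    show "supp X \<subseteq> I" "supp Y \<subseteq> I" "supp (T m) \<subseteq> I" using uX T(1) m I by (auto simp: supp_subset_iff)
    show "supp ?N \<subseteq> I" using I uT
      by (simp add: supp_subset_iff algebra_simps sum_distrib_left sum_distrib_right)
    show "0 \<le> ?N" using T(2) \<eta> E0 by (intro add_nonneg_nonneg sum_nonneg scaleR_nonneg_nonneg) auto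
    show "X * X = T m + ?N"
      unfolding XX S_def using M(1) m by (simp add: sum.remove[of M m])
  qed (use I T m sX XY Xc \<eta> in auto)
  \<comment> \<open>The square-root elements sum only to something below the identity. Giving the
    deficit to one outcome completes the measurement, and enlarging an element can only lower its
    miss operator.\<close>
  obtain m0 where m0: "m0 \<in> M" using M by blast
  define L' where "L' m = L m + (if m = m0 then ?E - (\<Sum>m\<in>M. L m) else 0)" for m
  have LL: "L m \<le> L' m" for m using Lle by (simp add: L'_def)
  show thesis
  proof (rule that)
    fix m assume m: "m \<in> M"
    show "0 \<le> L' m" using L0[OF m] LL[of m] by simp
    show "supp (L' m) \<subseteq> I"
      using I by (simp add: supp_subset_iff L'_def algebra_simps uL sum_distrib_left sum_distrib_right)
    have "?E - L' m \<le> ?E - L m" using LL by simp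
    with HN[OF m] show "?E - L' m \<le> 2 *\<^sub>R (?E - T m) + 4 *\<^sub>R ((\<Sum>m'\<in>M - {m}. T m') + \<eta> *\<^sub>R ?E)"
      by (rule order_trans[rotated])
  next
    show "(\<Sum>m\<in>M. L' m) = ?E" using M(1) m0 by (simp add: L'_def sum.distrib)
  qed
qed

section \<open>Nested tests and random superposition codes\<close>

definition is_proj :: "'a set \<Rightarrow> 'a op \<Rightarrow> bool" where
  "is_proj I Q \<longleftrightarrow> supp Q \<subseteq> I \<and> star Q = Q \<and> Q * Q = Q"

lemma unit_nonneg: "0 \<le> unit_op I"
  using self_nonneg[of "unit_op I"] by simp

lemma is_proj_unit: "is_proj I (unit_op I)"
  by (simp add: is_proj_def supp_unit)

lemma
  assumes I: "finite I" and Q: "is_proj I Q"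
  shows is_proj_nonneg: "0 \<le> Q" and is_proj_le: "Q \<le> unit_op I"
    and is_proj_compl: "is_proj I (unit_op I - Q)"
proof -
  have u: "unit_op I * Q = Q" "Q * unit_op I = Q" and s: "star Q = Q" "Q * Q = Q"
    using Q I by (auto simp: is_proj_def supp_subset_iff)
  show "0 \<le> Q" using self_nonneg[of Q] by (simp add: s)
  show c: "is_proj I (unit_op I - Q)"
    using I by (simp add: is_proj_def supp_subset_iff algebra_simps u s)
  have "star (unit_op I - Q) * (unit_op I - Q) = unit_op I - Q"
    using c by (simp add: is_proj_def)
  then show "Q \<le> unit_op I" using self_nonneg[of "unit_op I - Q"] by simp
qed

text \<open>Gentle measurement in a linear form: expanding \<open>Q = 1 - (1 - Q)\<close> in \<open>Q (1 - B) Q\<close> costs only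
  constant factors and no square root.\<close>

lemma
  assumes I: "finite I" and Q: "is_proj I Q" and B: "supp B \<subseteq> I" "0 \<le> B" "B \<le> unit_op I"
  shows sandwich_nonneg: "0 \<le> Q * B * Q" and sandwich_le: "Q * B * Q \<le> unit_op I"
    and sandwich_supp: "supp (Q * B * Q) \<subseteq> I"
    and sandwich_compl: "unit_op I - Q * B * Q \<le> 3 *\<^sub>R (unit_op I - Q) + 2 *\<^sub>R (unit_op I - B)"
proof -
  let ?E = "unit_op I" and ?C = "unit_op I - Q"
  have u: "?E * Q = Q" "Q * ?E = Q" "?E * B = B" "B * ?E = B" and s: "star Q = Q" "Q * Q = Q"
    using Q B I by (auto simp: is_proj_def supp_subset_iff)
  show "0 \<le> Q * B * Q" using conj_mono[OF B(2), of Q] by (simp add: s)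
  have "Q * B * Q \<le> Q * ?E * Q" using conj_mono[OF B(3), of Q] by (simp add: s)
  also have "\<dots> \<le> ?E" using is_proj_le[OF I Q] by (simp add: u s)
  finally show "Q * B * Q \<le> ?E" .
  show "supp (Q * B * Q) \<subseteq> I"
    using I by (simp add: supp_subset_iff u mult.assoc) (simp add: u flip: mult.assoc)
  define A where "A = ?E - B"
  have uA: "?E * A = A" "A * ?E = A" by (simp_all add: A_def algebra_simps u)
  have A: "0 \<le> A" "A \<le> ?E" using B by (simp_all add: A_def)
  have sC: "star ?C = ?C" "?C * ?C = ?C" using is_proj_compl[OF I Q] by (auto simp: is_proj_def)
  \<comment> \<open>Parallelogram identity again, with \<open>1 - ?C = Q\<close>: the cross terms
    between \<open>Q\<close> and its complement cancel.\<close>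
  have "0 \<le> star (?E + ?C) * A * (?E + ?C)" using conj_mono[OF A(1), of "?E + ?C"] by simp
  also have "\<dots> = 2 *\<^sub>R A + 2 *\<^sub>R (?C * A * ?C) - Q * A * Q"
    by (simp add: s algebra_simps u uA scaleR_2)
  finally have "Q * A * Q \<le> 2 *\<^sub>R A + 2 *\<^sub>R (?C * A * ?C)" by simp
  also have "\<dots> \<le> 2 *\<^sub>R A + 2 *\<^sub>R ?C"
  proof -
    have "?C * A * ?C \<le> ?C * ?E * ?C" using conj_mono[OF A(2), of ?C] by (simp only: sC)
    also have "\<dots> = ?C" by (simp add: algebra_simps u s)
    finally show ?thesis by (intro add_left_mono scaleR_left_mono) auto
  qed
  finally have *: "Q * A * Q \<le> 2 *\<^sub>R A + 2 *\<^sub>R ?C" .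
  have "?E - Q * B * Q = ?C + Q * A * Q" by (simp add: A_def algebra_simps u s)
  also have "\<dots> \<le> ?C + (2 *\<^sub>R A + 2 *\<^sub>R ?C)" using * by (rule add_left_mono)
  also have "\<dots> = 3 *\<^sub>R ?C + 2 *\<^sub>R A"
    using scaleR_add_left[of 1 2 ?C] by (simp add: add_ac)
  finally show "?E - Q * B * Q \<le> 3 *\<^sub>R ?C + 2 *\<^sub>R (?E - B)" by (simp add: A_def)
qed

text \<open>\<open>Q\<close> is outermost so that cyclicity can place it around the average state,
  and \<open>R\<close> encloses \<open>P\<close> directly so that it sandwiches the conditional
  state which averaging \<open>P\<close> produces.\<close>

definition nested_test :: "'a op \<Rightarrow> 'a op \<Rightarrow> 'a op \<Rightarrow> 'a op" where
  "nested_test Q R P = Q * (R * P * R) * Q"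

text \<open>The sandwich bound is applied twice; the outer application scales the inner one by 2,
  whence the constants 3, 2 * 3 and 2 * 2.\<close>

lemma
  assumes I: "finite I" and Q: "is_proj I Q" and R: "is_proj I R" and P: "is_proj I P"
  shows nested_test_nonneg: "0 \<le> nested_test Q R P"
    and nested_test_le: "nested_test Q R P \<le> unit_op I"
    and nested_test_supp: "supp (nested_test Q R P) \<subseteq> I"
    and nested_test_compl: "unit_op I - nested_test Q R P \<le>
      3 *\<^sub>R (unit_op I - Q) + 6 *\<^sub>R (unit_op I - R) + 4 *\<^sub>R (unit_op I - P)"
proof -
  let ?E = "unit_op I"
  have P': "supp P \<subseteq> I" "0 \<le> P" "P \<le> ?E"
    using P is_proj_nonneg[OF I P] is_proj_le[OF I P] by (auto simp: is_proj_def)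
  note RPR = sandwich_supp[OF I R P'] sandwich_nonneg[OF I R P'] sandwich_le[OF I R P']
  show "0 \<le> nested_test Q R P" "nested_test Q R P \<le> ?E" "supp (nested_test Q R P) \<subseteq> I"
    unfolding nested_test_def using sandwich_nonneg[OF I Q RPR] sandwich_le[OF I Q RPR]
      sandwich_supp[OF I Q RPR] by auto
  have "?E - nested_test Q R P \<le> 3 *\<^sub>R (?E - Q) + 2 *\<^sub>R (?E - R * P * R)"
    unfolding nested_test_def by (rule sandwich_compl[OF I Q RPR])
  also have "\<dots> \<le> 3 *\<^sub>R (?E - Q) + 2 *\<^sub>R (3 *\<^sub>R (?E - R) + 2 *\<^sub>R (?E - P))"
    using sandwich_compl[OF I R P'] by (intro add_left_mono scaleR_left_mono) auto
  also have "\<dots> = 3 *\<^sub>R (?E - Q) + 6 *\<^sub>R (?E - R) + 4 *\<^sub>R (?E - P)"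
    by (simp add: scaleR_add_right add.assoc)
  finally show "?E - nested_test Q R P \<le> 3 *\<^sub>R (?E - Q) + 6 *\<^sub>R (?E - R) + 4 *\<^sub>R (?E - P)" .
qed

text \<open>Cyclicity moves both copies of \<open>Q\<close> onto the state, which is then at most
  \<open>c\<close>; the remaining trace of \<open>R * P * R\<close> is at most that of
  \<open>P\<close>. It handles wrong cloud centres, where the state is the average one.\<close>

lemma rtr_nested_test_le:
  assumes I: "finite I" and Q: "is_proj I Q" and R: "is_proj I R" and P: "is_proj I P"
    and c: "Q * \<rho> * Q \<le> c *\<^sub>R unit_op I" "0 \<le> c"
  shows "rtr (nested_test Q R P * \<rho>) \<le> c * rtr P"
proof -
  let ?B = "R * P * R"
  have u: "P * unit_op I = P" "unit_op I * P = P" "unit_op I * R = R" and sR: "star R = R" "R * R = R"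
    using P R I by (auto simp: is_proj_def supp_subset_iff)
  have B: "0 \<le> ?B"
    using conj_mono[OF is_proj_nonneg[OF I P], of R] by (simp add: sR)
  have "tr (nested_test Q R P * \<rho>) = tr ((Q * \<rho> * Q) * ?B)"
    unfolding nested_test_def by (metis mult.assoc tr_comm)
  also have "Re \<dots> \<le> rtr (c *\<^sub>R unit_op I * ?B)" using c B by (intro rtr_mult_mono)
  also have "\<dots> = c * rtr (unit_op I * ?B)" by simp
  also have "tr (unit_op I * ?B) = tr (R * (P * R))" by (simp add: u flip: mult.assoc)
  also have "\<dots> = tr (R * P)" by (subst tr_comm) (simp add: mult.assoc sR tr_comm[of P])
  also have "c * Re \<dots> \<le> c * rtr (unit_op I * P)"
    using is_proj_le[OF I R] is_proj_nonneg[OF I P] c by (intro mult_left_mono rtr_mult_mono)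
  finally show ?thesis by (simp add: u)
qed

text \<open>Bounding \<open>P x\<close> by \<open>a \<rho> x\<close> lets the average over \<open>x\<close> produce the state \<open>\<sigma>\<close> between the two copies
  of \<open>R\<close>, which sidesteps that \<open>Q\<close> and \<open>R\<close> need not commute.\<close>

lemma rtr_nested_test_average_le:
  assumes I: "finite I" and Q: "is_proj I Q" and R: "is_proj I R"
    and P: "\<And>x. x \<in> X \<Longrightarrow> P x \<le> a *\<^sub>R \<rho> x" and q: "\<And>x. x \<in> X \<Longrightarrow> 0 \<le> q x"
    and b: "R * (\<Sum>x\<in>X. q x *\<^sub>R \<rho> x) * R \<le> b *\<^sub>R unit_op I" and ab: "0 \<le> a" "0 \<le> b"
    and \<sigma>: "0 \<le> \<sigma>" "supp \<sigma> \<subseteq> I"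
  shows "(\<Sum>x\<in>X. q x * rtr (nested_test Q R (P x) * \<sigma>)) \<le> a * b * rtr \<sigma>"
proof -
  let ?E = "unit_op I"
  have s: "star Q = Q" "Q * Q = Q" "star R = R" and u: "Q * ?E = Q" "?E * \<sigma> = \<sigma>"
    using Q R \<sigma> I by (auto simp: is_proj_def supp_subset_iff)
  have "(\<Sum>x\<in>X. q x *\<^sub>R nested_test Q R (P x)) = Q * (R * (\<Sum>x\<in>X. q x *\<^sub>R P x) * R) * Q"
    by (simp add: nested_test_def sum_distrib_left sum_distrib_right)
  also have "\<dots> \<le> Q * (R * (a *\<^sub>R (\<Sum>x\<in>X. q x *\<^sub>R \<rho> x)) * R) * Q"
  proof -
    have "(\<Sum>x\<in>X. q x *\<^sub>R P x) \<le> (\<Sum>x\<in>X. q x *\<^sub>R (a *\<^sub>R \<rho> x))"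
      using P q by (intro sum_mono scaleR_left_mono)
    also have "\<dots> = a *\<^sub>R (\<Sum>x\<in>X. q x *\<^sub>R \<rho> x)"
      by (simp add: scaleR_sum_right mult.commute)
    finally have "star R * (\<Sum>x\<in>X. q x *\<^sub>R P x) * R \<le> star R * (a *\<^sub>R (\<Sum>x\<in>X. q x *\<^sub>R \<rho> x)) * R"
      by (rule conj_mono)
    from conj_mono[OF this, of Q] show ?thesis by (simp only: s)
  qed
  also have "\<dots> = a *\<^sub>R (Q * (R * (\<Sum>x\<in>X. q x *\<^sub>R \<rho> x) * R) * Q)" by simp
  also have "\<dots> \<le> a *\<^sub>R (Q * (b *\<^sub>R ?E) * Q)"
    using conj_mono[OF b, of Q] ab by (intro scaleR_left_mono) (simp_all only: s)
  also have "\<dots> = (a * b) *\<^sub>R Q" by (simp add: u s)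
  also have "\<dots> \<le> (a * b) *\<^sub>R ?E"
    using is_proj_le[OF I Q] ab by (intro scaleR_left_mono) auto
  finally have "rtr ((\<Sum>x\<in>X. q x *\<^sub>R nested_test Q R (P x)) * \<sigma>) \<le> rtr ((a * b) *\<^sub>R ?E * \<sigma>)"
    using \<sigma>(1) by (rule rtr_mult_mono)
  then show ?thesis by (simp add: sum_distrib_right tr_sum u)
qed

section \<open>Averages over independent draws, as finite sums\<close>

definition expect :: "'j set \<Rightarrow> 'a set \<Rightarrow> ('a \<Rightarrow> real) \<Rightarrow> (('j \<Rightarrow> 'a) \<Rightarrow> real) \<Rightarrow> real" where
  "expect J A q f = (\<Sum>g\<in>PiE J (\<lambda>_. A). (\<Prod>j\<in>J. q (g j)) * f g)"

lemma expect_add: "expect J A q (\<lambda>g. f g + h g) = expect J A q f + expect J A q h"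
  by (simp add: expect_def distrib_left sum.distrib)

lemma expect_sum: "expect J A q (\<lambda>g. \<Sum>k\<in>S. f k g) = (\<Sum>k\<in>S. expect J A q (f k))"
  by (simp add: expect_def sum_distrib_left) (rule sum.swap)

lemma expect_cmult: "expect J A q (\<lambda>g. c * f g) = c * expect J A q f"
  by (simp add: expect_def sum_distrib_left mult_ac)

lemma mult_if_zero:
  fixes x y :: real
  shows "x * (if b then y else 0) = (if b then x * y else 0)" "(if b then y else 0) * x = (if b then y
      * x else 0)"
  by simp_all

text \<open>Coordinates outside \<open>D\<close> sum to 1 and drop out. A function of finitely many
  coordinates is a combination of such indicators, so one-point and two-point averages both follow
  from this.\<close>

lemma expect_indicator:
  assumes "finite J" "finite A" "(\<Sum>a\<in>A. q a) = 1" "D \<subseteq> J" "\<And>k. k \<in> D \<Longrightarrow> t k \<in> A"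
  shows "expect J A q (\<lambda>g. \<Prod>k\<in>D. if g k = t k then 1 else 0) = (\<Prod>k\<in>D. q (t k))"
proof -
  let ?h = "\<lambda>k a. q a * (if k \<in> D then if a = t k then 1 else 0 else 1)"
  have D: "D = {j \<in> J. j \<in> D}" using assms by auto
  have "expect J A q (\<lambda>g. \<Prod>k\<in>D. if g k = t k then 1 else 0) = (\<Sum>g\<in>PiE J (\<lambda>_. A). \<Prod>j\<in>J. ?h j (g j))"
    unfolding expect_def prod.distrib
    by (intro sum.cong refl arg_cong2[of _ _ _ _ "(*)"], subst (1) D, subst prod.inter_filter)
      (use assms in auto)
  also have "\<dots> = (\<Prod>j\<in>J. \<Sum>a\<in>A. ?h j a)"
    using assms by (subst prod_sum_PiE) auto
  also have "\<dots> = (\<Prod>j\<in>J. if j \<in> D then q (t j) else 1)"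
    using assms by (intro prod.cong refl) (auto simp: mult_if_zero)
  also have "\<dots> = (\<Prod>k\<in>D. q (t k))"
    by (subst (2) D, subst prod.inter_filter) (use assms in auto)
  finally show ?thesis .
qed

lemma expect_one:
  assumes "finite J" "finite A" "(\<Sum>a\<in>A. q a) = 1" "i \<in> J"
  shows "expect J A q (\<lambda>g. F (g i)) = (\<Sum>a\<in>A. q a * F a)"
proof -
  have "expect J A q (\<lambda>g. F (g i)) = expect J A q (\<lambda>g. \<Sum>a\<in>A. F a * (\<Prod>k\<in>{i}. if g k = a then 1 else 0))"
    unfolding expect_def using assms(2,4) by (intro sum.cong) (auto simp: PiE_def Pi_def mult_if_zero)
  also have "\<dots> = (\<Sum>a\<in>A. F a * expect J A q (\<lambda>g. \<Prod>k\<in>{i}. if g k = a then 1 else 0))"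
    by (simp only: expect_sum expect_cmult)
  also have "\<dots> = (\<Sum>a\<in>A. F a * q a)"
    using assms by (intro sum.cong refl, subst expect_indicator[where t = "\<lambda>_. _"]) auto
  finally show ?thesis by (simp add: mult.commute)
qed

text \<open>Independence of distinct draws. Pairs are enough for random coding because the error
  bound is a sum over pairs of messages.\<close>

lemma expect_two:
  assumes "finite J" "finite A" "(\<Sum>a\<in>A. q a) = 1" "i \<in> J" "j \<in> J" "i \<noteq> j"
  shows "expect J A q (\<lambda>g. F (g i) (g j)) = (\<Sum>a\<in>A. q a * (\<Sum>b\<in>A. q b * F a b))"
proof -
  let ?t = "\<lambda>a b k. if k = i then a else b"
  have "expect J A q (\<lambda>g. F (g i) (g j)) =
      expect J A q (\<lambda>g. \<Sum>a\<in>A. \<Sum>b\<in>A. F a b * (\<Prod>k\<in>{i, j}. if g k = ?t a b k then 1 else 0))"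
    unfolding expect_def using assms(2,4,5,6)
    by (intro sum.cong) (auto simp: PiE_def Pi_def mult_if_zero)
  also have "\<dots> = (\<Sum>a\<in>A. \<Sum>b\<in>A. F a b * expect J A q (\<lambda>g. \<Prod>k\<in>{i, j}. if g k = ?t a b k then 1 else 0))"
    by (simp only: expect_sum expect_cmult)
  also have "\<dots> = (\<Sum>a\<in>A. \<Sum>b\<in>A. F a b * (q a * q b))"
  proof (intro sum.cong refl)
    fix a b assume ab: "a \<in> A" "b \<in> A"
    have "expect J A q (\<lambda>g. \<Prod>k\<in>{i, j}. if g k = ?t a b k then 1 else 0) = (\<Prod>k\<in>{i, j}. q (?t a b k))"
      using assms ab by (intro expect_indicator) auto
    then show "F a b * expect J A q (\<lambda>g. \<Prod>k\<in>{i, j}. if g k = ?t a b k then 1 else 0) = F a b * (q a * q b)"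
      using assms(6) by simp
  qed
  finally show ?thesis by (simp add: sum_distrib_left mult_ac)
qed

lemma expect_const:
  assumes "finite J" "finite A" "(\<Sum>a\<in>A. q a) = 1"
  shows "expect J A q (\<lambda>_. c) = c"
  using expect_cmult[of J A q c "\<lambda>_. 1"] expect_indicator[OF assms, of "{}"] by simp

lemma ex_le_average:
  fixes \<mu> f :: "'a \<Rightarrow> real"
  assumes "finite A" "\<And>a. a \<in> A \<Longrightarrow> 0 \<le> \<mu> a" "(\<Sum>a\<in>A. \<mu> a) = 1" "(\<Sum>a\<in>A. \<mu> a * f a) \<le> B"
  shows "\<exists>a\<in>A. f a \<le> B"
proof (rule ccontr)
  assume "\<not> ?thesis"
  then have gt: "B < f a" if "a \<in> A" for a using that by (auto simp: not_le)
  \<comment> \<open>Strictness has to be witnessed at an outcome of positive weight.\<close>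
  obtain a0 where a0: "a0 \<in> A" "0 < \<mu> a0"
  proof -
    have "\<exists>a\<in>A. \<mu> a \<noteq> 0" using assms(3) by (metis sum.neutral zero_neq_one)
    then show thesis using that assms(2) by (metis less_eq_real_def)
  qed
  have "(\<Sum>a\<in>A. \<mu> a * B) < (\<Sum>a\<in>A. \<mu> a * f a)"
    using assms(1) gt[THEN less_imp_le] assms(2) gt a0
    by (intro sum_strict_mono_ex1 bexI[of _ a0]) (auto intro: mult_left_mono)
  then show False using assms(3,4) by (simp flip: sum_distrib_right)
qed

lemma sum_add_sum_swap:
  fixes f :: "'a \<Rightarrow> real"
  shows "(\<Sum>i\<in>T. f i) + (\<Sum>j\<in>S. \<Sum>i\<in>T. h j i) = (\<Sum>i\<in>T. f i + (\<Sum>j\<in>S. h j i))"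
  by (subst sum.swap) (simp add: sum.distrib)

text \<open>\<open>G\<close> stands for the error of the sent codeword itself, \<open>H1\<close> for
  confusion with another satellite of its cloud, \<open>H2\<close> for confusion with a satellite of
  another cloud, and \<open>H3\<close> for Receiver 2 taking another cloud for the right one. Their
  average bounds enter with the number of confusions of each kind.\<close>

lemma superposition_code_exists:
  fixes p :: "'w \<Rightarrow> real" and q :: "'w \<Rightarrow> 'x \<Rightarrow> real"
  assumes fin: "finite W" "finite X" and p: "\<And>w. w \<in> W \<Longrightarrow> 0 \<le> p w" "(\<Sum>w\<in>W. p w) = 1"
    and q: "\<And>w x. w \<in> W \<Longrightarrow> x \<in> X \<Longrightarrow> 0 \<le> q w x" "\<And>w. w \<in> W \<Longrightarrow> (\<Sum>x\<in>X. q w x) = 1"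
    and EG: "(\<Sum>w\<in>W. p w * (\<Sum>x\<in>X. q w x * G w x)) \<le> g"
    and EH1: "(\<Sum>w\<in>W. p w * (\<Sum>x\<in>X. q w x * (\<Sum>x'\<in>X. q w x' * H1 w x x'))) \<le> h1"
    and EH2: "(\<Sum>w'\<in>W. p w' * (\<Sum>x'\<in>X. q w' x' * (\<Sum>w\<in>W. p w * (\<Sum>x\<in>X. q w x * H2 w' x' x)))) \<le> h2"
    and EH3: "(\<Sum>w'\<in>W. p w' * (\<Sum>w\<in>W. p w * (\<Sum>x\<in>X. q w x * H3 w' x))) \<le> h3"
    and M: "1 \<le> M" "1 \<le> M1"
  obtains w x where "\<And>m. m < M \<Longrightarrow> w m \<in> W" "\<And>m m1. m < M \<Longrightarrow> m1 < M1 \<Longrightarrow> x m m1 \<in> X"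
    "(\<Sum>m<M. \<Sum>m1<M1. G (w m) (x m m1) + (\<Sum>m1'\<in>{..<M1} - {m1}. H1 (w m) (x m m1) (x m m1'))
       + (\<Sum>m'\<in>{..<M} - {m}. (\<Sum>m1'<M1. H2 (w m') (x m' m1') (x m m1)) + H3 (w m') (x m m1)))
     \<le> real M * real M1 * (g + real (M1 - 1) * h1 + real (M - 1) * (real M1 * h2 + h3))"
proof -
  \<comment> \<open>A cloud centre together with all its satellites is one letter of distribution
    \<open>\<mu>\<close>; satellites are independent only given the centre, whereas whole clouds are
    independent draws.\<close>
  define C where "C = W \<times> PiE {..<M1} (\<lambda>_. X)"
  define \<mu> where "\<mu> c = p (fst c) * (\<Prod>m1<M1. q (fst c) (snd c m1))" for c
  have finC: "finite C" using fin by (simp add: C_def finite_PiE)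
  have \<mu>0: "0 \<le> \<mu> c" if "c \<in> C" for c
    using that p q by (auto simp: C_def \<mu>_def PiE_def Pi_def intro!: mult_nonneg_nonneg prod_nonneg)
  have avC: "(\<Sum>c\<in>C. \<mu> c * f c) = (\<Sum>w\<in>W. p w * expect {..<M1} X (q w) (\<lambda>xs. f (w, xs)))" for f
    unfolding C_def \<mu>_def expect_def
    by (simp add: sum.cartesian_product' sum_distrib_left mult.assoc)
  have \<mu>1: "(\<Sum>c\<in>C. \<mu> c) = 1"
    using avC[of "\<lambda>_. 1"] fin q p by (simp add: expect_const)
  note e1 = expect_one[OF _ fin(2) q(2)] and e2 = expect_two[OF _ fin(2) q(2)]
  define G' where "G' c = (\<Sum>m1<M1. G (fst c) (snd c m1) + (\<Sum>m1'\<in>{..<M1} - {m1}. H1 (fst c) (snd c m1)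
      (snd c m1')))" for c
  define H' where "H' c' c = (\<Sum>m1<M1. (\<Sum>m1'<M1. H2 (fst c') (snd c' m1') (snd c m1)) + H3 (fst c') (snd c m1))"
    for c' c :: "'w \<times> (nat \<Rightarrow> 'x)"
  have EG': "(\<Sum>c\<in>C. \<mu> c * G' c) \<le> real M1 * (g + real (M1 - 1) * h1)"
  proof -
    have "(\<Sum>c\<in>C. \<mu> c * G' c) = (\<Sum>w\<in>W. p w * (\<Sum>m1<M1. (\<Sum>x\<in>X. q w x * G w x)
        + (\<Sum>m1'\<in>{..<M1} - {m1}. \<Sum>x\<in>X. q w x * (\<Sum>x'\<in>X. q w x' * H1 w x x'))))"
      unfolding avC G'_def fst_conv snd_conv expect_sum expect_add
    proof (intro sum.cong refl arg_cong2[of _ _ _ _ "(*)"] arg_cong2[of _ _ _ _ "(+)"])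
      fix w m1 assume "w \<in> W" "m1 \<in> {..<M1}"
      then show "expect {..<M1} X (q w) (\<lambda>xs. G w (xs m1)) = (\<Sum>x\<in>X. q w x * G w x)"
        by (intro e1) auto
      fix m1' assume "m1' \<in> {..<M1} - {m1}"
      then show "expect {..<M1} X (q w) (\<lambda>xs. H1 w (xs m1) (xs m1')) =
          (\<Sum>x\<in>X. q w x * (\<Sum>x'\<in>X. q w x' * H1 w x x'))"
        using \<open>w \<in> W\<close> \<open>m1 \<in> {..<M1}\<close> by (intro e2) auto
    qed
    also have "\<dots> = real M1 * ((\<Sum>w\<in>W. p w * (\<Sum>x\<in>X. q w x * G w x)) +
        real (M1 - 1) * (\<Sum>w\<in>W. p w * (\<Sum>x\<in>X. q w x * (\<Sum>x'\<in>X. q w x' * H1 w x x'))))"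
      using M by (simp add: sum_distrib_left sum.distrib distrib_left mult_ac of_nat_diff)
    also have "\<dots> \<le> real M1 * (g + real (M1 - 1) * h1)"
      using EG EH1 by (intro mult_left_mono add_mono) auto
    finally show ?thesis .
  qed
  have EH': "(\<Sum>c'\<in>C. \<mu> c' * (\<Sum>c\<in>C. \<mu> c * H' c' c)) \<le> real M1 * (real M1 * h2 + h3)"
  proof -
    define a where "a w' x' = (\<Sum>w\<in>W. p w * (\<Sum>x\<in>X. q w x * H2 w' x' x))" for w' x'
    define b where "b w' = (\<Sum>w\<in>W. p w * (\<Sum>x\<in>X. q w x * H3 w' x))" for w'
    have in1: "(\<Sum>c\<in>C. \<mu> c * H' c' c) = real M1 * ((\<Sum>m1'<M1. a (fst c') (snd c' m1')) + b (fst c'))" for c'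
    proof -
      have "(\<Sum>c\<in>C. \<mu> c * H' c' c) = (\<Sum>w\<in>W. p w * (\<Sum>m1<M1.
          (\<Sum>m1'<M1. \<Sum>x\<in>X. q w x * H2 (fst c') (snd c' m1') x) + (\<Sum>x\<in>X. q w x * H3 (fst c') x)))"
        unfolding avC H'_def fst_conv snd_conv expect_sum expect_add
        by (intro sum.cong refl arg_cong2[of _ _ _ _ "(*)"] arg_cong2[of _ _ _ _ "(+)"] e1) auto
      also have "\<dots> = real M1 * ((\<Sum>m1'<M1. a (fst c') (snd c' m1')) + b (fst c'))"
        by (simp add: a_def b_def sum_distrib_left sum.distrib distrib_left mult_ac)
          (subst sum.swap, simp add: mult_ac)
      finally show ?thesis .
    qed
    have "(\<Sum>c'\<in>C. \<mu> c' * (\<Sum>c\<in>C. \<mu> c * H' c' c)) =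
        (\<Sum>w'\<in>W. p w' * (real M1 * ((\<Sum>m1'<M1. \<Sum>x'\<in>X. q w' x' * a w' x') + b w')))"
      unfolding in1 avC fst_conv snd_conv expect_cmult expect_sum expect_add
      by (intro sum.cong refl arg_cong2[of _ _ _ _ "(*)"] arg_cong2[of _ _ _ _ "(+)"] e1 expect_const)
        (auto simp: fin q)
    also have "\<dots> = real M1 * (real M1 * (\<Sum>w'\<in>W. p w' * (\<Sum>x'\<in>X. q w' x' * a w' x')) + (\<Sum>w'\<in>W. p w' * b w'))"
      by (simp add: distrib_left sum.distrib sum_distrib_left mult_ac)
    also have "\<dots> \<le> real M1 * (real M1 * h2 + h3)"
      using EH2 EH3 unfolding a_def b_def by (intro mult_left_mono add_mono) auto
    finally show ?thesis .
  qed
  \<comment> \<open>The code's total loss, grouped by clouds: \<open>G'\<close> sees one cloud,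
    \<open>H'\<close> a pair of distinct clouds, so one-point and two-point averages over
    \<open>C\<close> suffice.\<close>
  let ?F = "\<lambda>c. \<Sum>m<M. G' (c m) + (\<Sum>m'\<in>{..<M} - {m}. H' (c m') (c m))"
  have "expect {..<M} C \<mu> ?F = (\<Sum>m<M. (\<Sum>c\<in>C. \<mu> c * G' c) +
      (\<Sum>m'\<in>{..<M} - {m}. \<Sum>c'\<in>C. \<mu> c' * (\<Sum>c\<in>C. \<mu> c * H' c' c)))"
    unfolding expect_sum expect_add
    by (intro sum.cong refl arg_cong2[of _ _ _ _ "(+)"] expect_one expect_two) (use finC \<mu>1 in auto)
  also have "\<dots> = real M * ((\<Sum>c\<in>C. \<mu> c * G' c) + real (M - 1) * (\<Sum>c'\<in>C. \<mu> c' * (\<Sum>c\<in>C. \<mu> c * H' c' c)))"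
    using M by (simp add: distrib_left of_nat_diff)
  also have "\<dots> \<le> real M * (real M1 * (g + real (M1 - 1) * h1) + real (M - 1) * (real M1 * (real M1 * h2 + h3)))"
    using EG' EH' by (intro mult_left_mono add_mono) auto
  also have "\<dots> = real M * real M1 * (g + real (M1 - 1) * h1 + real (M - 1) * (real M1 * h2 + h3))"
    by (simp add: algebra_simps)
  finally have "\<exists>c\<in>PiE {..<M} (\<lambda>_. C). ?F c \<le> real M * real M1 * (g + real (M1 - 1) * h1 + real (M - 1)
      * (real M1 * h2 + h3))"
    unfolding expect_def
  proof (intro ex_le_average[where \<mu> = "\<lambda>c. \<Prod>m<M. \<mu> (c m)"])
    show "finite (PiE {..<M} (\<lambda>_. C))" using finC by (simp add: finite_PiE)
    show "0 \<le> (\<Prod>m<M. \<mu> (c m))" if "c \<in> PiE {..<M} (\<lambda>_. C)" for c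
      using that by (intro prod_nonneg) (blast intro: \<mu>0 dest: PiE_mem)
    show "(\<Sum>c\<in>PiE {..<M} (\<lambda>_. C). \<Prod>m<M. \<mu> (c m)) = 1"
      using expect_const[of "{..<M}" C \<mu> 1] finC \<mu>1 by (simp add: expect_def)
  qed
  then obtain c where c: "c \<in> PiE {..<M} (\<lambda>_. C)"
    and F: "?F c \<le> real M * real M1 * (g + real (M1 - 1) * h1 + real (M - 1) * (real M1 * h2 + h3))" by blast
  show thesis
  proof (rule that[of "\<lambda>m. fst (c m)" "\<lambda>m. snd (c m)"])
    fix m assume "m < M"
    then have cm: "c m \<in> C" using c by (blast dest: PiE_mem)
    show "fst (c m) \<in> W" using cm unfolding C_def mem_Times_iff by (rule conjunct1)
    have "snd (c m) \<in> PiE {..<M1} (\<lambda>_. X)" using cm unfolding C_def mem_Times_iff by (rule conjunct2)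
    then show "snd (c m) m1 \<in> X" if "m1 < M1" for m1 using that by (blast dest: PiE_mem)
  next
    have "?F c = (\<Sum>m<M. \<Sum>m1<M1. G (fst (c m)) (snd (c m) m1)
        + (\<Sum>m1'\<in>{..<M1} - {m1}. H1 (fst (c m)) (snd (c m) m1) (snd (c m) m1'))
        + (\<Sum>m'\<in>{..<M} - {m}. (\<Sum>m1'<M1. H2 (fst (c m')) (snd (c m') m1') (snd (c m) m1)) + H3 (fst (c m'))
            (snd (c m) m1)))"
      unfolding G'_def H'_def
      by (intro sum.cong refl, rule sum_add_sum_swap)
    with F show "(\<Sum>m<M. \<Sum>m1<M1. G (fst (c m)) (snd (c m) m1)
        + (\<Sum>m1'\<in>{..<M1} - {m1}. H1 (fst (c m)) (snd (c m) m1) (snd (c m) m1'))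
        + (\<Sum>m'\<in>{..<M} - {m}. (\<Sum>m1'<M1. H2 (fst (c m')) (snd (c m') m1') (snd (c m) m1)) + H3 (fst (c m'))
            (snd (c m) m1)))
      \<le> real M * real M1 * (g + real (M1 - 1) * h1 + real (M - 1) * (real M1 * h2 + h3))"
      by (simp only:)
  qed
qed

section \<open>Tensor powers\<close>

definition seqs :: "nat \<Rightarrow> 'a set \<Rightarrow> 'a list set" where
  "seqs n A = {xs. set xs \<subseteq> A \<and> length xs = n}"

lemma seqs_0 [simp]: "seqs 0 A = {[]}" by (auto simp: seqs_def)

lemma seqs_Suc: "seqs (Suc n) A = (\<lambda>(x, xs). x # xs) ` (A \<times> seqs n A)"
  by (auto simp: seqs_def image_iff length_Suc_conv)

lemma finite_seqs [simp]: "finite A \<Longrightarrow> finite (seqs n A)"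
  unfolding seqs_def by (rule finite_lists_length_eq)

lemma Cons_in_seqs [simp]: "x # xs \<in> seqs (Suc n) A \<longleftrightarrow> x \<in> A \<and> xs \<in> seqs n A"
  by (auto simp: seqs_def)

lemma seqs_length: "xs \<in> seqs n A \<Longrightarrow> length xs = n" by (simp add: seqs_def)

lemma sum_seqs_Suc: "(\<Sum>xs\<in>seqs (Suc n) A. f xs) = (\<Sum>x\<in>A. \<Sum>xs\<in>seqs n A. f (x # xs))"
proof -
  have "inj_on (\<lambda>(x, xs). x # xs) (A \<times> seqs n A)" by (auto simp: inj_on_def)
  then show ?thesis by (simp add: seqs_Suc sum.reindex split_def sum.cartesian_product)
qed

lemma sum_seqs_zip:
  "(\<Sum>xs\<in>seqs n A. \<Sum>ys\<in>seqs n B. f (zip xs ys)) = (\<Sum>zs\<in>seqs n (A \<times> B). f zs)"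
proof (induction n arbitrary: f)
  case (Suc n)
  have "(\<Sum>xs\<in>seqs (Suc n) A. \<Sum>ys\<in>seqs (Suc n) B. f (zip xs ys)) =
      (\<Sum>x\<in>A. \<Sum>y\<in>B. \<Sum>xs\<in>seqs n A. \<Sum>ys\<in>seqs n B. f ((x, y) # zip xs ys))"
    by (simp add: sum_seqs_Suc sum.swap[of _ B])
  also have "\<dots> = (\<Sum>x\<in>A. \<Sum>y\<in>B. \<Sum>zs\<in>seqs n (A \<times> B). f ((x, y) # zs))"
    using Suc.IH[of "\<lambda>zs. f (_ # zs)"] by simp
  also have "\<dots> = (\<Sum>zs\<in>seqs (Suc n) (A \<times> B). f zs)"
    by (simp add: sum_seqs_Suc sum.cartesian_product')
  finally show ?case .
qed simp

lemma sum_seqs_prod_list: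
  fixes f :: "'b \<Rightarrow> 'a \<Rightarrow> real"
  shows "(\<Sum>xs\<in>seqs (length ws) A. prod_list (map2 f ws xs)) = prod_list (map (\<lambda>w. \<Sum>x\<in>A. f w x) ws)"
  by (induction ws) (simp_all add: sum_seqs_Suc sum_distrib_left[symmetric] sum_distrib_right[symmetric])

lemma sum_seqs_prod_list_single:
  fixes f :: "'a \<Rightarrow> real"
  shows "(\<Sum>xs\<in>seqs n A. prod_list (map f xs)) = (\<Sum>x\<in>A. f x) ^ n"
  by (induction n) (simp_all add: sum_seqs_Suc sum_distrib_left[symmetric] sum_distrib_right[symmetric])

text \<open>The tensor product of a letter operator with a block operator, indexed by cons rather
  than by pairs, so that powers live on words and proofs are inductions on them.\<close>

definition cons_op :: "'a op \<Rightarrow> 'a list op \<Rightarrow> 'a list op" where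
  "cons_op A B = mk ((\<lambda>(x, xs). x # xs) ` (supp A \<times> supp B))
     (\<lambda>us vs. entry A (hd us) (hd vs) * entry B (tl us) (tl vs))"

lemma entry_cons_op:
  "entry (cons_op A B) us vs =
    (if us = [] \<or> vs = [] then 0 else entry A (hd us) (hd vs) * entry B (tl us) (tl vs))"
proof (cases "us \<in> (\<lambda>(x, xs). x # xs) ` (supp A \<times> supp B) \<and> vs \<in> (\<lambda>(x, xs). x # xs) ` (supp A \<times> supp B)")
  case True
  then show ?thesis by (auto simp: cons_op_def entry_mk)
next
  case False
  then have "us = [] \<or> vs = [] \<or> hd us \<notin> supp A \<or> tl us \<notin> supp B \<or> hd vs \<notin> supp A \<or> tl vs \<notin> supp B"
    by (cases us; cases vs) (auto simp: image_iff)
  then show ?thesis using False by (auto simp: cons_op_def entry_mk entry_supp)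
qed

lemma supp_cons_op: "supp (cons_op A B) \<subseteq> (\<lambda>(x, xs). x # xs) ` (supp A \<times> supp B)"
  unfolding cons_op_def by (rule supp_mk)

lemma sum_cons_image:
  "(\<Sum>us\<in>(\<lambda>(x, xs). x # xs) ` (S \<times> T). f us) = (\<Sum>x\<in>S. \<Sum>xs\<in>T. f (x # xs))"
proof -
  have "inj_on (\<lambda>(x, xs). x # xs) (S \<times> T)" by (auto simp: inj_on_def)
  then show ?thesis by (simp add: sum.reindex split_def sum.cartesian_product)
qed

lemma cons_op_mult: "cons_op A B * cons_op C D = cons_op (A * C) (B * D)"
proof (rule op_eqI)
  fix us vs
  have "entry (cons_op A B * cons_op C D) us vs =
      (\<Sum>ws\<in>(\<lambda>(x, xs). x # xs) ` (supp A \<times> supp B). entry (cons_op A B) us ws * entry (cons_op C D) ws vs)"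
    by (rule entry_times) (simp_all add: supp_cons_op)
  also have "\<dots> = entry (cons_op (A * C) (B * D)) us vs"
    unfolding sum_cons_image
    by (auto simp: entry_cons_op entry_times[where S = "supp A"] entry_times[where S = "supp B"]
         sum_product mult_ac)
  finally show "entry (cons_op A B * cons_op C D) us vs = entry (cons_op (A * C) (B * D)) us vs" .
qed

lemma star_cons_op [simp]: "star (cons_op A B) = cons_op (star A) (star B)"
  by (rule op_eqI) (auto simp: entry_cons_op)

lemma tr_cons_op: "tr (cons_op A B) = tr A * tr B"
  by (subst tr_eq[OF _ supp_cons_op])
    (simp_all add: sum_cons_image entry_cons_op tr_def sum_product)

lemma cons_op_add: "cons_op (A + A') B = cons_op A B + cons_op A' B"
  "cons_op A (B + B') = cons_op A B + cons_op A B'"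
  by (rule op_eqI, auto simp: entry_cons_op algebra_simps)+

lemma cons_op_scaleR: "cons_op (r *\<^sub>R A) B = r *\<^sub>R cons_op A B" "cons_op A (r *\<^sub>R B) = r *\<^sub>R cons_op A B"
  by (rule op_eqI, auto simp: entry_cons_op)+

lemma cons_op_zero [simp]: "cons_op 0 B = 0" "cons_op A 0 = 0"
  by (rule op_eqI, auto simp: entry_cons_op)+

lemma cons_op_sum: "cons_op (sum F X) B = (\<Sum>x\<in>X. cons_op (F x) B)"
  "cons_op A (sum G X) = (\<Sum>x\<in>X. cons_op A (G x))"
  by (induction X rule: infinite_finite_induct) (auto simp: cons_op_add)

definition tensor :: "'a op list \<Rightarrow> 'a list op" where
  "tensor As = foldr cons_op As (unit_op {[]})"

lemma tensor_simps [simp]: "tensor [] = unit_op {[]}" "tensor (A # As) = cons_op A (tensor As)"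
  by (simp_all add: tensor_def)

lemma unit_cons_op: "finite I \<Longrightarrow> finite J \<Longrightarrow>
    cons_op (unit_op I) (unit_op J) = unit_op ((\<lambda>(x, xs). x # xs) ` (I \<times> J))"
proof (rule op_eqI)
  fix us vs assume "finite I" "finite J"
  then show "entry (cons_op (unit_op I) (unit_op J)) us vs = entry (unit_op ((\<lambda>(x, xs). x # xs) `
      (I \<times> J))) us vs"
    by (cases us; cases vs) (auto simp: entry_cons_op unit_op_def entry_mk image_iff)
qed

text \<open>Multilinear expansion. Applied to spectral decompositions it exhibits the eigenvalues of
  a product state as products of single-letter eigenvalues.\<close>

lemma tensor_sum:
  "tensor (map (\<lambda>x. \<Sum>k\<in>K. r x k *\<^sub>R F x k) xs) =
    (\<Sum>ks\<in>seqs (length xs) K. prod_list (map2 r xs ks) *\<^sub>R tensor (map2 F xs ks))"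
  by (induction xs)
    (simp_all add: sum_seqs_Suc cons_op_sum cons_op_scaleR scaleR_sum_right,
      subst sum.swap, simp add: mult.commute)

text \<open>Hermitian square roots of the two factors tensor to a hermitian square root of the
  product.\<close>

lemma tensor_nonneg:
  assumes "\<And>A. A \<in> set As \<Longrightarrow> 0 \<le> A \<and> supp A \<subseteq> I" "finite I"
  shows "0 \<le> tensor As \<and> supp (tensor As) \<subseteq> seqs (length As) I"
  using assms(1)
proof (induction As)
  case (Cons A As)
  have A: "0 \<le> A" "supp A \<subseteq> I" and T: "0 \<le> tensor As" "supp (tensor As) \<subseteq> seqs (length As) I"
    using Cons by auto
  obtain X where X: "star X = X" "X * X = A" using nonneg_sqrt[OF assms(2) A(2,1)] by metis
  obtain Y where Y: "star Y = Y" "Y * Y = tensor As"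
    using nonneg_sqrt[OF _ T(2,1)] assms(2) by (metis finite_seqs)
  have "star (cons_op X Y) * cons_op X Y = tensor (A # As)"
    by (simp add: X Y cons_op_mult)
  then have "0 \<le> tensor (A # As)" by (metis self_nonneg)
  moreover have "supp (tensor (A # As)) \<subseteq> seqs (length (A # As)) I"
    using supp_cons_op[of A "tensor As"] A T by (force simp: seqs_Suc)
  ultimately show ?case ..
qed (auto simp: unit_nonneg supp_unit)

lemma tr_tensor: "tr (tensor As) = prod_list (map tr As)"
  by (induction As) (simp_all add: tr_cons_op tr_unit)

lemma resolution_cons_op:
  assumes "resolution K p E" "resolution L q F"
  shows "resolution ((\<lambda>(x, xs). x # xs) ` (K \<times> L)) (\<lambda>ks. cons_op (p (hd ks)) (q (tl ks))) (cons_op E F)"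
proof -
  interpret p: resolution K p E by fact
  interpret q: resolution L q F by fact
  show ?thesis
  proof
    show "(\<Sum>ks\<in>(\<lambda>(x, xs). x # xs) ` (K \<times> L). cons_op (p (hd ks)) (q (tl ks))) = cons_op E F"
      unfolding sum_cons_image p.sum_p[symmetric] q.sum_p[symmetric]
      by (simp add: cons_op_sum) (subst sum.swap, rule refl)
  qed (auto simp: p.fin q.fin p.star_p q.star_p cons_op_mult p.orth q.orth tr_cons_op p.tr_p q.tr_p
        split: if_splits)
qed

text \<open>The states of different letters need not commute: each position uses the eigenbasis of
  its own letter, and the products still resolve the identity of the block.\<close>

lemma resolution_tensor:
  assumes "\<And>x. x \<in> set xs \<Longrightarrow> resolution K (p x) (unit_op I)" "finite I" "length xs = n"
  shows "resolution (seqs n K) (\<lambda>ks. tensor (map2 p xs ks)) (unit_op (seqs n I))"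
  using assms(1,3)
proof (induction xs arbitrary: n)
  case Nil
  then show ?case by unfold_locales (auto simp: tr_unit)
next
  case (Cons x xs)
  obtain m where n: "n = Suc m" "length xs = m" using Cons by auto
  have R: "resolution (seqs n K) (\<lambda>ks. cons_op (p x (hd ks)) (tensor (map2 p xs (tl ks)))) (unit_op (seqs n I))"
    using resolution_cons_op[OF Cons.prems(1) Cons.IH[OF Cons.prems(1) n(2)], of x] assms(2)
    unfolding n(1) seqs_Suc by (simp add: unit_cons_op)
  have eq: "tensor (map2 p (x # xs) ks) = cons_op (p x (hd ks)) (tensor (map2 p xs (tl ks)))"
    if "ks \<in> seqs n K" for ks using that n by (cases ks) (auto simp: seqs_def)
  interpret R: resolution "seqs n K" "\<lambda>ks. cons_op (p x (hd ks)) (tensor (map2 p xs (tl ks)))"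
      "unit_op (seqs n I)"
    by (rule R)
  show ?case
    by unfold_locales
      (use R.fin R.star_p R.orth R.sum_p R.tr_p eq in \<open>auto cong: sum.cong\<close>)
qed

section \<open>Typical projections\<close>

lemma exp_sum_list: "exp (t * sum_list (map X js)) = prod_list (map (\<lambda>j. exp (t * X j)) js)" for t :: real
  by (induction js) (simp_all add: distrib_left exp_add)

lemma prod_list_map_nonneg:
  "(\<And>j. j \<in> set js \<Longrightarrow> 0 \<le> f j) \<Longrightarrow> 0 \<le> prod_list (map f js)" for f :: "'j \<Rightarrow> real"
  by (induction js) auto

lemma prod_list_map_mult:
  "prod_list (map (\<lambda>j. f j * g j) js) = prod_list (map f js) * prod_list (map g js)" for f g :: "'j \<Rightarrow> real"
  by (induction js) auto

text \<open>The moment generating function \<open>\<phi>\<close> has value 1 and negative derivative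
  at 0, so it drops below 1 at some \<open>t > 0\<close>. The indicator of a nonnegative sum is at
  most the exponential of \<open>t\<close> times the sum, whose mean factorises.\<close>

lemma chernoff:
  fixes v X :: "'j \<Rightarrow> real"
  assumes J: "finite J" "\<And>j. j \<in> J \<Longrightarrow> 0 \<le> v j" "(\<Sum>j\<in>J. v j) = 1" and neg: "(\<Sum>j\<in>J. v j * X j) < 0"
  obtains \<rho> where "0 \<le> \<rho>" "\<rho> < 1"
    "\<And>n. (\<Sum>js\<in>seqs n J. prod_list (map v js) * (if 0 \<le> sum_list (map X js) then 1 else 0)) \<le> \<rho> ^ n"
proof -
  define \<phi> where "\<phi> t = (\<Sum>j\<in>J. v j * exp (t * X j))" for t
  have "(\<phi> has_real_derivative (\<Sum>j\<in>J. v j * X j)) (at 0)"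
    unfolding \<phi>_def by (auto intro!: derivative_eq_intros simp: mult_ac)
  from DERIV_neg_dec_right[OF this neg]
  obtain d where d: "d > 0" "\<And>h. 0 < h \<Longrightarrow> h < d \<Longrightarrow> \<phi> (0 + h) < \<phi> 0" by blast
  define t where "t = d / 2"
  have t: "t > 0" "t < d" using d(1) by (auto simp: t_def)
  have "\<phi> 0 = 1" by (simp add: \<phi>_def J)
  then have lt: "\<phi> t < 1" using d(2)[OF t] by simp
  show thesis
  proof (rule that[OF _ lt])
    show "0 \<le> \<phi> t" unfolding \<phi>_def using J by (intro sum_nonneg) auto
    fix n
    have "(\<Sum>js\<in>seqs n J. prod_list (map v js) * (if 0 \<le> sum_list (map X js) then 1 else 0))
        \<le> (\<Sum>js\<in>seqs n J. prod_list (map v js) * exp (t * sum_list (map X js)))"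
    proof (intro sum_mono mult_left_mono)
      fix js assume "js \<in> seqs n J"
      then show "0 \<le> prod_list (map v js)" using J(2) by (intro prod_list_map_nonneg) (auto simp: seqs_def)
      show "(if 0 \<le> sum_list (map X js) then 1 else 0) \<le> exp (t * sum_list (map X js))" using t by simp
    qed
    also have "\<dots> = (\<Sum>js\<in>seqs n J. prod_list (map (\<lambda>j. v j * exp (t * X j)) js))"
      by (simp add: exp_sum_list prod_list_map_mult)
    also have "\<dots> = \<phi> t ^ n" by (simp add: sum_seqs_prod_list_single \<phi>_def)
    finally show "(\<Sum>js\<in>seqs n J. prod_list (map v js) * (if 0 \<le> sum_list (map X js) then 1 else 0)) \<le> \<phi> t ^ n" .
  qed
qed

text \<open>A positive product of nonnegative factors has only positive factors, so the logarithm
  splits.\<close>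

lemma prod_list_pos_log:
  "(\<And>j. j \<in> set js \<Longrightarrow> 0 \<le> f j) \<Longrightarrow> 0 < prod_list (map f js) \<Longrightarrow>
    log 2 (prod_list (map f js)) = sum_list (map (\<lambda>j. log 2 (f j)) js)"
proof (induction js)
  case (Cons j js)
  have nn: "0 \<le> f j" "0 \<le> prod_list (map f js)"
    using Cons.prems(1) by (auto intro: prod_list_map_nonneg)
  then have pos: "0 < f j" "0 < prod_list (map f js)"
    using Cons.prems(2) by (auto simp: zero_less_mult_iff)
  have "log 2 (a * b) = log 2 a + log 2 b" if "0 < a" "0 < b" for a b :: real
    using that by (simp add: log_mult)
  from this[OF pos] show ?case using Cons pos by simp
qed simp

lemma prod_list_map_one: "prod_list (map (\<lambda>_. 1) xs) = (1 :: real)"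
  by (induction xs) auto

lemma zip_mem: "xs \<in> seqs n A \<Longrightarrow> ks \<in> seqs n K \<Longrightarrow> j \<in> set (zip xs ks) \<Longrightarrow> j \<in> A \<times> K"
  by (cases j) (auto simp: seqs_def dest: set_zip_leftD set_zip_rightD)

text \<open>The half of conditional typicality that discards small eigenvalues, reduced to the facts
  that the coding argument uses. Domination by the scaled state serves wrong satellites, the rank
  bound wrong cloud centres; the error is controlled only on average over words.\<close>

definition upper_typical ::
    "'a set \<Rightarrow> 'x set \<Rightarrow> ('x \<Rightarrow> real) \<Rightarrow> ('x \<Rightarrow> 'a op) \<Rightarrow> real \<Rightarrow> (nat \<Rightarrow> 'x list \<Rightarrow> 'a list op) \<Rightarrow> real \<Rightarrow> bool" where
  "upper_typical I A p \<sigma> s Q \<rho> \<longleftrightarrow> 0 \<le> \<rho> \<and> \<rho> < 1 \<and>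
    (\<forall>n. \<forall>xs\<in>seqs n A. is_proj (seqs n I) (Q n xs) \<and>
      Q n xs \<le> 2 powr (real n * s) *\<^sub>R tensor (map \<sigma> xs) \<and> rtr (Q n xs) \<le> 2 powr (real n * s)) \<and>
    (\<forall>n. (\<Sum>xs\<in>seqs n A. prod_list (map p xs) *
       rtr ((unit_op (seqs n I) - Q n xs) * tensor (map \<sigma> xs))) \<le> \<rho> ^ n)"

text \<open>The opposite half: large eigenvalues are discarded, so that the surviving part of the
  state has norm at most the cut-off.\<close>

definition lower_typical ::
    "'a set \<Rightarrow> 'x set \<Rightarrow> ('x \<Rightarrow> real) \<Rightarrow> ('x \<Rightarrow> 'a op) \<Rightarrow> real \<Rightarrow> (nat \<Rightarrow> 'x list \<Rightarrow> 'a list op) \<Rightarrow> real \<Rightarrow> bool" where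
  "lower_typical I A p \<sigma> t Q \<rho> \<longleftrightarrow> 0 \<le> \<rho> \<and> \<rho> < 1 \<and>
    (\<forall>n. \<forall>xs\<in>seqs n A. is_proj (seqs n I) (Q n xs) \<and>
      Q n xs * tensor (map \<sigma> xs) * Q n xs \<le> 2 powr (- real n * t) *\<^sub>R unit_op (seqs n I)) \<and>
    (\<forall>n. (\<Sum>xs\<in>seqs n A. prod_list (map p xs) *
       rtr ((unit_op (seqs n I) - Q n xs) * tensor (map \<sigma> xs))) \<le> \<rho> ^ n)"

text \<open>The spectral data are fixed with one index set \<open>K\<close> for all letters, so that
  \<open>p x * r x k\<close> is a joint distribution on \<open>A \<times> K\<close> to which a
  classical tail bound applies.\<close>

locale cq_ensemble =
  fixes A :: "'x set" and p :: "'x \<Rightarrow> real" and I :: "'a set" and K :: "'k set"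
    and P :: "'x \<Rightarrow> 'k \<Rightarrow> 'a op" and r :: "'x \<Rightarrow> 'k \<Rightarrow> real"
  assumes finA: "finite A" and finI: "finite I"
    and p_nonneg: "x \<in> A \<Longrightarrow> 0 \<le> p x" and p_sum: "(\<Sum>x\<in>A. p x) = 1"
    and res: "x \<in> A \<Longrightarrow> resolution K (P x) (unit_op I)"
    and r_nonneg: "x \<in> A \<Longrightarrow> k \<in> K \<Longrightarrow> 0 \<le> r x k" and r_sum: "x \<in> A \<Longrightarrow> (\<Sum>k\<in>K. r x k) = 1"
begin

definition state :: "'x \<Rightarrow> 'a op" where "state x = (\<Sum>k\<in>K. r x k *\<^sub>R P x k)"

text \<open>The conditional entropy of the quantum output given the letter: the average von Neumann
  entropy of the states.\<close>

definition entropy :: real where "entropy = - (\<Sum>x\<in>A. p x * (\<Sum>k\<in>K. r x k * log 2 (r x k)))"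

lemma finK: "finite K"
proof -
  have "A \<noteq> {}" using p_sum by auto
  then show ?thesis using res resolution.fin by blast
qed

text \<open>The spectral projection of the product state onto the eigenvalues that satisfy
  \<open>g\<close>.\<close>

definition spec_proj :: "(real \<Rightarrow> bool) \<Rightarrow> 'x list \<Rightarrow> 'a list op" where
  "spec_proj g xs = (\<Sum>ks\<in>seqs (length xs) K.
     (if g (prod_list (map2 r xs ks)) then 1 else 0) *\<^sub>R tensor (map2 P xs ks))"

context
  fixes n :: nat and xs :: "'x list"
  assumes xs: "xs \<in> seqs n A"
begin

interpretation R: resolution "seqs n K" "\<lambda>ks. tensor (map2 P xs ks)" "unit_op (seqs n I)"
  by (rule resolution_tensor) (use xs res finI in \<open>auto simp: seqs_def\<close>)

lemma weight_nonneg: "ks \<in> seqs n K \<Longrightarrow> 0 \<le> prod_list (map2 r xs ks)"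
  using zip_mem[OF xs] r_nonneg by (intro prod_list_map_nonneg) force

lemma tensor_state: "tensor (map state xs) = R.fc (\<lambda>ks. prod_list (map2 r xs ks))"
proof -
  have "tensor (map state xs) = tensor (map (\<lambda>x. \<Sum>k\<in>K. r x k *\<^sub>R P x k) xs)"
    by (simp add: state_def[abs_def])
  then show ?thesis using seqs_length[OF xs] by (simp add: tensor_sum R.fc_def)
qed

lemma spec_proj_fc: "spec_proj g xs = R.fc (\<lambda>ks. if g (prod_list (map2 r xs ks)) then 1 else 0)"
  using seqs_length[OF xs] by (simp add: spec_proj_def R.fc_def)

lemma is_proj_spec_proj: "is_proj (seqs n I) (spec_proj g xs)"
  unfolding is_proj_def spec_proj_fc using finI
  by (auto simp: supp_subset_iff R.E_fc R.star_fc R.fc_mult intro!: R.fc_cong)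

lemma state_props: "0 \<le> tensor (map state xs)" "supp (tensor (map state xs)) \<subseteq> seqs n I" "tr (tensor
    (map state xs)) = 1"
proof -
  show "0 \<le> tensor (map state xs)" unfolding tensor_state by (rule R.fc_nonneg) (rule weight_nonneg)
  show "supp (tensor (map state xs)) \<subseteq> seqs n I"
    using finI by (simp add: supp_subset_iff tensor_state R.E_fc)
  have "(\<Sum>ks\<in>seqs n K. prod_list (map2 r xs ks)) = prod_list (map (\<lambda>x. \<Sum>k\<in>K. r x k) xs)"
    using xs sum_seqs_prod_list[of r xs K] by (simp add: seqs_def)
  also have "map (\<lambda>x. \<Sum>k\<in>K. r x k) xs = map (\<lambda>_. 1) xs"
    using xs by (auto simp: seqs_def r_sum)
  finally show "tr (tensor (map state xs)) = 1"
    unfolding tensor_state R.tr_fc by (simp add: prod_list_map_one)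
qed

lemma spec_proj_le:
  assumes "0 \<le> c" "\<And>y. g y \<Longrightarrow> 1 \<le> c * y"
  shows "spec_proj g xs \<le> c *\<^sub>R tensor (map state xs)"
  unfolding spec_proj_fc tensor_state R.fc_scaleR
  by (rule R.fc_mono) (simp add: assms weight_nonneg)

lemma spec_proj_conj_le:
  assumes "\<And>y. g y \<Longrightarrow> y \<le> c" "0 \<le> c"
  shows "spec_proj g xs * tensor (map state xs) * spec_proj g xs \<le> c *\<^sub>R unit_op (seqs n I)"
  unfolding spec_proj_fc tensor_state R.fc_mult R.fc_one[symmetric] R.fc_scaleR
  by (rule R.fc_mono) (simp add: assms)

text \<open>Projection and state are diagonal in the same resolution, so the quantum error is the
  probability that the random eigenvalue violates \<open>g\<close>.\<close>

lemma spec_proj_error: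
  "rtr ((unit_op (seqs n I) - spec_proj g xs) * tensor (map state xs)) =
    (\<Sum>ks\<in>seqs n K. prod_list (map2 r xs ks) * (if g (prod_list (map2 r xs ks)) then 0 else 1))"
proof -
  have "(unit_op (seqs n I) - spec_proj g xs) * tensor (map state xs) =
      R.fc (\<lambda>ks. prod_list (map2 r xs ks) * (if g (prod_list (map2 r xs ks)) then 0 else 1))"
    unfolding spec_proj_fc tensor_state R.fc_one[symmetric] R.fc_diff R.fc_mult
    by (rule R.fc_cong) auto
  then show ?thesis by (simp add: R.tr_fc)
qed

end

text \<open>Letter and eigenvalue index are drawn jointly, independently at each position;
  \<open>X\<close> is the centred log-eigenvalue with mean \<open>e * (s - entropy)\<close>. The
  sign \<open>e\<close> lets one proof serve both kinds of cut-off.\<close>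

lemma spec_proj_error_average:
  assumes neg: "e * (s - entropy) < 0"
    and g: "\<And>n y. 0 < y \<Longrightarrow> \<not> g n y \<Longrightarrow> 0 \<le> e * (log 2 y + real n * s)"
  obtains \<rho> where "0 \<le> \<rho>" "\<rho> < 1"
    "\<And>n. (\<Sum>xs\<in>seqs n A. prod_list (map p xs) *
       rtr ((unit_op (seqs n I) - spec_proj (g n) xs) * tensor (map state xs))) \<le> \<rho> ^ n"
proof -
  define v where "v j = p (fst j) * r (fst j) (snd j)" for j
  define X where "X j = e * (log 2 (r (fst j) (snd j)) + s)" for j
  \<comment> \<open>Index words of weight zero contribute nothing, so logarithms are only ever
    compared at positive eigenvalues.\<close>
  have aux: "a * (w * (if B then 0 else 1)) \<le> a * w * (if C then 1 else 0)"
    if "0 \<le> a" "0 \<le> w" "0 < w \<Longrightarrow> \<not> B \<Longrightarrow> C" for a w :: real and B C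
    using that by (cases "w = 0") auto
  have v0: "0 \<le> v j" if "j \<in> A \<times> K" for j using that p_nonneg r_nonneg by (auto simp: v_def)
  have v1: "(\<Sum>j\<in>A \<times> K. v j) = 1"
    by (simp add: v_def sum.cartesian_product' sum_distrib_left[symmetric] r_sum p_sum cong: sum.cong)
  have "(\<Sum>j\<in>A \<times> K. v j * X j) = (\<Sum>x\<in>A. \<Sum>k\<in>K. e * (p x * (r x k * log 2 (r x k))) + e * s * (p x * r x k))"
    by (simp add: v_def X_def sum.cartesian_product' algebra_simps)
  also have "\<dots> = e * (\<Sum>x\<in>A. p x * (\<Sum>k\<in>K. r x k * log 2 (r x k))) + e * s * (\<Sum>x\<in>A. p x * (\<Sum>k\<in>K. r x k))"
    by (simp add: sum.distrib sum_distrib_left)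
  also have "(\<Sum>x\<in>A. p x * (\<Sum>k\<in>K. r x k)) = 1" by (simp add: r_sum p_sum cong: sum.cong)
  finally have "(\<Sum>j\<in>A \<times> K. v j * X j) < 0"
    using neg by (simp add: entropy_def algebra_simps)
  then obtain \<rho> where \<rho>: "0 \<le> \<rho>" "\<rho> < 1"
    "\<And>n. (\<Sum>js\<in>seqs n (A \<times> K). prod_list (map v js) * (if 0 \<le> sum_list (map X js) then 1 else 0)) \<le> \<rho> ^ n"
    using chernoff[of "A \<times> K" v X] v0 v1 finA finK by blast
  show thesis
  proof (rule that[OF \<rho>(1,2)])
    fix n
    have "(\<Sum>xs\<in>seqs n A. prod_list (map p xs) *
        rtr ((unit_op (seqs n I) - spec_proj (g n) xs) * tensor (map state xs)))
      = (\<Sum>xs\<in>seqs n A. \<Sum>ks\<in>seqs n K. prod_list (map p xs) * (prod_list (map2 r xs ks) *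
          (if g n (prod_list (map2 r xs ks)) then 0 else 1)))"
      by (simp add: spec_proj_error sum_distrib_left)
    also have "\<dots> \<le> (\<Sum>xs\<in>seqs n A. \<Sum>ks\<in>seqs n K. prod_list (map v (zip xs ks)) *
        (if 0 \<le> sum_list (map X (zip xs ks)) then 1 else 0))"
    proof (intro sum_mono)
      fix xs ks assume xs: "xs \<in> seqs n A" and ks: "ks \<in> seqs n K"
      have len: "length xs = n" "length ks = n" using xs ks by (auto simp: seqs_def)
      note mem = zip_mem[OF xs ks]
      let ?w = "prod_list (map2 r xs ks)"
      have w: "?w = prod_list (map (\<lambda>j. r (fst j) (snd j)) (zip xs ks))" by (simp add: split_def)
      have "map (\<lambda>j. p (fst j)) (zip xs ks) = map p (map fst (zip xs ks))" by simp
      also have "\<dots> = map p xs" using len by (simp only: map_fst_zip)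
      finally have "map p xs = map (\<lambda>j. p (fst j)) (zip xs ks)" by simp
      then have pv: "prod_list (map v (zip xs ks)) = prod_list (map p xs) * ?w"
        by (simp add: v_def[abs_def] prod_list_map_mult w)
      have p0: "0 \<le> prod_list (map p xs)"
        using xs by (intro prod_list_map_nonneg) (auto simp: seqs_def p_nonneg)
      have w0: "0 \<le> ?w" by (rule weight_nonneg[OF xs ks])
      have "0 \<le> sum_list (map X (zip xs ks))" if "0 < ?w" "\<not> g n ?w"
      proof -
        have "log 2 ?w = sum_list (map (\<lambda>j. log 2 (r (fst j) (snd j))) (zip xs ks))"
          unfolding w by (rule prod_list_pos_log) (use that w r_nonneg mem in auto)
        then have "sum_list (map X (zip xs ks)) = e * (log 2 ?w + real n * s)"
          using len by (simp add: X_def[abs_def] sum_list_const_mult sum_list_addf sum_list_triv)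
        then show ?thesis using g[OF that] by simp
      qed
      then show "prod_list (map p xs) * (?w * (if g n ?w then 0 else 1)) \<le>
          prod_list (map v (zip xs ks)) * (if 0 \<le> sum_list (map X (zip xs ks)) then 1 else 0)"
        unfolding pv by (intro aux p0 w0)
    qed
    also have "\<dots> = (\<Sum>js\<in>seqs n (A \<times> K). prod_list (map v js) * (if 0 \<le> sum_list (map X js) then 1 else 0))"
      by (rule sum_seqs_zip)
    also have "\<dots> \<le> \<rho> ^ n" by (rule \<rho>)
    finally show "(\<Sum>xs\<in>seqs n A. prod_list (map p xs) *
        rtr ((unit_op (seqs n I) - spec_proj (g n) xs) * tensor (map state xs))) \<le> \<rho> ^ n" .
  qed
qed

text \<open>An eigenvalue is kept exactly if scaling makes it at least 1, which is what domination
  of the projection asks for; the rank bound follows since the state has trace one.\<close>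

lemma typical_upper:
  assumes "entropy < s"
  shows "\<exists>Q \<rho>. upper_typical I A p state s Q \<rho>"
proof -
  let ?g = "\<lambda>n y. 1 \<le> 2 powr (real n * s) * y"
  have g: "0 \<le> (- 1) * (log 2 y + real n * s)" if "0 < y" "\<not> ?g n y" for n y
  proof -
    have "log 2 (2 powr (real n * s) * y) \<le> log 2 1" using that by (subst log_le_cancel_iff) auto
    then show ?thesis using that by (simp add: log_mult log_powr)
  qed
  obtain \<rho> where \<rho>: "0 \<le> \<rho>" "\<rho> < 1"
    "\<And>n. (\<Sum>xs\<in>seqs n A. prod_list (map p xs) *
       rtr ((unit_op (seqs n I) - spec_proj (?g n) xs) * tensor (map state xs))) \<le> \<rho> ^ n"
  proof (rule spec_proj_error_average[of "-1" s ?g])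
    show "- 1 * (s - entropy) < 0" using assms by simp
  qed (rule g, auto)
  have le: "spec_proj (?g n) xs \<le> 2 powr (real n * s) *\<^sub>R tensor (map state xs)" if "xs \<in> seqs n A" for n xs
    by (rule spec_proj_le[OF that]) auto
  have "rtr (spec_proj (?g n) xs) \<le> 2 powr (real n * s)" if "xs \<in> seqs n A" for n xs
    using rtr_mono[OF le[OF that]] state_props[OF that] by simp
  with \<rho> le show ?thesis
    unfolding upper_typical_def
    by (intro exI[of _ "\<lambda>n. spec_proj (?g n)"] exI[of _ \<rho>]) (simp add: is_proj_spec_proj)
qed

lemma typical_lower:
  assumes "t < entropy"
  shows "\<exists>Q \<rho>. lower_typical I A p state t Q \<rho>"
proof -
  let ?g = "\<lambda>n y. y \<le> 2 powr (- real n * t)"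
  have g: "0 \<le> 1 * (log 2 y + real n * t)" if "0 < y" "\<not> ?g n y" for n y
  proof -
    have "log 2 (2 powr (- real n * t)) \<le> log 2 y" using that by (subst log_le_cancel_iff) auto
    then show ?thesis by (simp add: log_powr)
  qed
  obtain \<rho> where \<rho>: "0 \<le> \<rho>" "\<rho> < 1"
    "\<And>n. (\<Sum>xs\<in>seqs n A. prod_list (map p xs) *
       rtr ((unit_op (seqs n I) - spec_proj (?g n) xs) * tensor (map state xs))) \<le> \<rho> ^ n"
  proof (rule spec_proj_error_average[of 1 t ?g])
    show "1 * (t - entropy) < 0" using assms by simp
  qed (rule g, auto)
  have "spec_proj (?g n) xs * tensor (map state xs) * spec_proj (?g n) xs
      \<le> 2 powr (- real n * t) *\<^sub>R unit_op (seqs n I)" if "xs \<in> seqs n A" for n xs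
    by (rule spec_proj_conj_le[OF that]) auto
  with \<rho> show ?thesis
    unfolding lower_typical_def
    by (intro exI[of _ "\<lambda>n. spec_proj (?g n)"] exI[of _ \<rho>]) (simp add: is_proj_spec_proj)
qed

end

section \<open>Entropy of block states\<close>

lemma order_linear_factors: "Polynomial.order z (\<Prod>a\<leftarrow>as. [:- a, 1:]) = count_list as z" for z :: complex
proof (induction as)
  case (Cons a as)
  have nz: "(\<Prod>a\<leftarrow>as. [:- a, 1:]) \<noteq> 0" by (auto simp: prod_list_zero_iff)
  have "Polynomial.order z [:- a, 1:] = (if z = a then 1 else 0)"
    using order_power_n_n[of a 1] by (auto intro: order_0I)
  moreover have "Polynomial.order z ([:- a, 1:] * (\<Prod>a\<leftarrow>as. [:- a, 1:])) = Polynomial.order z [:- a, 1:]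
      + Polynomial.order z (\<Prod>a\<leftarrow>as. [:- a, 1:])"
    using nz by (intro order_mult) (metis mult_eq_0_iff pCons_eq_0_iff zero_neq_one)
  ultimately show ?case using Cons.IH by simp
qed (simp add: order_0I)

lemma sum_count_list:
  "finite S \<Longrightarrow> set as \<subseteq> S \<Longrightarrow> (\<Sum>z\<in>S. real (count_list as z) * f z) = (\<Sum>a\<leftarrow>as. f a)"
proof (induction as)
  case (Cons a as)
  have "(\<Sum>z\<in>S. real (count_list (a # as) z) * f z) = (\<Sum>z\<in>S. (if z = a then f a else 0)
      + real (count_list as z) * f z)"
    by (intro sum.cong) (auto simp: distrib_right)
  then show ?case using Cons by (simp add: sum.distrib)
qed simp

text \<open>Roots counted with multiplicity are the entries of any list of linear factors, so one
  factorisation evaluates the entropy.\<close>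

lemma vn_entropy_linear_factors:
  assumes "char_poly M = (\<Prod>a\<leftarrow>as. [:- a, 1:])"
  shows "vn_entropy M = - (\<Sum>a\<leftarrow>as. if Re a \<le> 0 then 0 else Re a * log 2 (Re a))"
proof -
  have roots: "{z. poly (char_poly M) z = 0} = set as"
    unfolding assms by (auto simp: poly_prod_list prod_list_zero_iff image_iff)
  have "vn_entropy M = - (\<Sum>z\<in>set as. real (count_list as z) * (if Re z \<le> 0 then 0 else Re z * log 2 (Re z)))"
    unfolding vn_entropy_def roots unfolding assms order_linear_factors ..
  then show ?thesis by (simp only: sum_count_list[OF finite_set order_refl])
qed

text \<open>The orthonormal vectors form a unitary that diagonalises \<open>M\<close>, so the
  characteristic polynomial has the \<open>r k\<close> as roots. The case distinction at zero
  disappears because the weight is zero there.\<close>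

lemma vn_entropy_spectral:
  assumes M: "M \<in> carrier_mat D D" and K: "finite K" "card K = D"
    and on: "\<And>k l. k \<in> K \<Longrightarrow> l \<in> K \<Longrightarrow> (\<Sum>i<D. cnj (u k i) * u l i) = (if k = l then 1 else 0)"
    and eq: "\<And>i j. i < D \<Longrightarrow> j < D \<Longrightarrow> M $$ (i, j) = (\<Sum>k\<in>K. of_real (r k) * (u k i * cnj (u k j)))"
    and r: "\<And>k. k \<in> K \<Longrightarrow> 0 \<le> r k"
  shows "vn_entropy M = - (\<Sum>k\<in>K. r k * log 2 (r k))"
proof -
  obtain e where "bij_betw e {0..<card K} K" using ex_bij_betw_nat_finite[OF K(1)] by blast
  then have e: "bij_betw e {..<D} K" by (simp add: K lessThan_atLeast0)
  then have eK: "e k \<in> K" if "k < D" for k using that by (auto simp: bij_betw_def)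
  have einj: "e k = e l \<longleftrightarrow> k = l" if "k < D" "l < D" for k l
    using e that by (auto simp: bij_betw_def inj_on_def)
  define U where "U = mat D D (\<lambda>(i, k). u (e k) i)"
  define V where "V = mat D D (\<lambda>(k, i). cnj (u (e k) i))"
  define B where "B = mat D D (\<lambda>(k, l). if k = l then complex_of_real (r (e k)) else 0)"
  have c: "U \<in> carrier_mat D D" "V \<in> carrier_mat D D" "B \<in> carrier_mat D D"
    by (auto simp: U_def V_def B_def)
  have VU: "V * U = 1\<^sub>m D"
    by (rule eq_matI)
      (auto simp: U_def V_def scalar_prod_def lessThan_atLeast0[symmetric] on eK einj)
  \<comment> \<open>Orthonormality gives only a left inverse; for square matrices it is two-sided,
    which is completeness of the basis.\<close>
  have UV: "U * V = 1\<^sub>m D" by (rule mat_mult_left_right_inverse[OF c(2,1) VU])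
  have UB: "(U * B) $$ (i, k) = u (e k) i * of_real (r (e k))" if "i < D" "k < D" for i k
  proof -
    have "(U * B) $$ (i, k) = (\<Sum>l<D. u (e l) i * (if l = k then complex_of_real (r (e l)) else 0))"
      using that by (simp add: U_def B_def scalar_prod_def lessThan_atLeast0[symmetric])
    also have "\<dots> = (\<Sum>l<D. if l = k then u (e l) i * complex_of_real (r (e l)) else 0)"
      by (intro sum.cong) auto
    finally show ?thesis using that by simp
  qed
  have "M = U * B * V"
  proof (rule eq_matI)
    fix i j assume "i < dim_row (U * B * V)" "j < dim_col (U * B * V)"
    then have ij: "i < D" "j < D" using c by auto
    have W: "(W * V) $$ (i, j) = (\<Sum>k<D. W $$ (i, k) * V $$ (k, j))" if "W \<in> carrier_mat D D" for W
      using that ij c by (simp add: scalar_prod_def lessThan_atLeast0[symmetric])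
    have "(U * B * V) $$ (i, j) = (\<Sum>k<D. (U * B) $$ (i, k) * V $$ (k, j))"
      by (rule W) (use c in auto)
    also have "\<dots> = (\<Sum>k<D. of_real (r (e k)) * (u (e k) i * cnj (u (e k) j)))"
      using ij by (intro sum.cong) (auto simp: UB V_def)
    also have "\<dots> = (\<Sum>k\<in>K. of_real (r k) * (u k i * cnj (u k j)))"
      by (rule sum.reindex_bij_betw[OF e])
    finally show "M $$ (i, j) = (U * B * V) $$ (i, j)" using eq[OF ij] by simp
  qed (use c M in auto)
  then have "similar_mat M B" by (intro similar_matI[OF _ UV VU]) (use c M in auto)
  then have "char_poly M = char_poly B" by (rule char_poly_similar)
  also have "\<dots> = (\<Prod>a\<leftarrow>diag_mat B. [:- a, 1:])"
    by (rule char_poly_upper_triangular[OF c(3)]) (auto simp: upper_triangular_def B_def)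
  also have "diag_mat B = map (\<lambda>k. complex_of_real (r (e k))) [0..<D]"
    by (auto simp: diag_mat_def B_def)
  finally have cp: "char_poly M = (\<Prod>a\<leftarrow>map (\<lambda>k. complex_of_real (r (e k))) [0..<D]. [:- a, 1:])" .
  have "vn_entropy M = - (\<Sum>k\<leftarrow>[0..<D]. if r (e k) \<le> 0 then 0 else r (e k) * log 2 (r (e k)))"
    using vn_entropy_linear_factors[OF cp] by (simp add: comp_def cong: if_cong)
  also have "\<dots> = - (\<Sum>k<D. if r (e k) \<le> 0 then 0 else r (e k) * log 2 (r (e k)))"
    by (simp add: interv_sum_list_conv_sum_set_nat lessThan_atLeast0)
  also have "\<dots> = - (\<Sum>k<D. r (e k) * log 2 (r (e k)))"
    using r[OF eK] by (intro arg_cong[of _ _ uminus] sum.cong refl) (force dest: order_antisym)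
  also have "\<dots> = - (\<Sum>k\<in>K. r k * log 2 (r k))"
    using sum.reindex_bij_betw[OF e, of "\<lambda>k. r k * log 2 (r k)"] by simp
  finally show ?thesis .
qed

section \<open>Density operators and their entropies\<close>

definition state_op :: "nat \<Rightarrow> nat op \<Rightarrow> bool" where
  "state_op d \<sigma> \<longleftrightarrow> 0 \<le> \<sigma> \<and> supp \<sigma> \<subseteq> {..<d} \<and> tr \<sigma> = 1"

definition entr :: "nat \<Rightarrow> nat op \<Rightarrow> real" where
  "entr d \<sigma> = vn_entropy (mat d d (\<lambda>(i, j). entry \<sigma> i j))"

text \<open>The trace of the product of two rank-one projections is the squared modulus of the inner
  product of their vectors.\<close>

lemma proj_orthogonal:
  assumes "finite I" "proj I u * proj I v = 0"
  shows "(\<Sum>i\<in>I. cnj (u i) * v i) = 0"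
proof -
  let ?s = "\<Sum>i\<in>I. cnj (u i) * v i"
  have "tr (proj I u * proj I v) = (\<Sum>i\<in>I. \<Sum>k\<in>I. entry (proj I u) i k * entry (proj I v) k i)"
    using assms(1) supp_proj[of I u] supp_proj[of I v] by (intro tr_times) auto
  also have "\<dots> = (\<Sum>i\<in>I. \<Sum>k\<in>I. (u i * cnj (v i)) * (cnj (u k) * v k))"
    using assms(1) by (intro sum.cong) (auto simp: proj_def entry_mk)
  also have "\<dots> = cnj ?s * ?s" by (simp add: sum_product)
  finally have "cnj ?s * ?s = 0" by (simp only: assms(2) tr_zero)
  then show ?thesis by (metis complex_cnj_zero_iff mult_eq_0_iff)
qed

lemma state_op_spectral:
  assumes "state_op d \<sigma>"
  obtains u r where "resolution {..<d} (\<lambda>k. proj {..<d} (u k)) (unit_op {..<d})"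
    "\<sigma> = (\<Sum>k<d. r k *\<^sub>R proj {..<d} (u k))" "\<And>k. k < d \<Longrightarrow> 0 \<le> r k" "(\<Sum>k<d. r k) = 1"
    "\<And>k l. k < d \<Longrightarrow> l < d \<Longrightarrow> (\<Sum>i<d. cnj (u k i) * u l i) = (if k = l then 1 else 0)"
proof -
  have s: "0 \<le> \<sigma>" "supp \<sigma> \<subseteq> {..<d}" "tr \<sigma> = 1" using assms by (auto simp: state_op_def)
  obtain u r where R: "resolution {..<d} (\<lambda>k. proj {..<d} (u k)) (unit_op {..<d})"
    and eq: "\<sigma> = (\<Sum>k<d. r k *\<^sub>R proj {..<d} (u k))"
    using spectral_theorem[OF _ s(2) nonneg_star[OF s(1)]] by (metis card_lessThan finite_lessThan)
  interpret resolution "{..<d}" "\<lambda>k. proj {..<d} (u k)" "unit_op {..<d}" by (rule R)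
  have \<sigma>: "\<sigma> = fc r" by (simp add: fc_def eq)
  show thesis
  proof (rule that[OF R eq])
    show "0 \<le> r k" if "k < d" for k using s(1) that by (simp add: \<sigma> fc_nonneg_iff)
    show "(\<Sum>k<d. r k) = 1" using s(3) by (simp add: \<sigma> tr_fc flip: of_real_sum)
    fix k l assume kl: "k < d" "l < d"
    show "(\<Sum>i<d. cnj (u k i) * u l i) = (if k = l then 1 else 0)"
    proof (cases "k = l")
      case True
      have "tr (proj {..<d} (u k)) = 1" using kl by (intro tr_p) auto
      then show ?thesis using True
        by (subst (asm) tr_proj) (simp_all add: complex_norm_square mult.commute del: of_real_power)
    next
      case False
      then show ?thesis using kl orth[of k l] by (simp add: proj_orthogonal)
    qed
  qed
qed

lemma entr_spectral:
  assumes on: "\<And>k l. k < d \<Longrightarrow> l < d \<Longrightarrow> (\<Sum>i<d. cnj (u k i) * u l i) = (if k = l then 1 else 0)"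
    and "\<sigma> = (\<Sum>k<d. r k *\<^sub>R proj {..<d} (u k))" "\<And>k. k < d \<Longrightarrow> 0 \<le> r k"
  shows "entr d \<sigma> = - (\<Sum>k<d. r k * log 2 (r k))"
  unfolding entr_def
  by (rule vn_entropy_spectral[where u = u]) (auto simp: assms entry_sum proj_def entry_mk)

text \<open>A classical-quantum state: \<open>cls\<close> reads off the classical part of a basis index, \<open>dig\<close> the quantum part.\<close>

lemma cq_block_entropy:
  fixes cls :: "nat \<Rightarrow> 'c"
  assumes bij: "bij_betw (\<lambda>i. (cls i, dig i)) {..<D} (C \<times> {..<d})" and C: "finite C"
    and st: "\<And>c. c \<in> C \<Longrightarrow> state_op d (\<sigma> c)" and p: "\<And>c. c \<in> C \<Longrightarrow> 0 \<le> p c"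
    and M: "M \<in> carrier_mat D D"
      "\<And>i j. i < D \<Longrightarrow> j < D \<Longrightarrow>
        M $$ (i, j) = (if cls i = cls j then of_real (p (cls i)) * entry (\<sigma> (cls i)) (dig i) (dig j) else 0)"
  shows "vn_entropy M = - (\<Sum>c\<in>C. p c * log 2 (p c)) + (\<Sum>c\<in>C. p c * entr d (\<sigma> c))"
proof -
  define G where "G c u r \<longleftrightarrow> \<sigma> c = (\<Sum>k<d. r k *\<^sub>R proj {..<d} (u k)) \<and> (\<forall>k<d. 0 \<le> r k) \<and> (\<Sum>k<d. r k) = 1 \<and>
    (\<forall>k<d. \<forall>l<d. (\<Sum>i<d. cnj (u k i) * u l i) = (if k = l then 1 else 0))"
    for c :: 'c and u :: "nat \<Rightarrow> nat \<Rightarrow> complex" and r :: "nat \<Rightarrow> real"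
  have "\<forall>c\<in>C. \<exists>f. G c (fst f) (snd f)"
  proof
    fix c assume "c \<in> C"
    then have "\<exists>u r. G c u r" unfolding G_def by (rule state_op_spectral[OF st]) blast
    then show "\<exists>f. G c (fst f) (snd f)" by simp
  qed
  then obtain f where f: "\<forall>c\<in>C. G c (fst (f c)) (snd (f c))" by (rule bchoice[THEN exE])
  define u where "u c = fst (f c)" for c
  define r where "r c = snd (f c)" for c
  have ur: "\<sigma> c = (\<Sum>k<d. r c k *\<^sub>R proj {..<d} (u c k))" "k < d \<Longrightarrow> 0 \<le> r c k" "(\<Sum>k<d. r c k) = 1"
    "k < d \<Longrightarrow> l < d \<Longrightarrow> (\<Sum>i<d. cnj (u c k i) * u c l i) = (if k = l then 1 else 0)" if "c \<in> C" for c k l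
    using f that unfolding G_def u_def r_def by blast+
  \<comment> \<open>Eigenvectors of a block-diagonal matrix: those of block \<open>c\<close>,
    extended by zero to the other blocks; the eigenvalues are scaled by the weight of the
    block.\<close>
  define V where "V ck i = (if cls i = fst ck then u (fst ck) (snd ck) (dig i) else 0)" for ck i
  define R where "R ck = p (fst ck) * r (fst ck) (snd ck)" for ck
  have cd: "cls i \<in> C" "dig i < d" if "i < D" for i using bij that by (auto simp: bij_betw_def)
  have sumD: "(\<Sum>i<D. f (cls i) (dig i)) = (\<Sum>c\<in>C. \<Sum>j<d. f c j)" for f :: "_ \<Rightarrow> _ \<Rightarrow> complex"
    using sum.reindex_bij_betw[OF bij, of "\<lambda>(c, j). f c j"] by (simp add: sum.cartesian_product')
  have "vn_entropy M = - (\<Sum>ck\<in>C \<times> {..<d}. R ck * log 2 (R ck))"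
  proof (rule vn_entropy_spectral[where u = V])
    show "card (C \<times> {..<d}) = D" using bij_betw_same_card[OF bij] by simp
    show "0 \<le> R ck" if "ck \<in> C \<times> {..<d}" for ck using that p ur(2) by (auto simp: R_def)
    fix ck cl assume k: "ck \<in> C \<times> {..<d}" "cl \<in> C \<times> {..<d}"
    obtain c k c' l where ckl: "ck = (c, k)" "cl = (c', l)" by (cases ck; cases cl)
    have "(\<Sum>i<D. cnj (V ck i) * V cl i) =
        (\<Sum>b\<in>C. \<Sum>j<d. cnj (if b = c then u c k j else 0) * (if b = c' then u c' l j else 0))"
      unfolding V_def ckl fst_conv snd_conv by (rule sumD)
    also have "\<dots> = (\<Sum>b\<in>C. if b = c then (if c = c' then \<Sum>j<d. cnj (u c k j) * u c l j else 0) else 0)"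
      by (intro sum.cong) auto
    also have "\<dots> = (if ck = cl then 1 else 0)"
      using k C ur(4) by (simp add: ckl)
    finally show "(\<Sum>i<D. cnj (V ck i) * V cl i) = (if ck = cl then 1 else 0)" .
  next
    fix i j assume ij: "i < D" "j < D"
    have "(\<Sum>ck\<in>C \<times> {..<d}. of_real (R ck) * (V ck i * cnj (V ck j))) =
      (\<Sum>c\<in>C. if cls i = c then \<Sum>k<d. of_real (R (c, k)) * (V (c, k) i * cnj (V (c, k) j)) else 0)"
      unfolding sum.cartesian_product' by (intro sum.cong refl) (auto simp: V_def)
    also have "\<dots> = (\<Sum>k<d. of_real (R (cls i, k)) * (V (cls i, k) i * cnj (V (cls i, k) j)))"
      using C cd[OF ij(1)] by simp
    also have "\<dots> = M $$ (i, j)"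
    proof (cases "cls i = cls j")
      case True
      have "entry (\<sigma> (cls i)) (dig i) (dig j) = (\<Sum>k<d. of_real (r (cls i) k) * (u (cls i) k (dig i)
          * cnj (u (cls i) k (dig j))))"
        using cd[OF ij(1)] cd[OF ij(2)] by (simp add: ur(1) entry_sum proj_def entry_mk)
      then show ?thesis using M(2)[OF ij] True by (simp add: R_def V_def sum_distrib_left mult.assoc)
    qed (use M(2)[OF ij] in \<open>simp add: V_def\<close>)
    finally show "M $$ (i, j) = (\<Sum>ck\<in>C \<times> {..<d}. of_real (R ck) * (V ck i * cnj (V ck j)))" by simp
  qed (use C M in auto)
  also have "\<dots> = - (\<Sum>c\<in>C. \<Sum>k<d. (p c * log 2 (p c)) * r c k + p c * (r c k * log 2 (r c k)))"
    unfolding sum.cartesian_product'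
  proof (intro arg_cong[of _ _ uminus] sum.cong refl)
    fix c k assume ck: "c \<in> C" "k \<in> {..<d}"
    \<comment> \<open>The logarithm of the product splits when both factors are positive; when one
      vanishes, both sides of the identity are zero.\<close>
    have "0 \<le> p c" "0 \<le> r c k" using ck p ur(2) by auto
    then show "R (c, k) * log 2 (R (c, k)) = (p c * log 2 (p c)) * r c k + p c * (r c k * log 2 (r c k))"
      unfolding R_def fst_conv snd_conv
      by (cases "p c = 0"; cases "r c k = 0") (simp_all add: log_mult algebra_simps)
  qed
  also have "\<dots> = - (\<Sum>c\<in>C. p c * log 2 (p c) - p c * entr d (\<sigma> c))"
  proof (intro arg_cong[of _ _ uminus] sum.cong refl)
    fix c assume c: "c \<in> C"
    have "entr d (\<sigma> c) = - (\<Sum>k<d. r c k * log 2 (r c k))"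
      by (rule entr_spectral[where u = "u c"]) (use c ur in auto)
    then show "(\<Sum>k<d. (p c * log 2 (p c)) * r c k + p c * (r c k * log 2 (r c k))) = p c * log 2 (p c) - p c
        * entr d (\<sigma> c)"
      using ur(3)[OF c] by (simp add: sum.distrib sum_distrib_left[symmetric])
  qed
  finally show ?thesis by (simp add: sum_subtractf)
qed

section \<open>Marginals of the classical-quantum state\<close>

lemma sum_mult_radix:
  fixes f :: "nat \<Rightarrow> 'a::comm_monoid_add"
  shows "(\<Sum>i<m * n. f i) = (\<Sum>b<m. \<Sum>c<n. f (b * n + c))"
proof -
  have "sum f {b * n..<b * n + n} = (\<Sum>c<n. f (b * n + c))" for b
    using sum.shift_bounds_nat_ivl[of f 0 "b * n" n] by (simp add: lessThan_atLeast0 add.commute)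
  then show ?thesis by (simp add: sum.nat_group[symmetric])
qed

lemma sum_rotate: "(\<Sum>i\<in>I. \<Sum>j\<in>J. \<Sum>k\<in>K. g i j k) = (\<Sum>k\<in>K. \<Sum>i\<in>I. \<Sum>j\<in>J. g i j k)"
proof -
  have "(\<Sum>i\<in>I. \<Sum>j\<in>J. \<Sum>k\<in>K. g i j k) = (\<Sum>i\<in>I. \<Sum>k\<in>K. \<Sum>j\<in>J. g i j k)"
    by (intro sum.cong[OF refl] sum.swap)
  also have "\<dots> = (\<Sum>k\<in>K. \<Sum>i\<in>I. \<Sum>j\<in>J. g i j k)" by (rule sum.swap)
  finally show ?thesis .
qed

lemma radix_less: "b < m \<Longrightarrow> c < n \<Longrightarrow> b * n + c < m * (n::nat)"
proof -
  assume "b < m" "c < n"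
  then have "b * n + c < (b + 1) * n" by simp
  also have "\<dots> \<le> m * n" using \<open>b < m\<close> by (intro mult_le_mono1) simp
  finally show ?thesis .
qed

lemma radix_div_mod: "c < n \<Longrightarrow> (b * n + c) div n = b" "c < n \<Longrightarrow> (b * n + c) mod n = (c::nat)"
  by auto

lemma psd_mat_quadform:
  assumes "psd_mat d M"
  shows "0 \<le> Re (\<Sum>i<d. \<Sum>j<d. cnj (f i) * M $$ (i, j) * f j)"
proof -
  have M: "M \<in> carrier_mat d d" using assms by (simp add: psd_mat_def hermitian_mat_def)
  have "conjugate (vec d f) \<bullet> (M *\<^sub>v vec d f) = (\<Sum>i<d. \<Sum>j<d. cnj (f i) * M $$ (i, j) * f j)"
    using M by (auto simp: scalar_prod_def lessThan_atLeast0[symmetric] sum_distrib_left mult.assoc intro!: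
        sum.cong)
  moreover have "0 \<le> Re (conjugate (vec d f) \<bullet> (M *\<^sub>v vec d f))"
    using assms unfolding psd_mat_def by (meson vec_carrier)
  ultimately show ?thesis by simp
qed

text \<open>Passage from positivity on vectors to positivity as a sum of squares: each eigenvalue is
  the quadratic form at its own eigenvector.\<close>

lemma nonneg_quadform:
  assumes I: "finite I" "supp A \<subseteq> I" and h: "star A = A"
    and q: "\<And>v. 0 \<le> Re (\<Sum>i\<in>I. \<Sum>j\<in>I. cnj (v i) * entry A i j * v j)"
  shows "0 \<le> A"
proof -
  obtain u r where R: "resolution {..<card I} (\<lambda>k. proj I (u k)) (unit_op I)"
    and eq: "A = (\<Sum>k<card I. r k *\<^sub>R proj I (u k))" using spectral_theorem[OF I h] .
  interpret resolution "{..<card I}" "\<lambda>k. proj I (u k)" "unit_op I" by (rule R)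
  have A: "A = fc r" by (simp add: fc_def eq)
  have "0 \<le> r k" if "k < card I" for k
  proof -
    have "of_real (r k) = tr (A * proj I (u k))"
      using that by (simp add: A fc_mult_p tr_p)
    also have "\<dots> = (\<Sum>i\<in>I. \<Sum>j\<in>I. entry A i j * entry (proj I (u k)) j i)"
      by (rule tr_times) (use I supp_proj[of I "u k"] in auto)
    also have "\<dots> = (\<Sum>i\<in>I. \<Sum>j\<in>I. cnj (u k i) * entry A i j * u k j)"
      using I by (intro sum.cong) (auto simp: proj_def entry_mk)
    finally show ?thesis using q[of "u k"] by (metis Re_complex_of_real)
  qed
  then show ?thesis by (simp add: A fc_nonneg_iff)
qed

text \<open>The reduced density matrix on the first factor; \<open>b * d2 + c\<close> is the
  Kronecker index of the basis pair \<open>(b, c)\<close>.\<close>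

definition rdm1 :: "nat \<Rightarrow> nat \<Rightarrow> complex mat \<Rightarrow> nat op" where
  "rdm1 d1 d2 M = mk {..<d1} (\<lambda>b b'. \<Sum>c<d2. M $$ (b * d2 + c, b' * d2 + c))"

definition rdm2 :: "nat \<Rightarrow> nat \<Rightarrow> complex mat \<Rightarrow> nat op" where
  "rdm2 d1 d2 M = mk {..<d2} (\<lambda>c c'. \<Sum>b<d1. M $$ (b * d2 + c, b * d2 + c'))"

lemma density_op_herm:
  assumes "density_op d M" "i < d" "j < d" shows "cnj (M $$ (j, i)) = M $$ (i, j)"
proof -
  have "\<forall>i<d. \<forall>j<d. M $$ (i, j) = cnj (M $$ (j, i))"
    using assms(1) unfolding density_op_def psd_mat_def hermitian_mat_def by blast
  then show ?thesis using assms(2,3) by (metis (no_types))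
qed

lemma density_op_trace:
  assumes "density_op (d1 * d2) M" shows "(\<Sum>b<d1. \<Sum>c<d2. M $$ (b * d2 + c, b * d2 + c)) = 1"
proof -
  have "M \<in> carrier_mat (d1 * d2) (d1 * d2)" "mtrace M = 1"
    using assms unfolding density_op_def psd_mat_def hermitian_mat_def by blast+
  then show ?thesis unfolding mtrace_def by (simp add: sum_mult_radix)
qed

text \<open>A principal submatrix of a positive matrix is positive: the vector is pushed along
  \<open>h\<close> and set to zero elsewhere.\<close>

lemma psd_mat_quadform_compress:
  assumes M: "psd_mat N M" and h: "\<And>b. b < d \<Longrightarrow> h b < N" "inj_on h {..<d}"
  shows "0 \<le> Re (\<Sum>b<d. \<Sum>b'<d. cnj (v b) * M $$ (h b, h b') * v b')"
proof -
  define f where "f i = (if i \<in> h ` {..<d} then v (inv_into {..<d} h i) else 0)" for i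
  have f: "f (h b) = v b" if "b < d" for b using that h(2) by (simp add: f_def)
  have sum: "(\<Sum>i<N. g i) = (\<Sum>b<d. g (h b))" if "\<And>i. i \<notin> h ` {..<d} \<Longrightarrow> g i = 0" for g :: "nat \<Rightarrow> complex"
  proof -
    have "(\<Sum>i\<in>h ` {..<d}. g i) = (\<Sum>i<N. g i)"
      by (rule sum.mono_neutral_left) (use that h(1) in auto)
    then show ?thesis using sum.reindex[OF h(2), of g] by simp
  qed
  have "(\<Sum>i<N. \<Sum>j<N. cnj (f i) * M $$ (i, j) * f j) = (\<Sum>b<d. \<Sum>b'<d. cnj (f (h b)) * M $$ (h b, h b')
      * f (h b'))"
    by (subst sum, simp add: f_def, rule sum.cong[OF refl], rule sum) (simp add: f_def)
  also have "\<dots> = (\<Sum>b<d. \<Sum>b'<d. cnj (v b) * M $$ (h b, h b') * v b')" by (simp add: f)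
  finally show ?thesis using psd_mat_quadform[OF M, of f] by simp
qed

text \<open>A partial trace is a sum of principal submatrices, one for each value \<open>e\<close>
  of the traced-out index. Leaving the embedding \<open>h\<close> open covers both
  receivers.\<close>

lemma state_op_reduced:
  assumes M: "density_op N M" and h: "\<And>e b. e < k \<Longrightarrow> b < d \<Longrightarrow> h e b < N" "\<And>e. e < k \<Longrightarrow> inj_on (h e) {..<d}"
    and tr: "(\<Sum>b<d. \<Sum>e<k. M $$ (h e b, h e b)) = 1"
  shows "state_op d (mk {..<d} (\<lambda>b b'. \<Sum>e<k. M $$ (h e b, h e b')))" (is "state_op d ?A")
proof -
  have s: "supp ?A \<subseteq> {..<d}" by (rule supp_mk)
  have "0 \<le> ?A"
  proof (rule nonneg_quadform[OF _ s])
    show "star ?A = ?A" by (rule op_eqI) (auto simp: entry_mk density_op_herm[OF M] h)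
    fix v :: "nat \<Rightarrow> complex"
    have "(\<Sum>b<d. \<Sum>b'<d. cnj (v b) * entry ?A b b' * v b') =
        (\<Sum>b<d. \<Sum>b'<d. \<Sum>e<k. cnj (v b) * M $$ (h e b, h e b') * v b')"
      by (intro sum.cong refl) (auto simp: entry_mk sum_distrib_left sum_distrib_right)
    also have "\<dots> = (\<Sum>e<k. \<Sum>b<d. \<Sum>b'<d. cnj (v b) * M $$ (h e b, h e b') * v b')"
      by (rule sum_rotate)
    finally have eq: "(\<Sum>b<d. \<Sum>b'<d. cnj (v b) * entry ?A b b' * v b') = \<dots>" .
    show "0 \<le> Re (\<Sum>b<d. \<Sum>b'<d. cnj (v b) * entry ?A b b' * v b')"
      unfolding eq by (subst Re_sum, rule sum_nonneg, rule psd_mat_quadform_compress)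
        (use M h in \<open>auto simp: density_op_def\<close>)
  qed simp
  moreover have "tr ?A = 1" using tr by (subst tr_eq[OF _ s]) (auto simp: entry_mk)
  ultimately show ?thesis using s by (simp add: state_op_def)
qed

lemma state_op_rdm1: "density_op (d1 * d2) M \<Longrightarrow> state_op d1 (rdm1 d1 d2 M)"
  unfolding rdm1_def
  by (rule state_op_reduced) (auto simp: radix_less inj_on_def density_op_trace)

lemma state_op_rdm2: "density_op (d1 * d2) M \<Longrightarrow> state_op d2 (rdm2 d1 d2 M)"
  unfolding rdm2_def
  by (rule state_op_reduced)
    (auto simp: radix_less inj_on_def density_op_trace sum.swap[of _ "{..<d1}" "{..<d2}"])

lemma state_op_convex:
  assumes "\<And>x. x \<in> X \<Longrightarrow> state_op d (\<sigma> x)" "\<And>x. x \<in> X \<Longrightarrow> 0 \<le> q x" "(\<Sum>x\<in>X. q x) = (1::real)"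
  shows "state_op d (\<Sum>x\<in>X. q x *\<^sub>R \<sigma> x)"
proof -
  have "0 \<le> (\<Sum>x\<in>X. q x *\<^sub>R \<sigma> x)"
    using assms by (intro sum_nonneg scaleR_nonneg_nonneg) (auto simp: state_op_def)
  moreover have "supp (\<Sum>x\<in>X. q x *\<^sub>R \<sigma> x) \<subseteq> {..<d}"
    using assms(1) unfolding supp_subset_iff[OF finite_lessThan] state_op_def
    by (auto simp: supp_subset_iff sum_distrib_left sum_distrib_right intro!: sum.cong)
  moreover have "tr (\<Sum>x\<in>X. q x *\<^sub>R \<sigma> x) = (\<Sum>x\<in>X. of_real (q x))"
    using assms(1) by (auto simp: tr_sum state_op_def intro!: sum.cong)
  ultimately show ?thesis using assms(3) by (simp add: state_op_def flip: of_real_sum)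
qed

text \<open>A one-dimensional quantum part, with which a purely classical marginal counts as a
  classical-quantum state.\<close>

lemma state_op_unit1: "state_op 1 (unit_op {..<1})" "entr 1 (unit_op {..<1}) = 0"
proof -
  show "state_op 1 (unit_op {..<1})"
    by (simp add: state_op_def unit_nonneg supp_unit tr_unit del: lessThan_Suc One_nat_def)
  have "unit_op {..<1::nat} = (\<Sum>k<1::nat. (1::real) *\<^sub>R proj {..<1} (\<lambda>_. 1))"
    by (rule op_eqI) (auto simp: unit_op_def proj_def entry_mk)
  then have "entr 1 (unit_op {..<1}) = - (\<Sum>k<1::nat. 1 * log 2 1)"
    by (intro entr_spectral[where u = "\<lambda>_ _. 1"]) auto
  then show "entr 1 (unit_op {..<1}) = 0" by simp
qed

section \<open>Basis indices as tuples of digits\<close>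

lemma radix3_div_mod:
  assumes "b < m" "c < (n::nat)"
  shows "((a * m + b) * n + c) div (m * n) = a"
    "((a * m + b) * n + c) div n = a * m + b"
proof -
  show 1: "((a * m + b) * n + c) div n = a * m + b" using assms by simp
  have "((a * m + b) * n + c) div (m * n) = ((a * m + b) * n + c) div n div m"
    by (metis div_mult2_eq mult.commute)
  then show "((a * m + b) * n + c) div (m * n) = a" unfolding 1 using assms by simp
qed

lemma bij_digit1: "bij_betw (\<lambda>a. digit [m] a 0) {..<m} {..<m}"
  by (rule bij_betw_byWitness[where f' = "\<lambda>x. x"]) (auto simp: digit_def)

lemma bij_digit2: "bij_betw (\<lambda>a. (digit [m, n] a 0, digit [m, n] a 1)) {..<m * n} ({..<m} \<times> {..<n})"
proof (rule bij_betw_byWitness[where f' = "\<lambda>(x, y). x * n + y"])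
  show "\<forall>a\<in>{..<m * n}. (case (digit [m, n] a 0, digit [m, n] a 1) of (x, y) \<Rightarrow> x * n + y) = a"
    by (auto simp: digit_def less_mult_imp_div_less)
  show "(\<lambda>a. (digit [m, n] a 0, digit [m, n] a 1)) ` {..<m * n} \<subseteq> {..<m} \<times> {..<n}"
    by (cases "m = 0"; cases "n = 0") (auto simp: digit_def)
qed (auto simp: digit_def radix_less radix_div_mod)

lemma bij_digit3:
  "bij_betw (\<lambda>a. (digit [l, m, n] a 0, digit [l, m, n] a 1, digit [l, m, n] a 2)) {..<l * (m
      * n)} ({..<l} \<times> {..<m} \<times> {..<n})"
proof (rule bij_betw_byWitness[where f' = "\<lambda>(x, y, z). (x * m + y) * n + z"])
  show "\<forall>a\<in>{..<l * (m * n)}. (case (digit [l, m, n] a 0, digit [l, m, n] a 1, digit [l, m, n] a 2) of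
      (x, y, z) \<Rightarrow> (x * m + y) * n + z) = a"
  proof
    fix a assume "a \<in> {..<l * (m * n)}"
    then have "a div (m * n) < l" by (simp add: less_mult_imp_div_less)
    moreover have "a div (m * n) = a div n div m" by (metis div_mult2_eq mult.commute)
    ultimately show "(case (digit [l, m, n] a 0, digit [l, m, n] a 1, digit [l, m, n] a 2) of (x, y, z) \<Rightarrow> (x
        * m + y) * n + z) = a"
      by (simp add: digit_def numeral_2_eq_2)
  qed
  show "(\<lambda>a. (digit [l, m, n] a 0, digit [l, m, n] a 1, digit [l, m, n] a 2)) ` {..<l * (m
      * n)} \<subseteq> {..<l} \<times> {..<m} \<times> {..<n}"
    by (cases "l = 0"; cases "m = 0"; cases "n = 0") (auto simp: digit_def numeral_2_eq_2)
  show "(\<lambda>(x, y, z). (x * m + y) * n + z) ` ({..<l} \<times> {..<m} \<times> {..<n}) \<subseteq> {..<l * (m * n)}"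
    using radix_less[OF radix_less, of _ l _ m _ n] by (auto simp: mult.assoc)
  show "\<forall>a'\<in>{..<l} \<times> {..<m} \<times> {..<n}.
    (digit [l, m, n] (case a' of (x, y, z) \<Rightarrow> (x * m + y) * n + z) 0,
     digit [l, m, n] (case a' of (x, y, z) \<Rightarrow> (x * m + y) * n + z) 1,
     digit [l, m, n] (case a' of (x, y, z) \<Rightarrow> (x * m + y) * n + z) 2) = a'"
    by (auto simp: digit_def numeral_2_eq_2 radix3_div_mod radix_div_mod)
qed

lemma sum_if_out:
  "(\<Sum>k\<in>S. if Q then f k else 0) = (if Q then (\<Sum>k\<in>S. f k) else (0::'a::comm_monoid_add))"
  by simp

text \<open>In nested form, a conjunction of index equations collapses one summation at a
  time.\<close>

lemma if_conj_zero: "(if A \<and> B then x else 0) = (if A then if B then x else 0 else 0)"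
  by simp

section \<open>The channel with its input distribution and the reduced ensembles\<close>

locale broadcast =
  fixes nX d1 d2 nW :: nat and \<rho> :: "nat \<Rightarrow> complex mat"
    and pW :: "nat \<Rightarrow> real" and pXW :: "nat \<Rightarrow> nat \<Rightarrow> real"
  assumes dens: "\<And>x. x < nX \<Longrightarrow> density_op (d1 * d2) (\<rho> x)"
    and pos_dims: "0 < nX" "0 < d1" "0 < d2"
    and pW0: "\<And>w. w < nW \<Longrightarrow> 0 \<le> pW w" and pW1: "(\<Sum>w<nW. pW w) = 1"
    and pXW0: "\<And>w x. w < nW \<Longrightarrow> x < nX \<Longrightarrow> 0 \<le> pXW w x" and pXW1: "\<And>w. w < nW \<Longrightarrow> (\<Sum>x<nX. pXW w x) = 1"
begin

definition pX :: "nat \<Rightarrow> real" where "pX x = (\<Sum>w<nW. pW w * pXW w x)"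

text \<open>The suffix names the receiver: \<sigma> is the state given the input letter, \<omega>
  the state given the auxiliary letter, and \<tau> the unconditioned average.\<close>

definition \<sigma>1 :: "nat \<Rightarrow> nat op" where "\<sigma>1 x = rdm1 d1 d2 (\<rho> x)"
definition \<sigma>2 :: "nat \<Rightarrow> nat op" where "\<sigma>2 x = rdm2 d1 d2 (\<rho> x)"
definition \<omega>1 :: "nat \<Rightarrow> nat op" where "\<omega>1 w = (\<Sum>x<nX. pXW w x *\<^sub>R \<sigma>1 x)"
definition \<omega>2 :: "nat \<Rightarrow> nat op" where "\<omega>2 w = (\<Sum>x<nX. pXW w x *\<^sub>R \<sigma>2 x)"
definition \<tau>1 :: "nat op" where "\<tau>1 = (\<Sum>w<nW. pW w *\<^sub>R \<omega>1 w)"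
definition \<tau>2 :: "nat op" where "\<tau>2 = (\<Sum>w<nW. pW w *\<^sub>R \<omega>2 w)"

lemma nW_pos: "0 < nW" using pW1 by (cases nW) auto

lemma pX0: "x < nX \<Longrightarrow> 0 \<le> pX x" unfolding pX_def by (intro sum_nonneg) (auto simp: pW0 pXW0)

lemma pX1: "(\<Sum>x<nX. pX x) = 1"
proof -
  have "(\<Sum>x<nX. pX x) = (\<Sum>w<nW. pW w * (\<Sum>x<nX. pXW w x))"
    unfolding pX_def by (subst sum.swap) (simp add: sum_distrib_left)
  also have "\<dots> = (\<Sum>w<nW. pW w)" by (intro sum.cong) (auto simp: pXW1)
  finally show ?thesis by (simp add: pW1)
qed

lemma st_\<sigma>: "x < nX \<Longrightarrow> state_op d1 (\<sigma>1 x)" "x < nX \<Longrightarrow> state_op d2 (\<sigma>2 x)"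
  unfolding \<sigma>1_def \<sigma>2_def using state_op_rdm1 state_op_rdm2 dens by auto

lemma st_\<omega>: "w < nW \<Longrightarrow> state_op d1 (\<omega>1 w)" "w < nW \<Longrightarrow> state_op d2 (\<omega>2 w)"
  unfolding \<omega>1_def \<omega>2_def by (rule state_op_convex; simp add: st_\<sigma> pXW0 pXW1)+

lemma st_\<tau>: "state_op d1 \<tau>1" "state_op d2 \<tau>2"
  unfolding \<tau>1_def \<tau>2_def by (rule state_op_convex; simp add: st_\<omega> pW0 pW1)+

abbreviation \<theta> :: "complex mat" where "\<theta> \<equiv> theta nW nX d1 d2 pW pXW \<rho>"
abbreviation ds :: "nat list" where "ds \<equiv> [nW, nX, d1, d2]"

definition idx :: "nat \<Rightarrow> nat \<Rightarrow> nat \<Rightarrow> nat \<Rightarrow> nat" where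
  "idx w x b c = (w * nX + x) * (d1 * d2) + (b * d2 + c)"

lemma idx_less: "w < nW \<Longrightarrow> x < nX \<Longrightarrow> b < d1 \<Longrightarrow> c < d2 \<Longrightarrow> idx w x b c < nW * nX * (d1 * d2)"
  unfolding idx_def by (intro radix_less) auto

lemma sum_idx:
  "(\<Sum>i<nW * nX * (d1 * d2). f i) = (\<Sum>w<nW. \<Sum>x<nX. \<Sum>b<d1. \<Sum>c<d2. f (idx w x b c))"
  unfolding sum_mult_radix idx_def ..

lemma dims_\<rho>: "x < nX \<Longrightarrow> dim_row (\<rho> x) = d1 * d2 \<and> dim_col (\<rho> x) = d1 * d2"
  using dens[of x] unfolding density_op_def psd_mat_def hermitian_mat_def by auto

lemma theta_idx:
  assumes "w < nW" "x < nX" "b < d1" "c < d2" "w' < nW" "x' < nX" "b' < d1" "c' < d2"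
  shows "\<theta> $$ (idx w x b c, idx w' x' b' c') =
    (if w = w' then if x = x' then of_real (pW w * pXW w x) * \<rho> x $$ (b * d2 + c, b' * d2 + c') else 0 else 0)"
proof -
  have r: "b * d2 + c < d1 * d2" "b' * d2 + c' < d1 * d2" using assms by (auto intro: radix_less)
  have dm: "idx w x b c mod (d1 * d2) = b * d2 + c" "idx w x b c div (d1 * d2) = w * nX + x"
    "idx w' x' b' c' mod (d1 * d2) = b' * d2 + c'" "idx w' x' b' c' div (d1 * d2) = w' * nX + x'"
    "idx w x b c div (nX * (d1 * d2)) = w" "idx w' x' b' c' div (nX * (d1 * d2)) = w'"
    "idx w x b c mod (nX * (d1 * d2)) = x * (d1 * d2) + (b * d2 + c)"
    "idx w' x' b' c' mod (nX * (d1 * d2)) = x' * (d1 * d2) + (b' * d2 + c')"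
  proof -
    show "idx w x b c mod (d1 * d2) = b * d2 + c" "idx w x b c div (d1 * d2) = w * nX + x"
      "idx w' x' b' c' mod (d1 * d2) = b' * d2 + c'" "idx w' x' b' c' div (d1 * d2) = w' * nX + x'"
      unfolding idx_def using r by (simp_all only: radix_div_mod)
    show "idx w x b c div (nX * (d1 * d2)) = w" "idx w' x' b' c' div (nX * (d1 * d2)) = w'"
      unfolding idx_def using r assms by (simp_all only: radix3_div_mod)
    have *: "idx w x b c = w * (nX * (d1 * d2)) + (x * (d1 * d2) + (b * d2 + c))" for w x b c
      by (simp add: idx_def algebra_simps)
    show "idx w x b c mod (nX * (d1 * d2)) = x * (d1 * d2) + (b * d2 + c)"
      "idx w' x' b' c' mod (nX * (d1 * d2)) = x' * (d1 * d2) + (b' * d2 + c')"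
      unfolding * using radix_less[OF assms(2) r(1)] radix_less[OF assms(6) r(2)]
          by (simp_all only: radix_div_mod)
  qed
  have i: "idx w x b c < nW * nX * (d1 * d2)" "idx w' x' b' c' < nW * nX * (d1 * d2)"
    using assms by (auto intro: idx_less)
  have i': "idx w x b c < nW * (nX * (d1 * d2))" "idx w' x' b' c' < nW * (nX * (d1 * d2))"
    using i by (auto simp: mult.assoc)
  have x2: "x * (d1 * d2) + (b * d2 + c) < nX * (d1 * d2)" "x' * (d1 * d2) + (b' * d2 + c') < nX * (d1 * d2)"
    using radix_less[OF assms(2) r(1)] radix_less[OF assms(6) r(2)] by auto
  have k: "kron (ket_bra nW v) (kron (ket_bra nX y) (\<rho> y)) $$ (idx w x b c, idx w' x' b' c') =
      (if v = w then if w = w' then if y = x then if x = x' then \<rho> y $$ (b * d2 + c, b' * d2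
          + c') else 0 else 0 else 0 else 0)"
    if "y < nX" for v y
  proof -
    have d: "dim_row (\<rho> y) = d1 * d2" "dim_col (\<rho> y) = d1 * d2" using dims_\<rho>[OF that] by auto
    have inner: "kron (ket_bra nX y) (\<rho> y) $$ (x * (d1 * d2) + (b * d2 + c), x' * (d1 * d2) + (b' * d2 + c')) =
      (if y = x then if x = x' then \<rho> y $$ (b * d2 + c, b' * d2 + c') else 0 else 0)"
      using x2 assms r d by (auto simp: kron_def ket_bra_def radix_div_mod)
    have dk: "dim_row (kron (ket_bra nX y) (\<rho> y)) = nX * (d1 * d2)" "dim_col (kron (ket_bra nX y) (\<rho> y))
        = nX * (d1 * d2)"
      by (auto simp: kron_def ket_bra_def d)
    have "kron (ket_bra nW v) (kron (ket_bra nX y) (\<rho> y)) $$ (idx w x b c, idx w' x' b' c') =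
        ket_bra nW v $$ (w, w') * kron (ket_bra nX y) (\<rho> y) $$ (x * (d1 * d2) + (b * d2 + c), x' * (d1 * d2)
            + (b' * d2 + c'))"
      unfolding kron_def[of "ket_bra nW v"] dk
      using i' by (simp add: ket_bra_def dm)
    then show ?thesis unfolding inner using assms by (auto simp: ket_bra_def)
  qed
  have "\<theta> $$ (idx w x b c, idx w' x' b' c') = (\<Sum>v<nW. \<Sum>y<nX.
      if v = w then if y = x then (if w = w' then if x = x' then of_real (pW v * pXW v y) * \<rho> y $$ (b * d2
          + c, b' * d2 + c') else 0 else 0) else 0 else 0)"
    unfolding theta_def Let_def using i by (simp del: of_real_mult) (intro sum.cong refl, auto simp: k)
  also have "\<dots> = (if w = w' then if x = x' then of_real (pW w * pXW w x) * \<rho> x $$ (b * d2 + c, b' * d2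
      + c') else 0 else 0)"
    using assms by (simp add: sum_if_out)
  finally show ?thesis .
qed

lemma digit_idx:
  assumes "w < nW" "x < nX" "b < d1" "c < d2" "k < 4"
  shows "digit ds (idx w x b c) k = [w, x, b, c] ! k"
proof -
  have *: "idx w x b c = ((w * nX + x) * d1 + b) * d2 + c" by (simp add: idx_def algebra_simps)
  have 2: "idx w x b c div d2 = (w * nX + x) * d1 + b" "idx w x b c mod d2 = c"
    unfolding * using assms by auto
  have 1: "idx w x b c div (d1 * d2) = w * nX + x" unfolding * using assms radix3_div_mod by simp
  have 0: "idx w x b c div (nX * (d1 * d2)) = w"
  proof -
    have "idx w x b c div (nX * (d1 * d2)) = idx w x b c div (d1 * d2) div nX"
      by (metis div_mult2_eq mult.commute)
    then show ?thesis unfolding 1 using assms by simp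
  qed
  have "k = 0 \<or> k = 1 \<or> k = 2 \<or> k = 3" using assms(5) by auto
  then show ?thesis using assms
    by (elim disjE) (simp_all add: digit_def numeral_2_eq_2 numeral_3_eq_3 0 1[unfolded One_nat_def] 2 del:
        mult_Suc)
qed

text \<open>One formula for every marginal. That the state is diagonal in \<open>w\<close> and
  \<open>x\<close> is exploited here once and for all, so only the digits of \<open>B1\<close> and
  \<open>B2\<close> occur twice; each concrete marginal is then a matter of collapsing sums.\<close>

lemma marginal_theta:
  assumes ks: "set ks \<subseteq> {..<4}"
    and a: "a < prod_list (map (\<lambda>k. ds ! k) ks)" and a': "a' < prod_list (map (\<lambda>k. ds ! k) ks)"
  shows "marginal ds ks \<theta> $$ (a, a') = (\<Sum>w<nW. \<Sum>x<nX. \<Sum>b<d1. \<Sum>c<d2. \<Sum>b'<d1. \<Sum>c'<d2.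
    if (\<forall>t<length ks. [w, x, b, c] ! (ks ! t) = digit (map (\<lambda>k. ds ! k) ks) a t \<and>
        [w, x, b', c'] ! (ks ! t) = digit (map (\<lambda>k. ds ! k) ks) a' t) \<and>
       (\<forall>k<4. k \<notin> set ks \<longrightarrow> [w, x, b, c] ! k = [w, x, b', c'] ! k)
    then of_real (pW w * pXW w x) * \<rho> x $$ (b * d2 + c, b' * d2 + c') else 0)"
proof -
  let ?es = "map (\<lambda>k. ds ! k) ks"
  have N: "prod_list ds = nW * nX * (d1 * d2)" and len: "length ds = 4" by simp_all
  have kt: "ks ! t < 4" if "t < length ks" for t using ks that nth_mem by blast
  have "marginal ds ks \<theta> $$ (a, a') = (\<Sum>i<nW * nX * (d1 * d2). \<Sum>j<nW * nX * (d1 * d2).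
      if (\<forall>t<length ks. digit ds i (ks ! t) = digit ?es a t \<and> digit ds j (ks ! t) = digit ?es a' t)
         \<and> (\<forall>k<4. k \<notin> set ks \<longrightarrow> digit ds i k = digit ds j k) then \<theta> $$ (i, j) else 0)"
    unfolding marginal_def Let_def N len using a a' by simp
  also have "\<dots> = (\<Sum>w<nW. \<Sum>x<nX. \<Sum>b<d1. \<Sum>c<d2. \<Sum>w'<nW. \<Sum>x'<nX. \<Sum>b'<d1. \<Sum>c'<d2.
      if w = w' then if x = x' then (if (\<forall>t<length ks. [w, x, b, c] ! (ks ! t) = digit ?es a t
          \<and> [w, x, b', c'] ! (ks ! t) = digit ?es a' t)
         \<and> (\<forall>k<4. k \<notin> set ks \<longrightarrow> [w, x, b, c] ! k = [w, x, b', c'] ! k)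
      then of_real (pW w * pXW w x) * \<rho> x $$ (b * d2 + c, b' * d2 + c') else 0) else 0 else 0)"
    unfolding sum_idx
  proof (intro sum.cong refl)
    fix w x b c w' x' b' c'
    assume m: "w \<in> {..<nW}" "x \<in> {..<nX}" "b \<in> {..<d1}" "c \<in> {..<d2}" "w' \<in> {..<nW}" "x' \<in> {..<nX}"
        "b' \<in> {..<d1}" "c' \<in> {..<d2}"
    have dg: "digit ds (idx w x b c) k = [w, x, b, c] ! k" "digit ds (idx w' x' b' c') k
        = [w', x', b', c'] ! k" if "k < 4" for k
      using digit_idx m that by auto
    have th: "\<theta> $$ (idx w x b c, idx w' x' b' c') =
      (if w = w' then if x = x' then of_real (pW w * pXW w x) * \<rho> x $$ (b * d2 + c, b' * d2
          + c') else 0 else 0)"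
      using theta_idx m by simp
    show "(if (\<forall>t<length ks. digit ds (idx w x b c) (ks ! t) = digit ?es a t \<and> digit ds (idx w' x' b' c')
        (ks ! t) = digit ?es a' t)
         \<and> (\<forall>k<4. k \<notin> set ks \<longrightarrow> digit ds (idx w x b c) k = digit ds (idx w' x' b' c') k) then \<theta> $$
             (idx w x b c, idx w' x' b' c') else 0) =
      (if w = w' then if x = x' then (if (\<forall>t<length ks. [w, x, b, c] ! (ks ! t) = digit ?es a t
          \<and> [w, x, b', c'] ! (ks ! t) = digit ?es a' t)
         \<and> (\<forall>k<4. k \<notin> set ks \<longrightarrow> [w, x, b, c] ! k = [w, x, b', c'] ! k)
      then of_real (pW w * pXW w x) * \<rho> x $$ (b * d2 + c, b' * d2 + c') else 0) else 0 else 0)"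
    proof -
      have "((\<forall>t<length ks. digit ds (idx w x b c) (ks ! t) = digit ?es a t \<and> digit ds (idx w' x' b' c')
          (ks ! t) = digit ?es a' t)
         \<and> (\<forall>k<4. k \<notin> set ks \<longrightarrow> digit ds (idx w x b c) k = digit ds (idx w' x' b' c') k)) \<longleftrightarrow>
        ((\<forall>t<length ks. [w, x, b, c] ! (ks ! t) = digit ?es a t \<and> [w', x', b', c'] ! (ks ! t) = digit ?es a' t)
         \<and> (\<forall>k<4. k \<notin> set ks \<longrightarrow> [w, x, b, c] ! k = [w', x', b', c'] ! k))"
        using dg kt by (metis (no_types, lifting))
      then show ?thesis unfolding th by (cases "w = w'"; cases "x = x'") (simp_all only: if_True if_False
          refl if_cancel)
    qed
  qed
  also have "\<dots> = (\<Sum>w<nW. \<Sum>x<nX. \<Sum>b<d1. \<Sum>c<d2. \<Sum>b'<d1. \<Sum>c'<d2.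
    if (\<forall>t<length ks. [w, x, b, c] ! (ks ! t) = digit ?es a t \<and> [w, x, b', c'] ! (ks ! t) = digit ?es a' t) \<and>
       (\<forall>k<4. k \<notin> set ks \<longrightarrow> [w, x, b, c] ! k = [w, x, b', c'] ! k)
    then of_real (pW w * pXW w x) * \<rho> x $$ (b * d2 + c, b' * d2 + c') else 0)"
    by (rule sum.cong[OF refl], rule sum.cong[OF refl], rule sum.cong[OF refl], rule sum.cong[OF refl])
      (simp add: sum_if_out)
  finally show ?thesis .
qed

lemma marginal_carrier: "marginal ds ks \<theta> \<in> carrier_mat (prod_list (map (\<lambda>k. ds ! k) ks)) (prod_list (map
    (\<lambda>k. ds ! k) ks))"
  by (simp add: marginal_def Let_def)

end

lemma bij_betw_swap: "bij_betw (\<lambda>a. (f a, g a)) A (X \<times> Y) \<Longrightarrow> bij_betw (\<lambda>a. (g a, f a)) A (Y \<times> X)"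
proof -
  assume b: "bij_betw (\<lambda>a. (f a, g a)) A (X \<times> Y)"
  have "bij_betw (\<lambda>(x, y). (y, x)) (X \<times> Y) (Y \<times> X)"
    by (rule bij_betw_byWitness[where f' = "\<lambda>(x, y). (y, x)"]) auto
  from bij_betw_trans[OF b this] show ?thesis by (simp add: comp_def)
qed

lemma bij_betw_rotate:
  "bij_betw (\<lambda>a. (f a, g a, h a)) A (X \<times> Y \<times> Z) \<Longrightarrow> bij_betw (\<lambda>a. ((h a, f a), g a)) A ((Z \<times> X) \<times> Y)"
proof -
  assume b: "bij_betw (\<lambda>a. (f a, g a, h a)) A (X \<times> Y \<times> Z)"
  have "bij_betw (\<lambda>(x, y, z). ((z, x), y)) (X \<times> Y \<times> Z) ((Z \<times> X) \<times> Y)"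
    by (rule bij_betw_byWitness[where f' = "\<lambda>((z, x), y). (x, y, z)"]) auto
  from bij_betw_trans[OF b this] show ?thesis by (simp add: comp_def)
qed

text \<open>A trivial classical label \<open>()\<close> or a trivial quantum dimension 1 brings
  purely quantum and purely classical marginals into the block form.\<close>

lemma bij_betw_unit: "bij_betw f A Y \<Longrightarrow> bij_betw (\<lambda>a. ((), f a)) A ({()} \<times> Y)"
  "bij_betw f A Y \<Longrightarrow> bij_betw (\<lambda>a. (f a, 0::nat)) A (Y \<times> {..<1})"
  by (auto simp: bij_betw_def inj_on_def image_iff)

context broadcast
begin

lemma entry_\<sigma>: "b < d1 \<Longrightarrow> b' < d1 \<Longrightarrow> entry (\<sigma>1 x) b b' = (\<Sum>c<d2. \<rho> x $$ (b * d2 + c, b' * d2 + c))"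
  "c < d2 \<Longrightarrow> c' < d2 \<Longrightarrow> entry (\<sigma>2 x) c c' = (\<Sum>b<d1. \<rho> x $$ (b * d2 + c, b * d2 + c'))"
  by (simp_all add: \<sigma>1_def \<sigma>2_def rdm1_def rdm2_def entry_mk)

definition Hcl :: "('i \<Rightarrow> real) \<Rightarrow> 'i set \<Rightarrow> real" where
  "Hcl p C = - (\<Sum>c\<in>C. p c * log 2 (p c))"

lemmas cond_simps = All_less_Suc eval_nat_numeral if_conj_zero sum_if_out

lemma sum_\<sigma>1: "b < d1 \<Longrightarrow> b' < d1 \<Longrightarrow>
    (\<Sum>c<d2. k * \<rho> x $$ (b * d2 + c, b' * d2 + c)) = k * entry (\<sigma>1 x) b b'"
  by (simp add: entry_\<sigma> flip: sum_distrib_left)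

lemma sum_\<sigma>2: "c < d2 \<Longrightarrow> c' < d2 \<Longrightarrow>
    (\<Sum>b<d1. k * \<rho> x $$ (b * d2 + c, b * d2 + c')) = k * entry (\<sigma>2 x) c c'"
  by (simp add: entry_\<sigma> flip: sum_distrib_left)

lemma sum_\<omega>: "(\<Sum>x<nX. of_real (pW w) * of_real (pXW w x) * entry (\<sigma>1 x) b b') = of_real (pW w)
    * entry (\<omega>1 w) b b'"
  "(\<Sum>x<nX. of_real (pW w) * of_real (pXW w x) * entry (\<sigma>2 x) b b') = of_real (pW w) * entry (\<omega>2 w) b b'"
  by (simp_all add: \<omega>1_def \<omega>2_def entry_sum sum_distrib_left mult.assoc)

lemma sum_w_pX: "(\<Sum>w<nW. of_real (pW w) * of_real (pXW w x) * y) = of_real (pX x) * (y :: complex)"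
  by (simp add: pX_def sum_distrib_right)

lemma sum_\<tau>: "(\<Sum>w<nW. of_real (pW w) * entry (\<omega>1 w) b b') = entry \<tau>1 b b'"
  "(\<Sum>w<nW. of_real (pW w) * entry (\<omega>2 w) b b') = entry \<tau>2 b b'"
  by (simp_all add: \<tau>1_def \<tau>2_def entry_sum)

lemma sum_\<sigma>_trace: "x < nX \<Longrightarrow> (\<Sum>b<d1. k * entry (\<sigma>1 x) b b) = k"
  using st_\<sigma>(1)[of x] tr_eq[of "{..<d1}" "\<sigma>1 x"] by (simp add: state_op_def flip: sum_distrib_left)

lemma sum_x_weight: "w < nW \<Longrightarrow> (\<Sum>x<nX. of_real (pW w) * of_real (pXW w x)) = complex_of_real (pW w)"
  using pXW1[of w] by (simp flip: sum_distrib_left of_real_sum)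

lemma sum_w_weight: "(\<Sum>w<nW. of_real (pW w) * of_real (pXW w x)) = complex_of_real (pX x)"
  by (simp add: pX_def)

text \<open>Sums over discarded systems are recognised from the inside out: first the reduced letter
  states, then averages over \<open>x\<close>, then averages over \<open>w\<close>, or plain
  probabilities where the quantum part is traced out.\<close>

lemmas collapse_simps = sum_\<sigma>_trace sum_x_weight sum_w_weight sum_\<sigma>1 sum_\<sigma>2 sum_\<omega> sum_w_pX sum_\<tau>

lemma sum_pair_pX: "(\<Sum>c\<in>{..<nW} \<times> {..<nX}. (case c of (w, x) \<Rightarrow> pW w * pXW w x) * entr d1 (case c of
    (w, x) \<Rightarrow> \<sigma>1 x))
    = (\<Sum>x<nX. pX x * entr d1 (\<sigma>1 x))"
  unfolding sum.cartesian_product' by (subst sum.swap) (simp add: pX_def sum_distrib_right)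

lemmas unit1 = state_op_unit1 state_op_unit1[unfolded One_nat_def]

lemma entry_unit1: "entry (unit_op {..<Suc 0}) 0 0 = 1" by (simp add: unit_op_def entry_mk)

lemma digit_bounds:
  "0 < m \<Longrightarrow> digit [m] a 0 < m" "0 < m \<Longrightarrow> digit [m, n] a 0 < m" "0 < n \<Longrightarrow> digit [m, n] a (Suc 0) < n"
  "0 < l \<Longrightarrow> digit [l, m, n] a 0 < l" "0 < m \<Longrightarrow> digit [l, m, n] a (Suc 0) < m" "0 < n \<Longrightarrow> digit [l, m, n] a 2 < n"
  "0 < n \<Longrightarrow> digit [l, m, n] a (Suc (Suc 0)) < n"
  by (simp_all add: digit_def)

lemma ent_block:
  assumes "bij_betw (\<lambda>a. (cls a, dig a)) {..<D} (C \<times> {..<d})" "finite C" "D = prod_list (map (\<lambda>k. ds ! k) ks)"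
    and "\<And>c. c \<in> C \<Longrightarrow> state_op d (\<sigma> c)" "\<And>c. c \<in> C \<Longrightarrow> 0 \<le> p c"
    and "\<And>a a'. a < D \<Longrightarrow> a' < D \<Longrightarrow> marginal ds ks \<theta> $$ (a, a') =
      (if cls a = cls a' then of_real (p (cls a)) * entry (\<sigma> (cls a)) (dig a) (dig a') else 0)"
  shows "ent ds ks \<theta> = Hcl p C + (\<Sum>c\<in>C. p c * entr d (\<sigma> c))"
  unfolding ent_def Hcl_def using assms marginal_carrier[of ks] by (intro cq_block_entropy) auto

lemmas block_simps = marginal_theta cond_simps collapse_simps digit_bounds nW_pos pos_dims entry_unit1
  unit1 st_\<sigma> st_\<omega> st_\<tau> pW0 pX0 pXW0

lemma ent_W: "ent ds [0] \<theta> = Hcl pW {..<nW}"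
proof -
  have "ent ds [0] \<theta> = Hcl pW {..<nW} + (\<Sum>w\<in>{..<nW}. pW w * entr 1 (unit_op {..<1}))"
    by (rule ent_block[OF bij_betw_unit(2)[OF bij_digit1]]) (auto simp: block_simps)
  then show ?thesis by (simp add: unit1)
qed

lemma ent_X: "ent ds [1] \<theta> = Hcl pX {..<nX}"
proof -
  have "ent ds [1] \<theta> = Hcl pX {..<nX} + (\<Sum>x\<in>{..<nX}. pX x * entr 1 (unit_op {..<1}))"
    by (rule ent_block[OF bij_betw_unit(2)[OF bij_digit1]]) (auto simp: block_simps)
  then show ?thesis by (simp add: unit1)
qed

lemma ent_XW: "ent ds [1, 0] \<theta> = Hcl (\<lambda>(w, x). pW w * pXW w x) ({..<nW} \<times> {..<nX})"
proof -
  have "ent ds [1, 0] \<theta> = Hcl (\<lambda>(w, x). pW w * pXW w x) ({..<nW} \<times> {..<nX}) + (\<Sum>c\<in>({..<nW} \<times> {..<nX}).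
      (\<lambda>(w, x). pW w * pXW w x) c * entr 1 (unit_op {..<1}))"
    \<comment> \<open>The marginal lists X before W whereas the classical label is
      \<open>(w, x)\<close>, hence the swap.\<close>
    by (rule ent_block[OF bij_betw_unit(2)[OF bij_betw_swap[OF bij_digit2]]]) (auto simp: block_simps)
  then show ?thesis by (simp add: unit1)
qed

lemma ent_B1: "ent ds [2] \<theta> = entr d1 \<tau>1"
proof -
  have "ent ds [2] \<theta> = Hcl (\<lambda>_. 1) {()} + (\<Sum>c\<in>{()}. 1 * entr d1 \<tau>1)"
    by (rule ent_block[OF bij_betw_unit(1)[OF bij_digit1]]) (auto simp: block_simps)
  then show ?thesis by (simp add: Hcl_def)
qed

lemma ent_B2: "ent ds [3] \<theta> = entr d2 \<tau>2"
proof -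
  have "ent ds [3] \<theta> = Hcl (\<lambda>_. 1) {()} + (\<Sum>c\<in>{()}. 1 * entr d2 \<tau>2)"
    by (rule ent_block[OF bij_betw_unit(1)[OF bij_digit1]]) (auto simp: block_simps)
  then show ?thesis by (simp add: Hcl_def)
qed

lemma ent_B1W: "ent ds [2, 0] \<theta> = Hcl pW {..<nW} + (\<Sum>w<nW. pW w * entr d1 (\<omega>1 w))"
  by (rule ent_block[OF bij_betw_swap[OF bij_digit2]]) (auto simp: block_simps)

lemma ent_XB1: "ent ds [1, 2] \<theta> = Hcl pX {..<nX} + (\<Sum>x<nX. pX x * entr d1 (\<sigma>1 x))"
  by (rule ent_block[OF bij_digit2]) (auto simp: block_simps)

lemma ent_WB2: "ent ds [0, 3] \<theta> = Hcl pW {..<nW} + (\<Sum>w<nW. pW w * entr d2 (\<omega>2 w))"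
  by (rule ent_block[OF bij_digit2]) (auto simp: block_simps)

text \<open>Given \<open>x\<close>, the state of \<open>B1\<close> does not depend on
  \<open>w\<close>, so the quantum term involves only the marginal \<open>pX\<close> although the
  classical part keeps the pair.\<close>

lemma ent_XB1W: "ent ds [1, 2, 0] \<theta> = Hcl (\<lambda>(w, x). pW w * pXW w x) ({..<nW} \<times> {..<nX}) + (\<Sum>x<nX. pX x
    * entr d1 (\<sigma>1 x))"
proof -
  have "ent ds [1, 2, 0] \<theta> = Hcl (\<lambda>(w, x). pW w * pXW w x) ({..<nW} \<times> {..<nX}) + (\<Sum>c\<in>({..<nW} \<times> {..<nX}).
      (\<lambda>(w, x). pW w * pXW w x) c * entr d1 ((\<lambda>(w, x). \<sigma>1 x) c))"
    by (rule ent_block[OF bij_betw_rotate[OF bij_digit3]]) (auto simp: block_simps)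
  then show ?thesis by (simp add: sum_pair_pX)
qed

text \<open>All classical entropies cancel, leaving a difference of conditional entropies, that is,
  an averaged Holevo quantity.\<close>

lemma qcmi_theta: "qcmi ds [1] [2] [0] \<theta> = (\<Sum>w<nW. pW w * entr d1 (\<omega>1 w)) - (\<Sum>x<nX. pX x * entr d1 (\<sigma>1 x))"
  unfolding qcmi_def by (simp add: ent_XW[simplified] ent_B1W[simplified] ent_XB1W[simplified]
      ent_W[simplified])

lemma qmi_theta_W: "qmi ds [0] [3] \<theta> = entr d2 \<tau>2 - (\<Sum>w<nW. pW w * entr d2 (\<omega>2 w))"
  unfolding qmi_def by (simp add: ent_W[simplified] ent_B2[simplified] ent_WB2[simplified])

lemma qmi_theta_X: "qmi ds [1] [2] \<theta> = entr d1 \<tau>1 - (\<Sum>x<nX. pX x * entr d1 (\<sigma>1 x))"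
  unfolding qmi_def by (simp add: ent_X[simplified] ent_B1[simplified] ent_XB1[simplified])

end

section \<open>Transfer between operators and matrices\<close>

text \<open>Mixed-radix evaluation, most significant digit first; on \<open>valid\<close> digit
  lists the functions \<open>digit\<close> invert it.\<close>

fun encode :: "nat list \<Rightarrow> nat list \<Rightarrow> nat" where
  "encode (d # ds) (x # xs) = x * prod_list ds + encode ds xs"
| "encode _ _ = 0"

definition valid :: "nat list \<Rightarrow> nat list \<Rightarrow> bool" where
  "valid ds xs \<longleftrightarrow> list_all2 (\<lambda>x d. x < d) xs ds"

lemma valid_simps [simp]: "valid [] xs \<longleftrightarrow> xs = []" "valid (d # ds) (x # xs) \<longleftrightarrow> x < d \<and> valid ds xs"
  "valid ds [] \<longleftrightarrow> ds = []"
  by (auto simp: valid_def)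

lemma valid_Cons: "valid (d # ds) xs \<longleftrightarrow> (\<exists>y ys. xs = y # ys \<and> y < d \<and> valid ds ys)"
  by (auto simp: valid_def list_all2_Cons2)

lemma valid_length: "valid ds xs \<Longrightarrow> length xs = length ds"
  by (auto simp: valid_def list_all2_lengthD)

lemma encode_less: "valid ds xs \<Longrightarrow> encode ds xs < prod_list ds"
  by (induction ds arbitrary: xs) (auto simp: valid_Cons radix_less)

lemma encode_surj: "i < prod_list ds \<Longrightarrow> \<exists>xs. valid ds xs \<and> encode ds xs = i"
proof (induction ds arbitrary: i)
  case (Cons d ds)
  let ?D = "prod_list ds"
  have "i < d * ?D" using Cons.prems by simp
  then have "0 < ?D" by (metis gr_zeroI mult_0_right not_less_zero)
  then obtain xs where xs: "valid ds xs" "encode ds xs = i mod ?D" using Cons.IH[of "i mod ?D"] by auto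
  have "i div ?D < d" using Cons.prems by (simp add: less_mult_imp_div_less)
  then have "valid (d # ds) (i div ?D # xs) \<and> encode (d # ds) (i div ?D # xs) = i" using xs by simp
  then show ?case by blast
qed simp

lemma digit_Cons: "digit (d # ds) i 0 = (i div prod_list ds) mod d" "digit (d # ds) i (Suc k) = digit ds i k"
  by (simp_all add: digit_def)

lemma digit_add: "k < length ds \<Longrightarrow> digit ds (x * prod_list ds + j) k = digit ds j k"
proof -
  assume k: "k < length ds"
  let ?q = "prod_list (drop (Suc k) ds)" and ?r = "ds ! k"
  have "prod_list ds = prod_list (take k ds @ ?r # drop (Suc k) ds)"
    using k by (simp add: id_take_nth_drop[symmetric])
  also have "\<dots> = prod_list (take k ds) * ?r * ?q" by simp
  finally have P: "x * prod_list ds + j = (x * prod_list (take k ds) * ?r) * ?q + j" by simp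
  show ?thesis
  proof (cases "?q = 0")
    case False
    then have "(x * prod_list ds + j) div ?q = (x * prod_list (take k ds)) * ?r + j div ?q"
      unfolding P by simp
    then show ?thesis unfolding digit_def by simp
  next
    \<comment> \<open>A zero dimension among the later digits: division by zero yields zero, so the
      two sides still agree.\<close>
    case True
    then show ?thesis unfolding digit_def by (simp only: div_by_0)
  qed
qed

lemma digit_encode: "valid ds xs \<Longrightarrow> k < length ds \<Longrightarrow> digit ds (encode ds xs) k = xs ! k"
proof (induction ds arbitrary: xs k)
  case (Cons d ds)
  then obtain y ys where y: "xs = y # ys" "y < d" "valid ds ys" by (auto simp: valid_Cons)
  show ?case
  proof (cases k)
    case 0
    then show ?thesis using y encode_less[OF y(3)] by (simp add: digit_Cons radix_div_mod)
  next
    case (Suc k')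
    then show ?thesis using y Cons by (simp add: digit_Cons digit_add)
  qed
qed simp

lemma encode_append: "length xs = length ds \<Longrightarrow>
    encode (ds @ es) (xs @ ys) = encode ds xs * prod_list es + encode es ys"
  by (induction xs ds rule: list_induct2) (simp_all add: algebra_simps)

lemma valid_append: "length xs = length ds \<Longrightarrow> valid (ds @ es) (xs @ ys) \<longleftrightarrow> valid ds xs \<and> valid es ys"
  by (induction xs ds rule: list_induct2) auto

lemma valid_replicate: "valid (replicate n d) xs \<longleftrightarrow> xs \<in> seqs n {..<d}"
proof (induction n arbitrary: xs)
  case (Suc n)
  then show ?case by (cases xs) (auto simp: seqs_def)
qed simp

lemma prod_list_replicate_nat: "prod_list (replicate n (d :: nat)) = d ^ n"
  by (induction n) auto

definition enc :: "nat \<Rightarrow> nat \<Rightarrow> nat list \<Rightarrow> nat" where "enc n d = encode (replicate n d)"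

definition dec :: "nat \<Rightarrow> nat \<Rightarrow> nat \<Rightarrow> nat list" where
  "dec n d i = map (digit (replicate n d) i) [0..<n]"

lemma dec_enc: "bs \<in> seqs n {..<d} \<Longrightarrow> dec n d (enc n d bs) = bs"
  unfolding dec_def enc_def using digit_encode[of "replicate n d" bs]
  by (auto intro!: nth_equalityI simp: valid_replicate seqs_length)

lemma enc_less: "bs \<in> seqs n {..<d} \<Longrightarrow> enc n d bs < d ^ n"
  using encode_less[of "replicate n d" bs] by (simp add: enc_def valid_replicate prod_list_replicate_nat)

lemma bij_enc: "bij_betw (enc n d) (seqs n {..<d}) {..<d ^ n}"
proof -
  have "{..<d ^ n} \<subseteq> enc n d ` seqs n {..<d}"
  proof
    fix i assume "i \<in> {..<d ^ n}"
    then obtain xs where "valid (replicate n d) xs" "encode (replicate n d) xs = i"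
      using encode_surj[of i "replicate n d"] by (auto simp: prod_list_replicate_nat)
    then show "i \<in> enc n d ` seqs n {..<d}" by (auto simp: enc_def valid_replicate)
  qed
  moreover have "inj_on (enc n d) (seqs n {..<d})" by (metis dec_enc inj_onI)
  ultimately show ?thesis by (auto simp: bij_betw_def enc_less)
qed

lemma enc_dec: "i < d ^ n \<Longrightarrow> enc n d (dec n d i) = i \<and> dec n d i \<in> seqs n {..<d}"
proof -
  assume "i < d ^ n"
  then obtain bs where "bs \<in> seqs n {..<d}" "i = enc n d bs"
    using bij_enc[of n d] by (auto simp: bij_betw_def image_iff set_eq_iff)
  then show ?thesis by (simp add: dec_enc)
qed

lemma sum_enc: "(\<Sum>i<d ^ n. f i) = (\<Sum>bs\<in>seqs n {..<d}. f (enc n d bs))"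
  by (rule sum.reindex_bij_betw[OF bij_enc, symmetric])

section \<open>Block operators as matrices\<close>

definition mat_op :: "nat \<Rightarrow> nat \<Rightarrow> nat list op \<Rightarrow> complex mat" where
  "mat_op n d L = mat (d ^ n) (d ^ n) (\<lambda>(i, j). entry L (dec n d i) (dec n d j))"

text \<open>With a hermitian square root \<open>X\<close> of \<open>L\<close>, the quadratic form at
  \<open>f\<close> is the squared norm of \<open>X\<close> applied to \<open>f\<close>.\<close>

lemma quadform_sqrt_nonneg:
  assumes I: "finite I" "supp L \<subseteq> I" and L: "0 \<le> L"
  shows "0 \<le> Re (\<Sum>i\<in>I. \<Sum>j\<in>I. cnj (f i) * entry L i j * f j)"
proof -
  obtain X where X: "star X = X" "X * X = L" "supp X \<subseteq> I" using nonneg_sqrt[OF I L] by metis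
  have hX: "entry X i k = cnj (entry X k i)" for i k by (metis X(1) entry_star)
  have "(\<Sum>i\<in>I. \<Sum>j\<in>I. cnj (f i) * entry L i j * f j) =
      (\<Sum>i\<in>I. \<Sum>j\<in>I. \<Sum>k\<in>I. cnj (f i) * entry X i k * (entry X k j * f j))"
    using X(3) by (simp add: X(2)[symmetric] entry_times[OF I(1)] sum_distrib_left sum_distrib_right mult.assoc)
  also have "\<dots> = (\<Sum>k\<in>I. \<Sum>i\<in>I. \<Sum>j\<in>I. cnj (f i) * entry X i k * (entry X k j * f j))"
    by (rule sum_rotate)
  also have "\<dots> = (\<Sum>k\<in>I. cnj (\<Sum>i\<in>I. entry X k i * f i) * (\<Sum>j\<in>I. entry X k j * f j))"
  proof (rule sum.cong[OF refl])
    fix k assume "k \<in> I"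
    have "cnj (\<Sum>i\<in>I. entry X k i * f i) = (\<Sum>i\<in>I. cnj (f i) * entry X i k)"
      by (simp add: hX[of _ k] mult.commute)
    then show "(\<Sum>i\<in>I. \<Sum>j\<in>I. cnj (f i) * entry X i k * (entry X k j * f j)) =
        cnj (\<Sum>i\<in>I. entry X k i * f i) * (\<Sum>j\<in>I. entry X k j * f j)"
      by (simp add: sum_product)
  qed
  also have "\<dots> = of_real (\<Sum>k\<in>I. (cmod (\<Sum>i\<in>I. entry X k i * f i))\<^sup>2)"
    unfolding of_real_sum by (intro sum.cong refl) (simp add: complex_norm_square mult.commute del:
        of_real_power)
  finally show ?thesis by (simp add: sum_nonneg del: of_real_sum)
qed

lemma psd_mat_op:
  assumes L: "0 \<le> L" "supp L \<subseteq> seqs n {..<d}"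
  shows "psd_mat (d ^ n) (mat_op n d L)"
proof -
  have h: "entry L i k = cnj (entry L k i)" for i k using nonneg_star[OF L(1)] by (metis entry_star)
  have c: "mat_op n d L \<in> carrier_mat (d ^ n) (d ^ n)" by (simp add: mat_op_def)
  have "hermitian_mat (d ^ n) (mat_op n d L)"
    unfolding hermitian_mat_def using c by (auto simp: mat_op_def intro: h)
  moreover have "0 \<le> Re (conjugate v \<bullet> (mat_op n d L *\<^sub>v v))" if v: "v \<in> carrier_vec (d ^ n)" for v
  proof -
    have "conjugate v \<bullet> (mat_op n d L *\<^sub>v v) =
        (\<Sum>i<d ^ n. \<Sum>j<d ^ n. cnj (v $ i) * entry L (dec n d i) (dec n d j) * v $ j)"
      using v by (auto simp: mat_op_def scalar_prod_def lessThan_atLeast0[symmetric] sum_distrib_left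
          mult.assoc intro!: sum.cong)
    also have "\<dots> = (\<Sum>bs\<in>seqs n {..<d}. \<Sum>cs\<in>seqs n {..<d}. cnj (v $ enc n d bs) * entry L bs cs
        * v $ enc n d cs)"
      unfolding sum_enc by (intro sum.cong refl) (simp add: dec_enc)
    finally show ?thesis using quadform_sqrt_nonneg[OF _ L(2,1), of "\<lambda>bs. v $ enc n d bs"] by simp
  qed
  ultimately show ?thesis by (simp add: psd_mat_def)
qed

lemma povm_mat_op:
  assumes M: "finite M" and L: "\<And>m. m \<in> M \<Longrightarrow> 0 \<le> L m" "\<And>m. m \<in> M \<Longrightarrow> supp (L m) \<subseteq> seqs n {..<d}"
    and sum: "(\<Sum>m\<in>M. L m) = unit_op (seqs n {..<d})"
  shows "povm (d ^ n) M (\<lambda>m. mat_op n d (L m))"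
proof -
  have "(\<Sum>m\<in>M. mat_op n d (L m) $$ (i, j)) = (1\<^sub>m (d ^ n)) $$ (i, j)" if ij: "i < d ^ n" "j < d ^ n" for i j
  proof -
    have "(\<Sum>m\<in>M. mat_op n d (L m) $$ (i, j)) = entry (\<Sum>m\<in>M. L m) (dec n d i) (dec n d j)"
      using ij by (simp add: mat_op_def entry_sum)
    also have "\<dots> = (if dec n d i = dec n d j then 1 else 0)"
      unfolding sum using enc_dec[OF ij(1)] enc_dec[OF ij(2)] by (simp add: unit_op_def entry_mk)
    also have "\<dots> = (if i = j then 1 else 0)" using enc_dec[OF ij(1)] enc_dec[OF ij(2)] by metis
    finally show ?thesis using ij by simp
  qed
  then show ?thesis unfolding povm_def using M psd_mat_op L by blast
qed

text \<open>The tensor product of \<open>L\<close> and \<open>G\<close>, indexed by words of pairs,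
  as products of joint letter states are. Unzipping a word takes the place of reordering tensor
  factors.\<close>

definition pairs_op :: "(nat \<times> nat) list set \<Rightarrow> nat list op \<Rightarrow> nat list op \<Rightarrow> (nat \<times> nat) list op" where
  "pairs_op Z L G = mk Z (\<lambda>zs zs'. entry L (map fst zs) (map fst zs') * entry G (map snd zs) (map snd zs'))"

lemma pair_list_eq: "map fst zs = map fst zs' \<Longrightarrow> map snd zs = map snd zs' \<Longrightarrow> zs = zs'"
  by (metis zip_map_fst_snd)

context
  fixes n d1 d2 :: nat
begin

abbreviation "Z \<equiv> seqs n ({..<d1} \<times> {..<d2})"

lemma map_fst_Z: "zs \<in> Z \<Longrightarrow> map fst zs \<in> seqs n {..<d1}" "zs \<in> Z \<Longrightarrow> map snd zs \<in> seqs n {..<d2}"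
  by (force simp: seqs_def)+

lemma sum_Z: "(\<Sum>zs\<in>Z. f (map fst zs) (map snd zs)) = (\<Sum>bs\<in>seqs n {..<d1}. \<Sum>cs\<in>seqs n {..<d2}. f bs cs)"
  for f :: "_ \<Rightarrow> _ \<Rightarrow> complex"
proof -
  have "(\<Sum>bs\<in>seqs n {..<d1}. \<Sum>cs\<in>seqs n {..<d2}. f (map fst (zip bs cs)) (map snd (zip bs cs))) =
      (\<Sum>zs\<in>Z. f (map fst zs) (map snd zs))"
    by (rule sum_seqs_zip)
  moreover have "(\<Sum>bs\<in>seqs n {..<d1}. \<Sum>cs\<in>seqs n {..<d2}. f (map fst (zip bs cs)) (map snd (zip bs cs))) =
      (\<Sum>bs\<in>seqs n {..<d1}. \<Sum>cs\<in>seqs n {..<d2}. f bs cs)"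
    by (intro sum.cong refl) (simp add: seqs_length)
  ultimately show ?thesis by simp
qed

lemma supp_pairs_op: "supp (pairs_op Z L G) \<subseteq> Z" unfolding pairs_op_def by (rule supp_mk)

text \<open>Unzipping factorises the sum over intermediate words; the support assumptions ensure
  that restricting these words to \<open>Z\<close> loses no term.\<close>

lemma pairs_op_mult:
  assumes "supp L \<subseteq> seqs n {..<d1}" "supp G \<subseteq> seqs n {..<d2}"
  shows "pairs_op Z L G * pairs_op Z L' G' = pairs_op Z (L * L') (G * G')"
proof (rule op_eqI)
  fix zs zs'
  have "entry (pairs_op Z L G * pairs_op Z L' G') zs zs' =
      (\<Sum>ws\<in>Z. entry (pairs_op Z L G) zs ws * entry (pairs_op Z L' G') ws zs')"
    by (rule entry_times) (auto simp: supp_pairs_op)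
  also have "\<dots> = (if zs \<in> Z \<and> zs' \<in> Z then (\<Sum>ws\<in>Z. (entry L (map fst zs) (map fst ws)
      * entry L' (map fst ws) (map fst zs'))
      * (entry G (map snd zs) (map snd ws) * entry G' (map snd ws) (map snd zs'))) else 0)"
    by (simp add: pairs_op_def entry_mk mult_ac)
  also have "\<dots> = entry (pairs_op Z (L * L') (G * G')) zs zs'"
    unfolding sum_Z[where f = "\<lambda>a b. (entry L (map fst zs) a * entry L' a (map fst zs'))
        * (entry G (map snd zs) b * entry G' b (map snd zs'))"]
    using assms by (simp add: pairs_op_def entry_mk entry_times[where S = "seqs n {..<d1}"]
        entry_times[where S = "seqs n {..<d2}"] sum_product)
  finally show "entry (pairs_op Z L G * pairs_op Z L' G') zs zs' = entry (pairs_op Z (L * L') (G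
      * G')) zs zs'" .
qed

lemma pairs_op_nonneg:
  assumes "0 \<le> L" "supp L \<subseteq> seqs n {..<d1}" "0 \<le> G" "supp G \<subseteq> seqs n {..<d2}"
  shows "0 \<le> pairs_op Z L G"
proof -
  obtain X where X: "star X = X" "X * X = L" "supp X \<subseteq> seqs n {..<d1}"
    using nonneg_sqrt[OF _ assms(2,1)] by (metis finite_lessThan finite_seqs)
  obtain Y where Y: "star Y = Y" "Y * Y = G" "supp Y \<subseteq> seqs n {..<d2}"
    using nonneg_sqrt[OF _ assms(4,3)] by (metis finite_lessThan finite_seqs)
  have hX: "cnj (entry X a b) = entry X b a" for a b by (metis X(1) entry_star)
  have hY: "cnj (entry Y a b) = entry Y b a" for a b by (metis Y(1) entry_star)
  have "star (pairs_op Z X Y) = pairs_op Z X Y"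
    by (rule op_eqI) (auto simp: pairs_op_def entry_mk hX hY)
  then show ?thesis
    using self_nonneg[of "pairs_op Z X Y"] pairs_op_mult[OF X(3) Y(3), of X Y] X Y by simp
qed

lemma pairs_op_diff: "pairs_op Z (L - L') G = pairs_op Z L G - pairs_op Z L' G"
  "pairs_op Z L (G - G') = pairs_op Z L G - pairs_op Z L G'"
  by (rule op_eqI, simp add: pairs_op_def entry_mk algebra_simps)+

lemma pairs_op_unit: "pairs_op Z (unit_op (seqs n {..<d1})) (unit_op (seqs n {..<d2})) = unit_op Z"
  by (rule op_eqI) (auto simp: pairs_op_def unit_op_def entry_mk map_fst_Z dest: pair_list_eq)

text \<open>The difference of the two sides is the trace against \<open>(1 - L) \<otimes> (1 - G) \<ge> 0\<close>.\<close>

lemma pairs_op_union_bound: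
  assumes "0 \<le> L" "L \<le> unit_op (seqs n {..<d1})" "supp L \<subseteq> seqs n {..<d1}"
    and "0 \<le> G" "G \<le> unit_op (seqs n {..<d2})" "supp G \<subseteq> seqs n {..<d2}" and T: "0 \<le> T"
  shows "rtr ((unit_op Z - pairs_op Z L G) * T) \<le>
    rtr (pairs_op Z (unit_op (seqs n {..<d1}) - L) (unit_op (seqs n {..<d2})) * T) +
    rtr (pairs_op Z (unit_op (seqs n {..<d1})) (unit_op (seqs n {..<d2}) - G) * T)"
proof -
  let ?E1 = "unit_op (seqs n {..<d1})" and ?E2 = "unit_op (seqs n {..<d2})"
  have "0 \<le> pairs_op Z (?E1 - L) (?E2 - G)"
  proof (rule pairs_op_nonneg)
    show "supp (?E1 - L) \<subseteq> seqs n {..<d1}" "supp (?E2 - G) \<subseteq> seqs n {..<d2}"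
      using assms(3,6) by (auto simp: supp_subset_iff algebra_simps)
  qed (use assms in auto)
  then have "0 \<le> rtr (pairs_op Z (?E1 - L) (?E2 - G) * T)" using T by (rule rtr_mult_nonneg)
  then show ?thesis
    by (simp add: pairs_op_diff left_diff_distrib pairs_op_unit)
qed

end

section \<open>The joint output state of a block\<close>

definition \<sigma>12 :: "nat \<Rightarrow> nat \<Rightarrow> complex mat \<Rightarrow> (nat \<times> nat) op" where
  "\<sigma>12 d1 d2 M = mk ({..<d1} \<times> {..<d2}) (\<lambda>z z'. M $$ (fst z * d2 + snd z, fst z' * d2 + snd z'))"

lemma \<sigma>12_nonneg:
  assumes M: "density_op (d1 * d2) M" shows "0 \<le> \<sigma>12 d1 d2 M"
proof (rule nonneg_quadform)
  show "supp (\<sigma>12 d1 d2 M) \<subseteq> {..<d1} \<times> {..<d2}" unfolding \<sigma>12_def by (rule supp_mk)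
  show "star (\<sigma>12 d1 d2 M) = \<sigma>12 d1 d2 M"
    by (rule op_eqI) (auto simp: \<sigma>12_def entry_mk density_op_herm[OF M] radix_less)
  fix v :: "nat \<times> nat \<Rightarrow> complex"
  let ?f = "\<lambda>i. v (i div d2, i mod d2)"
  have "(\<Sum>z\<in>{..<d1} \<times> {..<d2}. \<Sum>z'\<in>{..<d1} \<times> {..<d2}. cnj (v z) * entry (\<sigma>12 d1 d2 M) z z' * v z') =
      (\<Sum>i<d1 * d2. \<Sum>j<d1 * d2. cnj (?f i) * M $$ (i, j) * ?f j)"
    unfolding sum_mult_radix sum.cartesian_product'
    by (intro sum.cong refl) (auto simp: \<sigma>12_def entry_mk radix_div_mod)
  then show "0 \<le> Re (\<Sum>z\<in>{..<d1} \<times> {..<d2}. \<Sum>z'\<in>{..<d1} \<times> {..<d2}. cnj (v z) * entry (\<sigma>12 d1 d2 M) z z' * v z')"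
    using psd_mat_quadform[of "d1 * d2" M ?f] M by (simp only: density_op_def)
qed simp

text \<open>The digit order B1 B2 B1 B2 ... of the block before \<open>out_state\<close> collects
  the factors of each receiver.\<close>

definition inter :: "(nat \<times> nat) list \<Rightarrow> nat list" where
  "inter zs = concat (map (\<lambda>z. [fst z, snd z]) zs)"

lemma inter_simps [simp]: "inter [] = []" "inter (z # zs) = fst z # snd z # inter zs"
  by (simp_all add: inter_def)

lemma length_inter: "length (inter zs) = 2 * length zs" by (induction zs) auto

lemma nth_inter: "t < length zs \<Longrightarrow> inter zs ! (2 * t) = fst (zs ! t) \<and> inter zs ! (2 * t + 1) = snd (zs ! t)"
proof (induction zs arbitrary: t)
  case (Cons z zs)
  then show ?case by (cases t) auto
qed simp

lemma inter_replicate: "concat (replicate n [d1, d2]) = inter (replicate n (d1, d2))"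
  by (induction n) auto

lemma prod_list_inter_replicate: "prod_list (inter (replicate n (d1, d2))) = (d1 * d2) ^ n"
  by (induction n) auto

lemma enc_simps: "enc 0 d xs = 0" "length xs = n \<Longrightarrow> enc (Suc n) d (x # xs) = x * d ^ n + enc n d xs"
  by (simp_all add: enc_def prod_list_replicate_nat)

lemma encode_inter: "length zs = n \<Longrightarrow>
    encode (inter (replicate n (d1, d2))) (inter zs) = enc n (d1 * d2) (map (\<lambda>z. fst z * d2 + snd z) zs)"
proof (induction zs arbitrary: n)
  case (Cons z zs)
  then obtain m where m: "n = Suc m" "length zs = m" by auto
  show ?case using Cons.IH[OF m(2)] m
    by (simp add: prod_list_inter_replicate enc_simps algebra_simps)
qed (simp add: enc_simps)

lemma valid_inter: "zs \<in> Z n d1 d2 \<Longrightarrow> valid (inter (replicate n (d1, d2))) (inter zs)"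
proof (induction n arbitrary: zs)
  case (Suc n)
  then show ?case by (cases zs) (auto simp: seqs_def)
qed simp

lemma kron_index:
  assumes "A \<in> carrier_mat m m" "B \<in> carrier_mat k k" "i < m" "j < m" "i' < k" "j' < k"
  shows "kron A B $$ (i * k + i', j * k + j') = A $$ (i, j) * B $$ (i', j')"
  using assms radix_less[of i m i' k] radix_less[of j m j' k] by (simp add: kron_def radix_div_mod)

lemma pair_index_seqs: "zs \<in> Z n d1 d2 \<Longrightarrow> map (\<lambda>z. fst z * d2 + snd z) zs \<in> seqs n {..<d1 * d2}"
  by (auto simp: seqs_def radix_less subset_iff)

lemma kron_list_entry:
  assumes "\<And>x. x \<in> set xs \<Longrightarrow> \<rho> x \<in> carrier_mat (d1 * d2) (d1 * d2)" "length xs = n"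
  shows "kron_list (map \<rho> xs) \<in> carrier_mat ((d1 * d2) ^ n) ((d1 * d2) ^ n) \<and>
    (\<forall>zs\<in>Z n d1 d2. \<forall>zs'\<in>Z n d1 d2.
      kron_list (map \<rho> xs) $$ (enc n (d1 * d2) (map (\<lambda>z. fst z * d2 + snd z) zs), enc n (d1
          * d2) (map (\<lambda>z. fst z * d2 + snd z) zs'))
        = entry (tensor (map (\<lambda>x. \<sigma>12 d1 d2 (\<rho> x)) xs)) zs zs')"
  using assms
proof (induction xs arbitrary: n)
  case Nil
  then show ?case by (simp add: kron_list_def unit_op_def entry_mk enc_simps)
next
  case (Cons x xs)
  then obtain m where m: "n = Suc m" "length xs = m" by auto
  let ?D = "d1 * d2" and ?g = "\<lambda>z. fst z * d2 + snd z"
  have IH: "kron_list (map \<rho> xs) \<in> carrier_mat (?D ^ m) (?D ^ m)"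
    "\<And>zs zs'. zs \<in> Z m d1 d2 \<Longrightarrow> zs' \<in> Z m d1 d2 \<Longrightarrow>
      kron_list (map \<rho> xs) $$ (enc m ?D (map ?g zs), enc m ?D (map ?g zs')) = entry (tensor (map (\<lambda>x. \<sigma>12 d1
          d2 (\<rho> x)) xs)) zs zs'"
    using Cons.IH[OF Cons.prems(1) m(2)] by auto
  have \<rho>x: "\<rho> x \<in> carrier_mat ?D ?D" using Cons.prems by simp
  have k: "kron_list (map \<rho> (x # xs)) = kron (\<rho> x) (kron_list (map \<rho> xs))" by (simp add: kron_list_def)
  have "kron (\<rho> x) (kron_list (map \<rho> xs)) \<in> carrier_mat (?D ^ n) (?D ^ n)"
    using \<rho>x IH(1) by (auto simp: kron_def m)
  moreover have "kron (\<rho> x) (kron_list (map \<rho> xs)) $$ (enc n ?D (map ?g zs), enc n ?D (map ?g zs'))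
      = entry (tensor (map (\<lambda>x. \<sigma>12 d1 d2 (\<rho> x)) (x # xs))) zs zs'"
    if zs: "zs \<in> Z n d1 d2" "zs' \<in> Z n d1 d2" for zs zs'
  proof -
    obtain z ws z' ws' where w: "zs = z # ws" "zs' = z' # ws'"
      using zs m by (cases zs; cases zs') (auto simp: seqs_def)
    have z: "z \<in> {..<d1} \<times> {..<d2}" "z' \<in> {..<d1} \<times> {..<d2}" "ws \<in> Z m d1 d2" "ws' \<in> Z m d1 d2"
      using zs unfolding w m by auto
    have len: "length ws = m" "length ws' = m" using z by (auto simp: seqs_length)
    have "kron (\<rho> x) (kron_list (map \<rho> xs)) $$ (?g z * ?D ^ m + enc m ?D (map ?g ws), ?g z' * ?D ^ m
        + enc m ?D (map ?g ws'))
       = \<rho> x $$ (?g z, ?g z') * kron_list (map \<rho> xs) $$ (enc m ?D (map ?g ws), enc m ?D (map ?g ws'))"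
      by (rule kron_index[OF \<rho>x IH(1)]) (use z in \<open>auto intro!: radix_less enc_less pair_index_seqs\<close>)
    also have "\<dots> = entry (tensor (map (\<lambda>x. \<sigma>12 d1 d2 (\<rho> x)) (x # xs))) zs zs'"
      using z by (simp add: IH(2) w entry_cons_op \<sigma>12_def entry_mk)
    finally show ?thesis by (simp add: w m enc_simps len)
  qed
  ultimately show ?case unfolding k by blast
qed

text \<open>The marginal in \<open>out_state\<close> keeps all factors and only permutes them, so
  its double sum collapses to one entry of the Kronecker product, at the interleaved digits.\<close>

lemma out_state_entry:
  assumes \<rho>: "\<And>x. x \<in> set xs \<Longrightarrow> \<rho> x \<in> carrier_mat (d1 * d2) (d1 * d2)" and len: "length xs = n"
  shows "zs \<in> Z n d1 d2 \<Longrightarrow> zs' \<in> Z n d1 d2 \<Longrightarrow> out_state d1 d2 \<rho> n (\<lambda>i. xs ! i) $$ (enc n d1 (map fst zs)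
      * d2 ^ n + enc n d2 (map snd zs),
      enc n d1 (map fst zs') * d2 ^ n + enc n d2 (map snd zs')) =
    entry (tensor (map (\<lambda>x. \<sigma>12 d1 d2 (\<rho> x)) xs)) zs zs'"
    and "out_state d1 d2 \<rho> n (\<lambda>i. xs ! i) \<in> carrier_mat (d1 ^ n * d2 ^ n) (d1 ^ n * d2 ^ n)"
proof -
  define ds where "ds = inter (replicate n (d1, d2))"
  define ks where "ks = map (\<lambda>k. 2 * k) [0..<n] @ map (\<lambda>k. 2 * k + 1) [0..<n]"
  define es where "es = replicate n d1 @ replicate n d2"
  define K where "K = kron_list (map \<rho> xs)"
  have mp: "map (\<lambda>i. \<rho> (xs ! i)) [0..<n] = map \<rho> xs"
    using len by (auto intro!: nth_equalityI)
  have ds2: "ds ! (2 * t) = d1" "ds ! (2 * t + 1) = d2" if "t < n" for t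
    using nth_inter[of t "replicate n (d1, d2)"] that by (auto simp: ds_def)
  have es_eq: "map (\<lambda>k. ds ! k) ks = es"
  proof -
    have "map (\<lambda>k. ds ! k) ks = map (\<lambda>k. ds ! (2 * k)) [0..<n] @ map (\<lambda>k. ds ! (2 * k + 1)) [0..<n]"
      by (simp add: ks_def)
    also have "map (\<lambda>k. ds ! (2 * k)) [0..<n] = replicate n d1" using ds2(1) by (auto intro!: nth_equalityI)
    also have "map (\<lambda>k. ds ! (2 * k + 1)) [0..<n] = replicate n d2" using ds2(2) by (intro nth_equalityI) auto
    finally show ?thesis by (simp add: es_def)
  qed
  have lds: "length ds = 2 * n" by (simp add: ds_def length_inter)
  have lks: "length ks = 2 * n" by (simp add: ks_def)
  have ks_nth: "ks ! t = 2 * t" "ks ! (n + t) = 2 * t + 1" if "t < n" for t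
    using that by (simp_all add: ks_def nth_append)
  have set_ks: "k \<in> set ks" if "k < length ds" for k
  proof -
    have "k div 2 < n" using that lds by simp
    moreover have "k = 2 * (k div 2) \<or> k = 2 * (k div 2) + 1" by presburger
    ultimately have "k \<in> (\<lambda>k. 2 * k) ` {0..<n} \<union> (\<lambda>k. 2 * k + 1) ` {0..<n}"
      by (metis UnI1 UnI2 atLeastLessThan_iff image_eqI le0)
    then show ?thesis by (auto simp: ks_def)
  qed
  have Pds: "prod_list ds = (d1 * d2) ^ n" by (simp add: ds_def prod_list_inter_replicate)
  have Pes: "prod_list es = d1 ^ n * d2 ^ n" by (simp add: es_def prod_list_replicate_nat)
  have out: "out_state d1 d2 \<rho> n (\<lambda>i. xs ! i) = mat (d1 ^ n * d2 ^ n) (d1 ^ n * d2 ^ n) (\<lambda>(a, b).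
      \<Sum>i<(d1 * d2) ^ n. \<Sum>j<(d1 * d2) ^ n.
        if (\<forall>t<length ks. digit ds i (ks ! t) = digit es a t \<and> digit ds j (ks ! t) = digit es b t)
          \<and> (\<forall>k<length ds. k \<notin> set ks \<longrightarrow> digit ds i k = digit ds j k) then K $$ (i, j) else 0)"
    unfolding out_state_def marginal_def Let_def inter_replicate mp
    unfolding ds_def[symmetric] ks_def[symmetric] es_eq Pds Pes K_def ..
  then show "out_state d1 d2 \<rho> n (\<lambda>i. xs ! i) \<in> carrier_mat (d1 ^ n * d2 ^ n) (d1 ^ n * d2 ^ n)" by simp
  define ia where "ia zs = enc n d1 (map fst zs) * d2 ^ n + enc n d2 (map snd zs)" for zs
  define ii where "ii zs = encode ds (inter zs)" for zs
  have ia: "ia ws = encode es (map fst ws @ map snd ws)" "ia ws < d1 ^ n * d2 ^ n"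
    "valid es (map fst ws @ map snd ws)" if "ws \<in> Z n d1 d2" for ws
  proof -
    have l: "length (map fst ws) = length (replicate n d1)" using that by (simp add: seqs_length)
    show "ia ws = encode es (map fst ws @ map snd ws)"
      unfolding ia_def es_def encode_append[OF l] by (simp add: enc_def prod_list_replicate_nat)
    show "valid es (map fst ws @ map snd ws)"
      unfolding es_def valid_append[OF l] using map_fst_Z[OF that] by (simp add: valid_replicate)
    show "ia ws < d1 ^ n * d2 ^ n"
      unfolding ia_def using map_fst_Z[OF that] by (intro radix_less enc_less)
  qed
  \<comment> \<open>Every digit of \<open>i\<close> is prescribed by one of the conditions, so they
    single out the interleaved index \<open>ii ws\<close>.\<close>
  have cond: "(\<forall>t<length ks. digit ds i (ks ! t) = digit es (ia ws) t) \<longleftrightarrow> i = ii ws"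
    if ws: "ws \<in> Z n d1 d2" and i: "i < (d1 * d2) ^ n" for i ws
  proof -
    have lw: "length ws = n" using ws by (simp add: seqs_length)
    have les: "length es = 2 * n" by (simp add: es_def)
    have de: "digit es (ia ws) t = fst (ws ! t)" "digit es (ia ws) (n + t) = snd (ws ! t)" if "t < n" for t
      unfolding ia(1)[OF ws] using digit_encode[OF ia(3)[OF ws], of t] digit_encode[OF ia(3)[OF ws], of "n
          + t"] that lw les
      by (simp_all add: nth_append)
    obtain us where us: "valid ds us" "encode ds us = i" using encode_surj[of i ds] i Pds by auto
    have lu: "length us = 2 * n" using valid_length[OF us(1)] lds by simp
    have du: "digit ds i k = us ! k" if "k < 2 * n" for k
      using digit_encode[OF us(1), of k] us(2) that lds by simp
    show ?thesis
    proof
      assume C: "\<forall>t<length ks. digit ds i (ks ! t) = digit es (ia ws) t"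
      have a: "us ! (2 * t) = fst (ws ! t)" if "t < n" for t
        using C[rule_format, of t] that lks ks_nth de du[of "2 * t"] by simp
      have b: "us ! (2 * t + 1) = snd (ws ! t)" if "t < n" for t
        using C[rule_format, of "n + t"] that lks ks_nth de du[of "2 * t + 1"] by simp
      have "us = inter ws"
      proof (rule nth_equalityI)
        show "length us = length (inter ws)" using lu lw by (simp add: length_inter)
        fix k assume "k < length us"
        then have k2: "k div 2 < n" using lu by simp
        have "k = 2 * (k div 2) \<or> k = 2 * (k div 2) + 1" by presburger
        then show "us ! k = inter ws ! k"
          using a[OF k2] b[OF k2] nth_inter[of "k div 2" ws] k2 lw by metis
      qed
      then show "i = ii ws" using us by (simp add: ii_def)
    next
      assume "i = ii ws"
      then have dg: "digit ds i k = inter ws ! k" if "k < 2 * n" for k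
        using digit_encode[OF valid_inter[OF ws, folded ds_def], of k] that lds by (simp add: ii_def)
      show "\<forall>t<length ks. digit ds i (ks ! t) = digit es (ia ws) t"
      proof (intro allI impI)
        fix t assume t: "t < length ks"
        show "digit ds i (ks ! t) = digit es (ia ws) t"
        proof (cases "t < n")
          case True
          then show ?thesis using ks_nth(1)[OF True] de(1)[OF True] dg[of "2 * t"] nth_inter[of t ws] lw by simp
        next
          case False
          then obtain s where s: "t = n + s" "s < n" using t lks
              by (metis add_less_cancel_left le_add_diff_inverse mult_2 not_less)
          then show ?thesis using ks_nth(2)[OF s(2)] de(2)[OF s(2)] dg[of "2 * s + 1"] nth_inter[of s ws] lw
              by simp
        qed
      qed
    qed
  qed
  have ii_less: "ii ws < (d1 * d2) ^ n" if "ws \<in> Z n d1 d2" for ws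
    using encode_less[OF valid_inter[OF that, folded ds_def]] Pds by (simp add: ii_def)
  show "out_state d1 d2 \<rho> n (\<lambda>i. xs ! i) $$ (enc n d1 (map fst zs) * d2 ^ n + enc n d2 (map snd zs),
      enc n d1 (map fst zs') * d2 ^ n + enc n d2 (map snd zs')) =
    entry (tensor (map (\<lambda>x. \<sigma>12 d1 d2 (\<rho> x)) xs)) zs zs'"
    if zs: "zs \<in> Z n d1 d2" "zs' \<in> Z n d1 d2"
  proof -
    have "out_state d1 d2 \<rho> n (\<lambda>i. xs ! i) $$ (ia zs, ia zs') =
        (\<Sum>i<(d1 * d2) ^ n. \<Sum>j<(d1 * d2) ^ n.
          if (\<forall>t<length ks. digit ds i (ks ! t) = digit es (ia zs) t \<and> digit ds j (ks ! t)
              = digit es (ia zs') t)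
            \<and> (\<forall>k<length ds. k \<notin> set ks \<longrightarrow> digit ds i k = digit ds j k) then K $$ (i, j) else 0)"
      unfolding out using ia(2) zs by simp
    also have "\<dots> = (\<Sum>i<(d1 * d2) ^ n. \<Sum>j<(d1 * d2) ^ n. if i = ii zs then if j = ii zs' then K $$
        (i, j) else 0 else 0)"
    proof (rule sum.cong[OF refl], rule sum.cong[OF refl])
      fix i j assume "i \<in> {..<(d1 * d2) ^ n}" "j \<in> {..<(d1 * d2) ^ n}"
      then have "((\<forall>t<length ks. digit ds i (ks ! t) = digit es (ia zs) t \<and> digit ds j (ks ! t)
          = digit es (ia zs') t)
            \<and> (\<forall>k<length ds. k \<notin> set ks \<longrightarrow> digit ds i k = digit ds j k)) \<longleftrightarrow> i = ii zs \<and> j = ii zs'"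
        using cond[OF zs(1), of i] cond[OF zs(2), of j] set_ks by auto
      then show "(if (\<forall>t<length ks. digit ds i (ks ! t) = digit es (ia zs) t \<and> digit ds j (ks ! t)
          = digit es (ia zs') t)
            \<and> (\<forall>k<length ds. k \<notin> set ks \<longrightarrow> digit ds i k = digit ds j k) then K $$ (i, j) else 0) =
          (if i = ii zs then if j = ii zs' then K $$ (i, j) else 0 else 0)" by simp
    qed
    also have "\<dots> = K $$ (ii zs, ii zs')" using ii_less zs by (simp add: sum_if_out)
    also have "\<dots> = entry (tensor (map (\<lambda>x. \<sigma>12 d1 d2 (\<rho> x)) xs)) zs zs'"
      using kron_list_entry[where \<rho> = \<rho>, OF \<rho> len] zs
      by (simp add: K_def ii_def ds_def encode_inter[OF seqs_length[OF zs(1)]] encode_inter[OF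
          seqs_length[OF zs(2)]])
    finally show ?thesis unfolding ia_def .
  qed
qed

lemma supp_tensor:
  assumes "\<And>x. supp (F x) \<subseteq> I" shows "supp (tensor (map F xs)) \<subseteq> seqs (length xs) I"
proof (induction xs)
  case (Cons x xs)
  then show ?case using supp_cons_op[of "F x" "tensor (map F xs)"] assms[of x] by (force simp: seqs_Suc)
qed (simp add: supp_unit)

lemma supp_\<sigma>12: "supp (\<sigma>12 d1 d2 M) \<subseteq> {..<d1} \<times> {..<d2}"
  unfolding \<sigma>12_def by (rule supp_mk)

lemma supp_diff: "supp (A - B) \<subseteq> supp A \<union> supp B"
  by (auto simp: supp_def)

lemma sum_pairs: "(\<Sum>i<d1 ^ n * d2 ^ n. f i) =
    (\<Sum>zs\<in>Z n d1 d2. f (enc n d1 (map fst zs) * d2 ^ n + enc n d2 (map snd zs)))" for f :: "nat \<Rightarrow> complex"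
  unfolding sum_mult_radix sum_enc sum_Z[where f = "\<lambda>bs cs. f (enc n d1 bs * d2 ^ n + enc n d2 cs)"] ..

text \<open>The error in the definition of a code, read in the operator algebra: words of pairs
  index rows and columns bijectively, so both traces are the same sum.\<close>

lemma mtrace_code_error:
  assumes \<rho>: "\<And>x. x \<in> set xs \<Longrightarrow> \<rho> x \<in> carrier_mat (d1 * d2) (d1 * d2)" and len: "length xs = n"
  shows "mtrace ((1\<^sub>m (d1 ^ n * d2 ^ n) - kron (mat_op n d1 L) (mat_op n d2 G)) * out_state d1 d2 \<rho> n
      (\<lambda>i. xs ! i)) =
    tr ((unit_op (Z n d1 d2) - pairs_op (Z n d1 d2) L G) * tensor (map (\<lambda>x. \<sigma>12 d1 d2 (\<rho> x)) xs))"
proof -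
  let ?N = "d1 ^ n * d2 ^ n" and ?Z = "Z n d1 d2" and ?O = "out_state d1 d2 \<rho> n (\<lambda>i. xs ! i)"
  let ?T = "tensor (map (\<lambda>x. \<sigma>12 d1 d2 (\<rho> x)) xs)"
  let ?ia = "\<lambda>zs. enc n d1 (map fst zs) * d2 ^ n + enc n d2 (map snd zs)"
  have O1: "?O $$ (?ia zs, ?ia zs') = entry ?T zs zs'" if "zs \<in> ?Z" "zs' \<in> ?Z" for zs zs'
    by (rule out_state_entry(1)[OF _ len that]) (rule \<rho>)
  have O2: "?O \<in> carrier_mat ?N ?N"
    by (rule out_state_entry(2)[OF _ len]) (rule \<rho>)
  define A where "A = 1\<^sub>m ?N - kron (mat_op n d1 L) (mat_op n d2 G)"
  have m: "mat_op n d1 L \<in> carrier_mat (d1 ^ n) (d1 ^ n)" "mat_op n d2 G \<in> carrier_mat (d2 ^ n) (d2 ^ n)"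
    by (simp_all add: mat_op_def)
  have A: "A \<in> carrier_mat ?N ?N" using m by (auto simp: A_def kron_def)
  have kc: "dim_row (kron (mat_op n d1 L) (mat_op n d2 G)) = ?N" "dim_col (kron (mat_op n d1 L) (mat_op n d2
      G)) = ?N"
    using m by (auto simp: kron_def)
  have AO: "mtrace (A * B) = (\<Sum>i<?N. \<Sum>j<?N. A $$ (i, j) * B $$ (j, i))" if "B \<in> carrier_mat ?N ?N" for B
    using A that by (auto simp: mtrace_def scalar_prod_def lessThan_atLeast0[symmetric] intro!: sum.cong)
  have lt: "?ia zs < ?N" "enc n d1 (map fst zs) < d1 ^ n" "enc n d2 (map snd zs) < d2 ^ n" if "zs \<in> ?Z" for zs
    using map_fst_Z[OF that] by (auto intro!: radix_less enc_less)
  have Ae: "A $$ (?ia zs, ?ia zs') = entry (unit_op ?Z - pairs_op ?Z L G) zs zs'" if z: "zs \<in> ?Z" "zs' \<in> ?Z"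
      for zs zs'
  proof -
    note f = map_fst_Z[OF z(1)] map_fst_Z[OF z(2)]
    have "?ia zs = ?ia zs' \<longleftrightarrow> zs = zs'"
    proof
      assume e: "?ia zs = ?ia zs'"
      have "enc n d1 (map fst zs) = enc n d1 (map fst zs')" "enc n d2 (map snd zs) = enc n d2 (map snd zs')"
        using arg_cong[OF e, of "\<lambda>i. i div d2 ^ n"] arg_cong[OF e, of "\<lambda>i. i mod d2 ^ n"] lt[OF z(1)] lt[OF
            z(2)]
        by (simp_all only: radix_div_mod)
      then show "zs = zs'" using f by (metis dec_enc pair_list_eq)
    qed simp
    then show ?thesis
      unfolding A_def using z lt[OF z(1)] lt[OF z(2)] kc
      by (simp add: kron_index[OF m] unit_op_def pairs_op_def entry_mk) (simp add: mat_op_def dec_enc f lt)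
  qed
  have "mtrace (A * ?O) = (\<Sum>zs\<in>?Z. \<Sum>zs'\<in>?Z. A $$ (?ia zs, ?ia zs') * ?O $$ (?ia zs', ?ia zs))"
    unfolding AO[OF O2] sum_pairs ..
  also have "\<dots> = (\<Sum>zs\<in>?Z. \<Sum>zs'\<in>?Z. entry (unit_op ?Z - pairs_op ?Z L G) zs zs' * entry ?T zs' zs)"
    by (rule sum.cong[OF refl], rule sum.cong[OF refl]) (simp only: Ae O1)
  also have "\<dots> = tr ((unit_op ?Z - pairs_op ?Z L G) * ?T)"
  proof (rule tr_times[symmetric])
    have "supp (unit_op ?Z - pairs_op ?Z L G) \<subseteq> ?Z"
      using supp_unit[of ?Z] supp_pairs_op[of n d1 d2 L G] supp_diff[of "unit_op ?Z" "pairs_op ?Z L G"] by blast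
    moreover have "supp ?T \<subseteq> ?Z" using supp_tensor[of "\<lambda>x. \<sigma>12 d1 d2 (\<rho> x)" "{..<d1} \<times> {..<d2}" xs, OF
        supp_\<sigma>12] len by simp
    ultimately show "supp (unit_op ?Z - pairs_op ?Z L G) \<union> supp ?T \<subseteq> ?Z" by blast
  qed simp
  finally show ?thesis unfolding A_def .
qed

lemma tensor_partial_trace1:
  "length xs = n \<Longrightarrow> bs \<in> seqs n {..<d1} \<Longrightarrow> bs' \<in> seqs n {..<d1} \<Longrightarrow>
      (\<Sum>cs\<in>seqs n {..<d2}. entry (tensor (map (\<lambda>x. \<sigma>12 d1 d2 (\<rho> x)) xs)) (zip bs cs) (zip bs' cs)) =
      entry (tensor (map (\<lambda>x. rdm1 d1 d2 (\<rho> x)) xs)) bs bs'"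
proof (induction xs arbitrary: n bs bs')
  case (Cons x xs)
  then obtain m b as b' as' where m: "n = Suc m" "length xs = m" "bs = b # as" "bs' = b' # as'"
    by (cases bs; cases bs') (auto simp: seqs_def)
  then have s: "b < d1" "b' < d1" "as \<in> seqs m {..<d1}" "as' \<in> seqs m {..<d1}" using Cons.prems by auto
  show ?case unfolding m(1,3,4) sum_seqs_Suc using s Cons.IH[OF m(2) s(3,4)]
    by (simp add: entry_cons_op \<sigma>12_def rdm1_def entry_mk sum_distrib_right flip: sum_distrib_left)
qed (simp add: unit_op_def entry_mk)

lemma tensor_partial_trace2:
  "length xs = n \<Longrightarrow> bs \<in> seqs n {..<d2} \<Longrightarrow> bs' \<in> seqs n {..<d2} \<Longrightarrow>
      (\<Sum>cs\<in>seqs n {..<d1}. entry (tensor (map (\<lambda>x. \<sigma>12 d1 d2 (\<rho> x)) xs)) (zip cs bs) (zip cs bs')) =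
      entry (tensor (map (\<lambda>x. rdm2 d1 d2 (\<rho> x)) xs)) bs bs'"
proof (induction xs arbitrary: n bs bs')
  case (Cons x xs)
  then obtain m b as b' as' where m: "n = Suc m" "length xs = m" "bs = b # as" "bs' = b' # as'"
    by (cases bs; cases bs') (auto simp: seqs_def)
  then have s: "b < d2" "b' < d2" "as \<in> seqs m {..<d2}" "as' \<in> seqs m {..<d2}" using Cons.prems by auto
  show ?case unfolding m(1,3,4) sum_seqs_Suc using s Cons.IH[OF m(2) s(3,4)]
    by (simp add: entry_cons_op \<sigma>12_def rdm2_def entry_mk sum_distrib_right flip: sum_distrib_left)
qed (simp add: unit_op_def entry_mk)

text \<open>A local observable sees only the reduced state. The unit on the other side forces equal
  words there, and summing over them is the letterwise partial trace.\<close>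

lemma tr_pairs_op_unit:
  assumes len: "length xs = n"
  shows "supp L \<subseteq> seqs n {..<d1} \<Longrightarrow>
      tr (pairs_op (Z n d1 d2) L (unit_op (seqs n {..<d2})) * tensor (map (\<lambda>x. \<sigma>12 d1 d2 (\<rho> x)) xs)) =
      tr (L * tensor (map (\<lambda>x. rdm1 d1 d2 (\<rho> x)) xs))"
    and "supp G \<subseteq> seqs n {..<d2} \<Longrightarrow>
      tr (pairs_op (Z n d1 d2) (unit_op (seqs n {..<d1})) G * tensor (map (\<lambda>x. \<sigma>12 d1 d2 (\<rho> x)) xs)) =
      tr (G * tensor (map (\<lambda>x. rdm2 d1 d2 (\<rho> x)) xs))"
proof -
  let ?Z = "Z n d1 d2" and ?T = "tensor (map (\<lambda>x. \<sigma>12 d1 d2 (\<rho> x)) xs)"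
  let ?S1 = "seqs n {..<d1}" and ?S2 = "seqs n {..<d2}"
  have sT: "supp ?T \<subseteq> ?Z" using supp_tensor[of "\<lambda>x. \<sigma>12 d1 d2 (\<rho> x)" "{..<d1} \<times> {..<d2}" xs, OF supp_\<sigma>12]
      len by simp
  have gen: "tr (pairs_op ?Z L G * ?T) = (\<Sum>bs\<in>?S1. \<Sum>cs\<in>?S2. \<Sum>bs'\<in>?S1. \<Sum>cs'\<in>?S2.
      entry L bs bs' * entry G cs cs' * entry ?T (zip bs' cs') (zip bs cs))" for L G
  proof -
    have "tr (pairs_op ?Z L G * ?T) = (\<Sum>zs\<in>?Z. \<Sum>zs'\<in>?Z. entry (pairs_op ?Z L G) zs zs' * entry ?T zs' zs)"
      by (rule tr_times) (use sT supp_pairs_op in auto)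
    also have "\<dots> = (\<Sum>zs\<in>?Z. \<Sum>zs'\<in>?Z. entry L (map fst zs) (map fst zs') * entry G (map snd zs) (map snd zs')
        * entry ?T (zip (map fst zs') (map snd zs')) (zip (map fst zs) (map snd zs)))"
      by (rule sum.cong[OF refl], rule sum.cong[OF refl]) (simp add: pairs_op_def entry_mk zip_map_fst_snd)
    also have "\<dots> = (\<Sum>zs\<in>?Z. \<Sum>bs'\<in>?S1. \<Sum>cs'\<in>?S2. entry L (map fst zs) bs' * entry G (map snd zs) cs'
        * entry ?T (zip bs' cs') (zip (map fst zs) (map snd zs)))"
      by (rule sum.cong[OF refl], rule sum_Z)
    also have "\<dots> = (\<Sum>bs\<in>?S1. \<Sum>cs\<in>?S2. \<Sum>bs'\<in>?S1. \<Sum>cs'\<in>?S2.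
      entry L bs bs' * entry G cs cs' * entry ?T (zip bs' cs') (zip bs cs))"
      by (rule sum_Z)
    finally show ?thesis .
  qed
  have s1: "supp (tensor (map (\<lambda>x. rdm1 d1 d2 (\<rho> x)) xs)) \<subseteq> ?S1"
    using supp_tensor[of "\<lambda>x. rdm1 d1 d2 (\<rho> x)" "{..<d1}" xs] len by (simp add: rdm1_def supp_mk)
  have s2: "supp (tensor (map (\<lambda>x. rdm2 d1 d2 (\<rho> x)) xs)) \<subseteq> ?S2"
    using supp_tensor[of "\<lambda>x. rdm2 d1 d2 (\<rho> x)" "{..<d2}" xs] len by (simp add: rdm2_def supp_mk)
  show "tr (pairs_op ?Z L (unit_op ?S2) * ?T) = tr (L * tensor (map (\<lambda>x. rdm1 d1 d2 (\<rho> x)) xs))"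
    if L: "supp L \<subseteq> ?S1"
  proof -
    have "tr (pairs_op ?Z L (unit_op ?S2) * ?T) = (\<Sum>bs\<in>?S1. \<Sum>cs\<in>?S2. \<Sum>bs'\<in>?S1. \<Sum>cs'\<in>?S2.
        if cs' = cs then entry L bs bs' * entry ?T (zip bs' cs) (zip bs cs) else 0)"
      unfolding gen by (rule sum.cong[OF refl], rule sum.cong[OF refl], rule sum.cong[OF refl], rule
          sum.cong[OF refl])
        (simp add: unit_op_def entry_mk)
    also have "\<dots> = (\<Sum>bs\<in>?S1. \<Sum>cs\<in>?S2. \<Sum>bs'\<in>?S1. entry L bs bs' * entry ?T (zip bs' cs) (zip bs cs))"
      by (rule sum.cong[OF refl], rule sum.cong[OF refl], rule sum.cong[OF refl]) simp
    also have "\<dots> = (\<Sum>bs\<in>?S1. \<Sum>bs'\<in>?S1. entry L bs bs' * (\<Sum>cs\<in>?S2. entry ?T (zip bs' cs) (zip bs cs)))"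
      unfolding sum_distrib_left by (rule sum.cong[OF refl], rule sum.swap)
    also have "\<dots> = (\<Sum>bs\<in>?S1. \<Sum>bs'\<in>?S1. entry L bs bs' * entry (tensor (map (\<lambda>x. rdm1 d1 d2 (\<rho> x)) xs)) bs' bs)"
      by (rule sum.cong[OF refl], rule sum.cong[OF refl]) (simp add: tensor_partial_trace1[OF len])
    also have "\<dots> = tr (L * tensor (map (\<lambda>x. rdm1 d1 d2 (\<rho> x)) xs))"
      by (rule tr_times[symmetric]) (use L s1 in auto)
    finally show ?thesis .
  qed
  show "tr (pairs_op ?Z (unit_op ?S1) G * ?T) = tr (G * tensor (map (\<lambda>x. rdm2 d1 d2 (\<rho> x)) xs))"
    if G: "supp G \<subseteq> ?S2"
  proof -
    have "tr (pairs_op ?Z (unit_op ?S1) G * ?T) = (\<Sum>bs\<in>?S1. \<Sum>cs\<in>?S2. \<Sum>bs'\<in>?S1. \<Sum>cs'\<in>?S2.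
        if bs' = bs then entry G cs cs' * entry ?T (zip bs cs') (zip bs cs) else 0)"
      unfolding gen by (rule sum.cong[OF refl], rule sum.cong[OF refl], rule sum.cong[OF refl], rule
          sum.cong[OF refl])
        (simp add: unit_op_def entry_mk)
    also have "\<dots> = (\<Sum>bs\<in>?S1. \<Sum>cs\<in>?S2. \<Sum>cs'\<in>?S2. entry G cs cs' * entry ?T (zip bs cs') (zip bs cs))"
      by (rule sum.cong[OF refl], rule sum.cong[OF refl]) (simp add: sum_if_out)
    also have "\<dots> = (\<Sum>cs\<in>?S2. \<Sum>cs'\<in>?S2. entry G cs cs' * (\<Sum>bs\<in>?S1. entry ?T (zip bs cs') (zip bs cs)))"
      unfolding sum_distrib_left by (rule sum_rotate[symmetric])
    also have "\<dots> = (\<Sum>cs\<in>?S2. \<Sum>cs'\<in>?S2. entry G cs cs' * entry (tensor (map (\<lambda>x. rdm2 d1 d2 (\<rho> x)) xs)) cs' cs)"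
      by (rule sum.cong[OF refl], rule sum.cong[OF refl]) (simp add: tensor_partial_trace2[OF len])
    also have "\<dots> = tr (G * tensor (map (\<lambda>x. rdm2 d1 d2 (\<rho> x)) xs))"
      by (rule tr_times[symmetric]) (use G s2 in auto)
    finally show ?thesis .
  qed
qed

section \<open>Coding\<close>

text \<open>Chooses one eigenbasis per letter; all are indexed by \<open>{..<d}\<close>, which
  provides the common index set of \<open>cq_ensemble\<close>.\<close>

lemma state_ensemble:
  assumes A: "finite A" and p: "\<And>x. x \<in> A \<Longrightarrow> 0 \<le> p x" "(\<Sum>x\<in>A. p x) = 1"
    and \<sigma>: "\<And>x. x \<in> A \<Longrightarrow> state_op d (\<sigma> x)"
  shows "\<exists>P r. cq_ensemble A p {..<d} {..<d} P r \<and> (\<forall>x\<in>A. cq_ensemble.state {..<d} P r x = \<sigma> x) \<and>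
    cq_ensemble.entropy A p {..<d} r = (\<Sum>x\<in>A. p x * entr d (\<sigma> x))"
proof -
  define G where "G x P r \<longleftrightarrow> resolution {..<d} P (unit_op {..<d}) \<and> \<sigma> x = (\<Sum>k<d. r k *\<^sub>R P k) \<and>
    (\<forall>k<d. 0 \<le> r k) \<and> (\<Sum>k<d. r k) = 1 \<and> entr d (\<sigma> x) = - (\<Sum>k<d. r k * log 2 (r k))"
    for x :: 'a and P :: "nat \<Rightarrow> nat op" and r :: "nat \<Rightarrow> real"
  have "\<forall>x\<in>A. \<exists>f. G x (fst f) (snd f)"
  proof
    fix x assume "x \<in> A"
    then have "\<exists>P r. G x P r"
    proof (rule state_op_spectral[OF \<sigma>])
      fix u r
      assume R: "resolution {..<d} (\<lambda>k. proj {..<d} (u k)) (unit_op {..<d})"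
        "\<sigma> x = (\<Sum>k<d. r k *\<^sub>R proj {..<d} (u k))" "\<And>k. k < d \<Longrightarrow> 0 \<le> r k" "(\<Sum>k<d. r k) = 1"
        "\<And>k l. k < d \<Longrightarrow> l < d \<Longrightarrow> (\<Sum>i<d. cnj (u k i) * u l i) = (if k = l then 1 else 0)"
      have "entr d (\<sigma> x) = - (\<Sum>k<d. r k * log 2 (r k))" by (rule entr_spectral[OF R(5,2,3)])
      with R show "\<exists>P r. G x P r" unfolding G_def by blast
    qed
    then show "\<exists>f. G x (fst f) (snd f)" by simp
  qed
  then obtain f where f: "\<forall>x\<in>A. G x (fst (f x)) (snd (f x))" by (rule bchoice[THEN exE])
  define P where "P x = fst (f x)" for x
  define r where "r x = snd (f x)" for x
  have G: "G x (P x) (r x)" if "x \<in> A" for x using f that by (simp add: P_def r_def)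
  have E: "cq_ensemble A p {..<d} {..<d} P r"
    by (rule cq_ensemble.intro) (use A p G in \<open>auto simp: G_def\<close>)
  interpret cq_ensemble A p "{..<d}" "{..<d}" P r by (rule E)
  have "state x = \<sigma> x" if "x \<in> A" for x using G[OF that] by (simp add: state_def G_def)
  moreover have "entropy = (\<Sum>x\<in>A. p x * entr d (\<sigma> x))"
  proof -
    have "entropy = (\<Sum>x\<in>A. p x * - (\<Sum>k<d. r x k * log 2 (r x k)))"
      by (simp add: entropy_def sum_negf)
    also have "\<dots> = (\<Sum>x\<in>A. p x * entr d (\<sigma> x))"
    proof (rule sum.cong[OF refl])
      fix x assume "x \<in> A"
      then have "entr d (\<sigma> x) = - (\<Sum>k<d. r x k * log 2 (r x k))" using G unfolding G_def by blast
      then show "p x * - (\<Sum>k<d. r x k * log 2 (r x k)) = p x * entr d (\<sigma> x)" by (simp only:)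
    qed
    finally show ?thesis .
  qed
  ultimately show ?thesis using E by blast
qed

lemma tensor_map_cong: "xs \<in> seqs n A \<Longrightarrow> (\<And>x. x \<in> A \<Longrightarrow> f x = g x) \<Longrightarrow> tensor (map f xs) = tensor (map g xs)"
  by (auto simp: seqs_def intro!: arg_cong[of _ _ tensor] map_cong)

lemma typical_exists:
  assumes A: "finite A" and p: "\<And>x. x \<in> A \<Longrightarrow> 0 \<le> p x" "(\<Sum>x\<in>A. p x) = 1"
    and \<sigma>: "\<And>x. x \<in> A \<Longrightarrow> state_op d (\<sigma> x)"
  shows "(\<Sum>x\<in>A. p x * entr d (\<sigma> x)) < s \<Longrightarrow> \<exists>Q \<rho>. upper_typical {..<d} A p \<sigma> s Q \<rho>"
    and "t < (\<Sum>x\<in>A. p x * entr d (\<sigma> x)) \<Longrightarrow> \<exists>Q \<rho>. lower_typical {..<d} A p \<sigma> t Q \<rho>"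
proof -
  have "\<exists>P r. cq_ensemble A p {..<d} {..<d} P r \<and> (\<forall>x\<in>A. cq_ensemble.state {..<d} P r x = \<sigma> x) \<and>
    cq_ensemble.entropy A p {..<d} r = (\<Sum>x\<in>A. p x * entr d (\<sigma> x))"
    by (rule state_ensemble) (use A p \<sigma> in auto)
  then obtain P r where E: "cq_ensemble A p {..<d} {..<d} P r"
    and st: "\<And>x. x \<in> A \<Longrightarrow> cq_ensemble.state {..<d} P r x = \<sigma> x"
    and en: "cq_ensemble.entropy A p {..<d} r = (\<Sum>x\<in>A. p x * entr d (\<sigma> x))"
    by blast
  interpret cq_ensemble A p "{..<d}" "{..<d}" P r by (rule E)
  have t: "tensor (map state xs) = tensor (map \<sigma> xs)" if "xs \<in> seqs n A" for xs n
    by (rule tensor_map_cong[OF that st])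
  show "\<exists>Q \<rho>. upper_typical {..<d} A p \<sigma> s Q \<rho>" if "(\<Sum>x\<in>A. p x * entr d (\<sigma> x)) < s"
    using typical_upper[of s] that by (simp add: en upper_typical_def t cong: sum.cong)
  show "\<exists>Q \<rho>. lower_typical {..<d} A p \<sigma> t Q \<rho>" if "t < (\<Sum>x\<in>A. p x * entr d (\<sigma> x))"
    using typical_lower[of t] that by (simp add: en lower_typical_def t cong: sum.cong)
qed

lemma seqs_singleton: "seqs n {a} = {replicate n a}"
  by (auto simp: seqs_def intro!: replicate_length_same[symmetric])

text \<open>An unconditional cut-off is a conditional one over a one-letter alphabet, whose only
  word of length \<open>n\<close> is constant.\<close>

lemma lower_typical_single:
  assumes "lower_typical {..<d} {a} (\<lambda>_. 1) (\<lambda>_. \<sigma>) t Q \<rho>"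
  shows "0 \<le> \<rho>" "\<rho> < 1" "is_proj (seqs n {..<d}) (Q n (replicate n a))"
    "Q n (replicate n a) * tensor (replicate n \<sigma>) * Q n (replicate n a) \<le> 2 powr (- real n * t) *\<^sub>R unit_op
        (seqs n {..<d})"
    "rtr ((unit_op (seqs n {..<d}) - Q n (replicate n a)) * tensor (replicate n \<sigma>)) \<le> \<rho> ^ n"
  using assms by (simp_all add: lower_typical_def seqs_singleton)

lemma tensor_average:
  "(\<Sum>xs\<in>seqs n X. prod_list (map q xs) *\<^sub>R tensor (map \<sigma> xs)) = tensor (replicate n (\<Sum>x\<in>X. q x *\<^sub>R \<sigma> x))"
proof (induction n)
  case (Suc n)
  have "(\<Sum>xs\<in>seqs (Suc n) X. prod_list (map q xs) *\<^sub>R tensor (map \<sigma> xs)) =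
      (\<Sum>x\<in>X. \<Sum>xs\<in>seqs n X. cons_op (q x *\<^sub>R \<sigma> x) (prod_list (map q xs) *\<^sub>R tensor (map \<sigma> xs)))"
    by (simp add: sum_seqs_Suc cons_op_scaleR mult.commute)
  also have "\<dots> = cons_op (\<Sum>x\<in>X. q x *\<^sub>R \<sigma> x) (\<Sum>xs\<in>seqs n X. prod_list (map q xs) *\<^sub>R tensor (map \<sigma> xs))"
    by (simp add: cons_op_sum) (subst sum.swap, rule refl)
  finally show ?case by (simp add: Suc.IH)
qed simp

text \<open>Averaging over the satellites of a fixed cloud centre yields a product state again; this
  is the state that the inner cut-off of Receiver 1 sandwiches.\<close>

lemma tensor_conditional_average:
  "(\<Sum>xs\<in>seqs (length ws) X. prod_list (map2 q ws xs) *\<^sub>R tensor (map \<sigma> xs)) = tensor (map (\<lambda>w. \<Sum>x\<in>X. q w x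
      *\<^sub>R \<sigma> x) ws)"
proof (induction ws)
  case (Cons w ws)
  have "(\<Sum>xs\<in>seqs (length (w # ws)) X. prod_list (map2 q (w # ws) xs) *\<^sub>R tensor (map \<sigma> xs)) =
      (\<Sum>x\<in>X. \<Sum>xs\<in>seqs (length ws) X. cons_op (q w x *\<^sub>R \<sigma> x) (prod_list (map2 q ws xs) *\<^sub>R tensor (map \<sigma> xs)))"
    by (simp add: sum_seqs_Suc cons_op_scaleR mult.commute)
  also have "\<dots> = cons_op (\<Sum>x\<in>X. q w x *\<^sub>R \<sigma> x) (\<Sum>xs\<in>seqs (length ws) X. prod_list (map2 q ws xs) *\<^sub>R tensor
      (map \<sigma> xs))"
    by (simp add: cons_op_sum) (subst sum.swap, rule refl)
  finally show ?case by (simp add: Cons.IH)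
qed simp

lemma weight_average:
  "(\<Sum>ws\<in>seqs (length xs) W. prod_list (map p ws) * prod_list (map2 q ws xs)) = prod_list (map (\<lambda>x. \<Sum>w\<in>W. p w
      * q w x) xs)"
  for p :: "'w \<Rightarrow> real"
proof (induction xs)
  case (Cons x xs)
  have "(\<Sum>ws\<in>seqs (length (x # xs)) W. prod_list (map p ws) * prod_list (map2 q ws (x # xs))) =
      (\<Sum>w\<in>W. \<Sum>ws\<in>seqs (length xs) W. (p w * q w x) * (prod_list (map p ws) * prod_list (map2 q ws xs)))"
    by (simp add: sum_seqs_Suc mult_ac)
  also have "\<dots> = (\<Sum>w\<in>W. p w * q w x) * (\<Sum>ws\<in>seqs (length xs) W. prod_list (map p ws) * prod_list
      (map2 q ws xs))"
    by (simp add: sum_product)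
  finally show ?case by (simp add: Cons.IH)
qed simp

lemma rtr_mult_sum: "(\<Sum>x\<in>X. q x * rtr (A * F x)) = rtr (A * (\<Sum>x\<in>X. q x *\<^sub>R F x))"
  by (simp add: sum_distrib_left tr_sum)

section \<open>Averages over cloud centres and satellites\<close>

context broadcast
begin

abbreviation "p\<^sub>n \<equiv> \<lambda>w. prod_list (map pW w)"
abbreviation "q\<^sub>n \<equiv> \<lambda>w x. prod_list (map2 pXW w x)"

lemma p\<^sub>n_nonneg: "w \<in> seqs n {..<nW} \<Longrightarrow> 0 \<le> p\<^sub>n w"
  by (intro prod_list_map_nonneg) (auto simp: seqs_def pW0)

lemma p\<^sub>n_sum: "(\<Sum>w\<in>seqs n {..<nW}. p\<^sub>n w) = 1"
  by (simp add: sum_seqs_prod_list_single pW1)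

lemma q\<^sub>n_nonneg: "w \<in> seqs n {..<nW} \<Longrightarrow> x \<in> seqs n {..<nX} \<Longrightarrow> 0 \<le> q\<^sub>n w x"
  by (intro prod_list_map_nonneg) (use zip_mem pXW0 in force)

lemma q\<^sub>n_sum: "w \<in> seqs n {..<nW} \<Longrightarrow> (\<Sum>x\<in>seqs n {..<nX}. q\<^sub>n w x) = 1"
proof -
  assume w: "w \<in> seqs n {..<nW}"
  then have "map (\<lambda>w. \<Sum>x<nX. pXW w x) w = map (\<lambda>_. 1) w"
    by (intro map_cong) (auto simp: seqs_def pXW1)
  then have "prod_list (map (\<lambda>w. \<Sum>x<nX. pXW w x) w) = 1" by (simp only: prod_list_map_one)
  then show ?thesis using sum_seqs_prod_list[of pXW w "{..<nX}"] seqs_length[OF w] by simp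
qed

lemma avg_W:
  assumes w: "w \<in> seqs n {..<nW}"
  shows "(\<Sum>x\<in>seqs n {..<nX}. q\<^sub>n w x *\<^sub>R tensor (map \<sigma>1 x)) = tensor (map \<omega>1 w)"
    "(\<Sum>x\<in>seqs n {..<nX}. q\<^sub>n w x *\<^sub>R tensor (map \<sigma>2 x)) = tensor (map \<omega>2 w)"
  using tensor_conditional_average[where q = pXW and ws = w and X = "{..<nX}" and \<sigma> = \<sigma>1]
    tensor_conditional_average[where q = pXW and ws = w and X = "{..<nX}" and \<sigma> = \<sigma>2]
    seqs_length[OF w] by (simp_all add: \<omega>1_def[abs_def] \<omega>2_def[abs_def])

lemma avg_\<tau>: "(\<Sum>w\<in>seqs n {..<nW}. p\<^sub>n w *\<^sub>R tensor (map \<omega>1 w)) = tensor (replicate n \<tau>1)"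
  "(\<Sum>w\<in>seqs n {..<nW}. p\<^sub>n w *\<^sub>R tensor (map \<omega>2 w)) = tensor (replicate n \<tau>2)"
  by (simp_all add: tensor_average \<tau>1_def \<tau>2_def)

lemma rtr_avg_W:
  assumes w: "w \<in> seqs n {..<nW}"
  shows "(\<Sum>x\<in>seqs n {..<nX}. q\<^sub>n w x * rtr (A * tensor (map \<sigma>1 x))) = rtr (A * tensor (map \<omega>1 w))"
    "(\<Sum>x\<in>seqs n {..<nX}. q\<^sub>n w x * rtr (A * tensor (map \<sigma>2 x))) = rtr (A * tensor (map \<omega>2 w))"
  unfolding rtr_mult_sum avg_W[OF w] by simp_all

lemma rtr_avg_\<tau>: "(\<Sum>w\<in>seqs n {..<nW}. p\<^sub>n w * (\<Sum>x\<in>seqs n {..<nX}. q\<^sub>n w x * rtr (A * tensor (map \<sigma>1 x))))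
    = rtr (A * tensor (replicate n \<tau>1))"
  "(\<Sum>w\<in>seqs n {..<nW}. p\<^sub>n w * (\<Sum>x\<in>seqs n {..<nX}. q\<^sub>n w x * rtr (A * tensor (map \<sigma>2 x)))) = rtr (A
      * tensor (replicate n \<tau>2))"
proof -
  have "(\<Sum>w\<in>seqs n {..<nW}. p\<^sub>n w * (\<Sum>x\<in>seqs n {..<nX}. q\<^sub>n w x * rtr (A * tensor (map \<sigma>1 x)))) =
      (\<Sum>w\<in>seqs n {..<nW}. p\<^sub>n w * rtr (A * tensor (map \<omega>1 w)))"
    by (rule sum.cong[OF refl]) (simp only: rtr_avg_W)
  then show "(\<Sum>w\<in>seqs n {..<nW}. p\<^sub>n w * (\<Sum>x\<in>seqs n {..<nX}. q\<^sub>n w x * rtr (A * tensor (map \<sigma>1 x))))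
      = rtr (A * tensor (replicate n \<tau>1))"
    by (simp only: rtr_mult_sum avg_\<tau>)
  have "(\<Sum>w\<in>seqs n {..<nW}. p\<^sub>n w * (\<Sum>x\<in>seqs n {..<nX}. q\<^sub>n w x * rtr (A * tensor (map \<sigma>2 x)))) =
      (\<Sum>w\<in>seqs n {..<nW}. p\<^sub>n w * rtr (A * tensor (map \<omega>2 w)))"
    by (rule sum.cong[OF refl]) (simp only: rtr_avg_W)
  then show "(\<Sum>w\<in>seqs n {..<nW}. p\<^sub>n w * (\<Sum>x\<in>seqs n {..<nX}. q\<^sub>n w x * rtr (A * tensor (map \<sigma>2 x))))
      = rtr (A * tensor (replicate n \<tau>2))"
    by (simp only: rtr_mult_sum avg_\<tau>)
qed

text \<open>A quantity that depends on the satellite alone is averaged under powers of the marginal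
  \<open>pX\<close>, so the projections \<open>P\<close> may be chosen for \<open>pX\<close> without
  reference to the cloud.\<close>

lemma avg_X: "(\<Sum>w\<in>seqs n {..<nW}. p\<^sub>n w * (\<Sum>x\<in>seqs n {..<nX}. q\<^sub>n w x * f x)) =
    (\<Sum>x\<in>seqs n {..<nX}. prod_list (map pX x) * f x)"
proof -
  have "(\<Sum>w\<in>seqs n {..<nW}. p\<^sub>n w * (\<Sum>x\<in>seqs n {..<nX}. q\<^sub>n w x * f x)) =
      (\<Sum>x\<in>seqs n {..<nX}. (\<Sum>w\<in>seqs n {..<nW}. p\<^sub>n w * q\<^sub>n w x) * f x)"
    by (simp add: sum_distrib_left sum_distrib_right mult.assoc) (rule sum.swap)
  also have "\<dots> = (\<Sum>x\<in>seqs n {..<nX}. prod_list (map pX x) * f x)"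
  proof (rule sum.cong[OF refl])
    fix x assume "x \<in> seqs n {..<nX}"
    then show "(\<Sum>w\<in>seqs n {..<nW}. p\<^sub>n w * q\<^sub>n w x) * f x = prod_list (map pX x) * f x"
      using weight_average[of pW pXW x "{..<nW}"] by (simp add: seqs_length pX_def[abs_def])
  qed
  finally show ?thesis .
qed

lemma tensor_state:
  assumes x: "x \<in> seqs n A" and \<sigma>: "\<And>a. a \<in> A \<Longrightarrow> state_op d (\<sigma> a)"
  shows "0 \<le> tensor (map \<sigma> x)" "supp (tensor (map \<sigma> x)) \<subseteq> seqs n {..<d}" "tr (tensor (map \<sigma> x)) = 1"
proof -
  have s: "0 \<le> B \<and> supp B \<subseteq> {..<d}" "tr B = 1" if "B \<in> set (map \<sigma> x)" for B
    using that x \<sigma> by (auto simp: seqs_def state_op_def subset_iff)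
  show "0 \<le> tensor (map \<sigma> x)" "supp (tensor (map \<sigma> x)) \<subseteq> seqs n {..<d}"
    using tensor_nonneg[of "map \<sigma> x" "{..<d}"] s(1) seqs_length[OF x] by auto
  have "prod_list (map tr (map \<sigma> x)) = 1" using s(2) by (induction x) auto
  then show "tr (tensor (map \<sigma> x)) = 1" by (simp add: tr_tensor)
qed

text \<open>Coding at a fixed block length, with all exponentials left as parameters. In the last
  assumption 6, 12, 8 and 6, 8 are twice the constants of the nested tests, the factor 2 and the 4
  of the wrong-message terms come from the measurement bound, and each receiver adds
  \<open>4 * \<eta>\<close>.\<close>

lemma code_from_tests:
  fixes n :: nat and R1' R' R2' \<eta> a b c a2 c2 e1 e2 e3 e4 e5 \<epsilon> :: real
  defines "M1 \<equiv> msg_size n R1'" and "M \<equiv> msg_size n R'"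
  defines "E1 \<equiv> unit_op (seqs n {..<d1})" and "E2 \<equiv> unit_op (seqs n {..<d2})"
  assumes M2: "msg_size n R2' = 1" and M_pos: "1 \<le> M" "1 \<le> M1" and \<eta>: "0 < \<eta>"
    and Q: "is_proj (seqs n {..<d1}) Q" and S: "\<And>w. w \<in> seqs n {..<nW} \<Longrightarrow> is_proj (seqs n {..<d1}) (S w)"
    and P: "\<And>x. x \<in> seqs n {..<nX} \<Longrightarrow> is_proj (seqs n {..<d1}) (P x)"
    and Q2: "is_proj (seqs n {..<d2}) Q2" and P2: "\<And>w. w \<in> seqs n {..<nW} \<Longrightarrow> is_proj (seqs n {..<d2}) (P2 w)"
    and nn: "0 \<le> a" "0 \<le> b" "0 \<le> c" "0 \<le> a2" "0 \<le> c2"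
    and Pa: "\<And>x. x \<in> seqs n {..<nX} \<Longrightarrow> P x \<le> a *\<^sub>R tensor (map \<sigma>1 x)" "\<And>x. x \<in> seqs n {..<nX} \<Longrightarrow> rtr (P x) \<le> a"
    and Sb: "\<And>w. w \<in> seqs n {..<nW} \<Longrightarrow> S w * tensor (map \<omega>1 w) * S w \<le> b *\<^sub>R E1"
    and Qc: "Q * tensor (replicate n \<tau>1) * Q \<le> c *\<^sub>R E1"
    and P2a: "\<And>w. w \<in> seqs n {..<nW} \<Longrightarrow> rtr (P2 w) \<le> a2"
    and Q2c: "Q2 * tensor (replicate n \<tau>2) * Q2 \<le> c2 *\<^sub>R E2"
    and e1: "rtr ((E1 - Q) * tensor (replicate n \<tau>1)) \<le> e1"
    and e2: "(\<Sum>w\<in>seqs n {..<nW}. p\<^sub>n w * rtr ((E1 - S w) * tensor (map \<omega>1 w))) \<le> e2"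
    and e3: "(\<Sum>x\<in>seqs n {..<nX}. prod_list (map pX x) * rtr ((E1 - P x) * tensor (map \<sigma>1 x))) \<le> e3"
    and e4: "rtr ((E2 - Q2) * tensor (replicate n \<tau>2)) \<le> e4"
    and e5: "(\<Sum>w\<in>seqs n {..<nW}. p\<^sub>n w * rtr ((E2 - P2 w) * tensor (map \<omega>2 w))) \<le> e5"
    and \<epsilon>: "(6 * e1 + 12 * e2 + 8 * e3 + 6 * e4 + 8 * e5 + 8 * \<eta>) + real (M1 - 1) * (4 * (a * b))
      + real (M - 1) * (real M1 * (4 * (a * c)) + 4 * (a2 * c2)) \<le> \<epsilon>"
  shows "has_code nX d1 d2 \<rho> n R1' R' R2' \<epsilon>"
proof -
  let ?W = "seqs n {..<nW}" and ?X = "seqs n {..<nX}" and ?I1 = "seqs n {..<d1}" and ?I2 = "seqs n {..<d2}"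
  define T where "T w x = nested_test Q (S w) (P x)" for w x
  \<comment> \<open>Receiver 2 decodes only cloud centres, so its middle cut-off is the identity and
    the corresponding error term vanishes.\<close>
  define T2 where "T2 w = nested_test Q2 E2 (P2 w)" for w
  define \<rho>1 where "\<rho>1 x = tensor (map \<sigma>1 x)" for x
  define \<rho>2 where "\<rho>2 x = tensor (map \<sigma>2 x)" for x
  have fin: "finite ?W" "finite ?X" "finite ?I1" "finite ?I2" by simp_all
  have E2p: "is_proj ?I2 E2" by (simp add: E2_def is_proj_unit)
  have \<rho>1: "0 \<le> \<rho>1 x" "supp (\<rho>1 x) \<subseteq> ?I1" "tr (\<rho>1 x) = 1" if "x \<in> ?X" for x
    unfolding \<rho>1_def using tensor_state[OF that, of d1 \<sigma>1] st_\<sigma> by auto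
  have \<rho>2: "0 \<le> \<rho>2 x" "supp (\<rho>2 x) \<subseteq> ?I2" "tr (\<rho>2 x) = 1" if "x \<in> ?X" for x
    unfolding \<rho>2_def using tensor_state[OF that, of d2 \<sigma>2] st_\<sigma> by auto
  have T: "0 \<le> T w x" "T w x \<le> E1" "supp (T w x) \<subseteq> ?I1"
    "E1 - T w x \<le> 3 *\<^sub>R (E1 - Q) + 6 *\<^sub>R (E1 - S w) + 4 *\<^sub>R (E1 - P x)" if "w \<in> ?W" "x \<in> ?X" for w x
    unfolding T_def E1_def
    using nested_test_nonneg[OF fin(3) Q S P] nested_test_le[OF fin(3) Q S P]
      nested_test_supp[OF fin(3) Q S P] nested_test_compl[OF fin(3) Q S P] that by auto
  have T2: "0 \<le> T2 w" "T2 w \<le> E2" "supp (T2 w) \<subseteq> ?I2"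
    "E2 - T2 w \<le> 3 *\<^sub>R (E2 - Q2) + 4 *\<^sub>R (E2 - P2 w)" if "w \<in> ?W" for w
    unfolding T2_def
    using nested_test_nonneg[OF fin(4) Q2 E2p P2] nested_test_le[OF fin(4) Q2 E2p P2]
      nested_test_supp[OF fin(4) Q2 E2p P2] nested_test_compl[OF fin(4) Q2 E2p P2] that by (auto simp: E2_def)
  define G where "G w x = (2 * rtr ((E1 - T w x) * \<rho>1 x) + 4 * \<eta>) + (2 * rtr ((E2 - T2 w) * \<rho>2 x) + 4 * \<eta>)"
      for w x
  define H1 where "H1 w x x' = 4 * rtr (T w x' * \<rho>1 x)" for w x x'
  define H2 where "H2 w' x' x = 4 * rtr (T w' x' * \<rho>1 x)" for w' x' x
  define H3 where "H3 w' x = 4 * rtr (T2 w' * \<rho>2 x)" for w' x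
  let ?av = "\<lambda>f. \<Sum>w\<in>?W. p\<^sub>n w * (\<Sum>x\<in>?X. q\<^sub>n w x * f w x)"
  have av_mono: "?av f \<le> ?av g" if "\<And>w x. w \<in> ?W \<Longrightarrow> x \<in> ?X \<Longrightarrow> f w x \<le> g w x" for f g
    using that by (intro sum_mono mult_left_mono) (auto intro: p\<^sub>n_nonneg q\<^sub>n_nonneg)
  have av_add: "?av (\<lambda>w x. f w x + g w x) = ?av f + ?av g" for f g
    by (simp add: distrib_left sum.distrib)
  have av_cmult: "?av (\<lambda>w x. k * f w x) = k * ?av f" for k f
    by (simp add: sum_distrib_left mult_ac)
  have av_const: "?av (\<lambda>_ _. k) = k" for k
  proof -
    have "?av (\<lambda>_ _. k) = (\<Sum>w\<in>?W. p\<^sub>n w * ((\<Sum>x\<in>?X. q\<^sub>n w x) * k))" by (simp add: sum_distrib_right)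
    also have "\<dots> = (\<Sum>w\<in>?W. p\<^sub>n w) * k" by (simp add: q\<^sub>n_sum sum_distrib_right cong: sum.cong)
    finally show ?thesis by (simp add: p\<^sub>n_sum)
  qed
  have EG: "?av G \<le> 6 * e1 + 12 * e2 + 8 * e3 + 6 * e4 + 8 * e5 + 8 * \<eta>"
  proof -
    have "?av (\<lambda>w x. rtr ((E1 - T w x) * \<rho>1 x)) \<le>
        ?av (\<lambda>w x. (3 * rtr ((E1 - Q) * \<rho>1 x) + 6 * rtr ((E1 - S w) * \<rho>1 x)) + 4 * rtr ((E1 - P x) * \<rho>1 x))"
    proof (rule av_mono)
      fix w x assume wx: "w \<in> ?W" "x \<in> ?X"
      show "rtr ((E1 - T w x) * \<rho>1 x) \<le> (3 * rtr ((E1 - Q) * \<rho>1 x) + 6 * rtr ((E1 - S w) * \<rho>1 x)) + 4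
          * rtr ((E1 - P x) * \<rho>1 x)"
        using rtr_mult_mono[OF T(4)[OF wx] \<rho>1(1)[OF wx(2)]] by (simp add: distrib_right)
    qed
    also have "\<dots> = 3 * ?av (\<lambda>w x. rtr ((E1 - Q) * \<rho>1 x)) + 6 * ?av (\<lambda>w x. rtr ((E1 - S w) * \<rho>1 x)) + 4
        * ?av (\<lambda>w x. rtr ((E1 - P x) * \<rho>1 x))"
      by (simp only: av_add av_cmult)
    also have "?av (\<lambda>w x. rtr ((E1 - Q) * \<rho>1 x)) = rtr ((E1 - Q) * tensor (replicate n \<tau>1))"
      unfolding \<rho>1_def by (rule rtr_avg_\<tau>)
    also have "?av (\<lambda>w x. rtr ((E1 - S w) * \<rho>1 x)) = (\<Sum>w\<in>?W. p\<^sub>n w * rtr ((E1 - S w) * tensor (map \<omega>1 w)))"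
      unfolding \<rho>1_def by (rule sum.cong[OF refl]) (simp only: rtr_avg_W)
    also have "?av (\<lambda>w x. rtr ((E1 - P x) * \<rho>1 x)) = (\<Sum>x\<in>?X. prod_list (map pX x) * rtr ((E1 - P x)
        * tensor (map \<sigma>1 x)))"
      unfolding \<rho>1_def by (rule avg_X)
    finally have 1: "?av (\<lambda>w x. rtr ((E1 - T w x) * \<rho>1 x)) \<le> 3 * e1 + 6 * e2 + 4 * e3"
      using e1 e2 e3 by linarith
    have "?av (\<lambda>w x. rtr ((E2 - T2 w) * \<rho>2 x)) \<le>
        ?av (\<lambda>w x. 3 * rtr ((E2 - Q2) * \<rho>2 x) + 4 * rtr ((E2 - P2 w) * \<rho>2 x))"
    proof (rule av_mono)
      fix w x assume wx: "w \<in> ?W" "x \<in> ?X"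
      show "rtr ((E2 - T2 w) * \<rho>2 x) \<le> 3 * rtr ((E2 - Q2) * \<rho>2 x) + 4 * rtr ((E2 - P2 w) * \<rho>2 x)"
        using rtr_mult_mono[OF T2(4)[OF wx(1)] \<rho>2(1)[OF wx(2)]] by (simp add: distrib_right)
    qed
    also have "\<dots> = 3 * ?av (\<lambda>w x. rtr ((E2 - Q2) * \<rho>2 x)) + 4 * ?av (\<lambda>w x. rtr ((E2 - P2 w) * \<rho>2 x))"
      by (simp only: av_add av_cmult)
    also have "?av (\<lambda>w x. rtr ((E2 - Q2) * \<rho>2 x)) = rtr ((E2 - Q2) * tensor (replicate n \<tau>2))"
      unfolding \<rho>2_def by (rule rtr_avg_\<tau>)
    also have "?av (\<lambda>w x. rtr ((E2 - P2 w) * \<rho>2 x)) = (\<Sum>w\<in>?W. p\<^sub>n w * rtr ((E2 - P2 w) * tensor (map \<omega>2 w)))"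
      unfolding \<rho>2_def by (rule sum.cong[OF refl]) (simp only: rtr_avg_W)
    finally have 2: "?av (\<lambda>w x. rtr ((E2 - T2 w) * \<rho>2 x)) \<le> 3 * e4 + 4 * e5"
      using e4 e5 by linarith
    have "?av G = (2 * ?av (\<lambda>w x. rtr ((E1 - T w x) * \<rho>1 x)) + 4 * \<eta>) + (2 * ?av (\<lambda>w x. rtr ((E2 - T2 w)
        * \<rho>2 x)) + 4 * \<eta>)"
      unfolding G_def by (simp only: av_add av_cmult av_const)
    then show ?thesis using 1 2 by linarith
  qed
  have EH1: "(\<Sum>w\<in>?W. p\<^sub>n w * (\<Sum>x\<in>?X. q\<^sub>n w x * (\<Sum>x'\<in>?X. q\<^sub>n w x' * H1 w x x'))) \<le> 4 * (a * b)"
  proof -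
    have "(\<Sum>w\<in>?W. p\<^sub>n w * (\<Sum>x\<in>?X. q\<^sub>n w x * (\<Sum>x'\<in>?X. q\<^sub>n w x' * H1 w x x'))) \<le> ?av (\<lambda>_ _. 4 * (a * b))"
    proof (rule av_mono)
      fix w x assume wx: "w \<in> ?W" "x \<in> ?X"
      have "(\<Sum>x'\<in>?X. q\<^sub>n w x' * rtr (nested_test Q (S w) (P x') * \<rho>1 x)) \<le> a * b * rtr (\<rho>1 x)"
        \<comment> \<open>The wrong satellite \<open>x'\<close> shares the cloud \<open>w\<close>,
          so the states averaged over it give the product of \<open>\<omega>1\<close>, which
          \<open>S w\<close> cuts off at \<open>b\<close>.\<close>
        by (rule rtr_nested_test_average_le[OF fin(3) Q S[OF wx(1)], where \<rho> = "\<lambda>x. tensor (map \<sigma>1 x)"])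
          (use Pa q\<^sub>n_nonneg[OF wx(1)] Sb[OF wx(1)] nn \<rho>1[OF wx(2)] in \<open>auto simp: avg_W[OF wx(1)] E1_def\<close>)
      then have "4 * (\<Sum>x'\<in>?X. q\<^sub>n w x' * rtr (T w x' * \<rho>1 x)) \<le> 4 * (a * b)"
        using \<rho>1(3)[OF wx(2)] by (simp add: T_def)
      then show "(\<Sum>x'\<in>?X. q\<^sub>n w x' * H1 w x x') \<le> 4 * (a * b)"
        by (simp add: H1_def sum_distrib_left mult_ac)
    qed
    then show ?thesis by (simp only: av_const)
  qed
  have EH2: "(\<Sum>w'\<in>?W. p\<^sub>n w' * (\<Sum>x'\<in>?X. q\<^sub>n w' x' * (\<Sum>w\<in>?W. p\<^sub>n w * (\<Sum>x\<in>?X. q\<^sub>n w x * H2 w' x' x)))) \<le> 4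
      * (a * c)"
  proof -
    have "(\<Sum>w'\<in>?W. p\<^sub>n w' * (\<Sum>x'\<in>?X. q\<^sub>n w' x' * (\<Sum>w\<in>?W. p\<^sub>n w * (\<Sum>x\<in>?X. q\<^sub>n w x * H2 w' x' x))))
        \<le> ?av (\<lambda>_ _. 4 * (a * c))"
    proof (rule av_mono)
      fix w' x' assume wx: "w' \<in> ?W" "x' \<in> ?X"
      \<comment> \<open>The sent codeword comes from a cloud independent of the tested one, so its
        average is the power of \<open>\<tau>1\<close>.\<close>
      have "(\<Sum>w\<in>?W. p\<^sub>n w * (\<Sum>x\<in>?X. q\<^sub>n w x * H2 w' x' x)) = 4 * rtr (T w' x' * tensor (replicate n \<tau>1))"
        unfolding H2_def \<rho>1_def av_cmult rtr_avg_\<tau> ..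
      moreover have "rtr (T w' x' * tensor (replicate n \<tau>1)) \<le> c * rtr (P x')"
        unfolding T_def by (rule rtr_nested_test_le[OF fin(3) Q S[OF wx(1)] P[OF wx(2)] Qc[unfolded E1_def]
            nn(3)])
      moreover have "c * rtr (P x') \<le> c * a" using Pa(2)[OF wx(2)] nn by (intro mult_left_mono)
      ultimately show "(\<Sum>w\<in>?W. p\<^sub>n w * (\<Sum>x\<in>?X. q\<^sub>n w x * H2 w' x' x)) \<le> 4 * (a * c)"
        by (simp add: mult.commute)
    qed
    then show ?thesis by (simp only: av_const)
  qed
  have EH3: "(\<Sum>w'\<in>?W. p\<^sub>n w' * (\<Sum>w\<in>?W. p\<^sub>n w * (\<Sum>x\<in>?X. q\<^sub>n w x * H3 w' x))) \<le> 4 * (a2 * c2)"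
  proof -
    have "(\<Sum>w'\<in>?W. p\<^sub>n w' * (\<Sum>w\<in>?W. p\<^sub>n w * (\<Sum>x\<in>?X. q\<^sub>n w x * H3 w' x))) \<le> (\<Sum>w'\<in>?W. p\<^sub>n w' * (4 * (a2 * c2)))"
    proof (intro sum_mono mult_left_mono)
      fix w' assume w: "w' \<in> ?W"
      have "(\<Sum>w\<in>?W. p\<^sub>n w * (\<Sum>x\<in>?X. q\<^sub>n w x * H3 w' x)) = 4 * rtr (T2 w' * tensor (replicate n \<tau>2))"
        unfolding H3_def \<rho>2_def av_cmult rtr_avg_\<tau> ..
      moreover have "rtr (T2 w' * tensor (replicate n \<tau>2)) \<le> c2 * rtr (P2 w')"
        unfolding T2_def by (rule rtr_nested_test_le[OF fin(4) Q2 E2p P2[OF w] Q2c[unfolded E2_def] nn(5)])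
      moreover have "c2 * rtr (P2 w') \<le> c2 * a2" using P2a[OF w] nn by (intro mult_left_mono)
      ultimately show "(\<Sum>w\<in>?W. p\<^sub>n w * (\<Sum>x\<in>?X. q\<^sub>n w x * H3 w' x)) \<le> 4 * (a2 * c2)"
        by (simp add: mult.commute)
      show "0 \<le> p\<^sub>n w'" by (rule p\<^sub>n_nonneg[OF w])
    qed
    also have "\<dots> = 4 * (a2 * c2)" by (simp only: sum_distrib_right[symmetric] p\<^sub>n_sum mult_1)
    finally show ?thesis .
  qed
  obtain w x where w: "\<And>m. m < M \<Longrightarrow> w m \<in> ?W" and x: "\<And>m m1. m < M \<Longrightarrow> m1 < M1 \<Longrightarrow> x m m1 \<in> ?X"
    and code: "(\<Sum>m<M. \<Sum>m1<M1. G (w m) (x m m1) + (\<Sum>m1'\<in>{..<M1} - {m1}. H1 (w m) (x m m1) (x m m1'))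
       + (\<Sum>m'\<in>{..<M} - {m}. (\<Sum>m1'<M1. H2 (w m') (x m' m1') (x m m1)) + H3 (w m') (x m m1)))
     \<le> real M * real M1 * ((6 * e1 + 12 * e2 + 8 * e3 + 6 * e4 + 8 * e5 + 8 * \<eta>) + real (M1 - 1) * (4 * (a * b))
       + real (M - 1) * (real M1 * (4 * (a * c)) + 4 * (a2 * c2)))"
    by (rule superposition_code_exists[OF fin(1,2) _ p\<^sub>n_sum _ _ EG EH1 EH2 EH3 M_pos])
      (use p\<^sub>n_nonneg q\<^sub>n_nonneg q\<^sub>n_sum in \<open>blast+\<close>)
  \<comment> \<open>\<open>{..<1}\<close> is the single personal message of Receiver 2; the orders
    \<open>(m1, m)\<close> and \<open>(m, m2)\<close> are those of the definition of a code.\<close>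
  let ?MM = "{..<M1} \<times> {..<M}" and ?MM2 = "{..<M} \<times> {..<1::nat}"
  define T' where "T' mm = T (w (snd mm)) (x (snd mm) (fst mm))" for mm
  define T2' where "T2' mm = T2 (w (fst mm))" for mm :: "nat \<times> nat"
  have MMne: "?MM \<noteq> {}" "?MM2 \<noteq> {}" using M_pos by (auto simp: lessThan_empty_iff)
  have T': "supp (T' mm) \<subseteq> ?I1" "0 \<le> T' mm" "T' mm \<le> unit_op ?I1" if "mm \<in> ?MM" for mm
    unfolding T'_def using that T[OF w x, of "snd mm" "snd mm" "fst mm"] by (auto simp: E1_def)
  have T2': "supp (T2' mm) \<subseteq> ?I2" "0 \<le> T2' mm" "T2' mm \<le> unit_op ?I2" if "mm \<in> ?MM2" for mm
    unfolding T2'_def using that T2[OF w, of "fst mm"] by (auto simp: E2_def)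
  obtain L where L: "\<And>m. m \<in> ?MM \<Longrightarrow> 0 \<le> L m" "\<And>m. m \<in> ?MM \<Longrightarrow> supp (L m) \<subseteq> ?I1" "(\<Sum>m\<in>?MM. L m) = unit_op ?I1"
    "\<And>m. m \<in> ?MM \<Longrightarrow> unit_op ?I1 - L m \<le> 2 *\<^sub>R (unit_op ?I1 - T' m) + 4 *\<^sub>R ((\<Sum>m'\<in>?MM - {m}. T' m')
        + \<eta> *\<^sub>R unit_op ?I1)"
    by (rule square_root_measurement[OF fin(3) _ MMne(1) \<eta> T']) auto
  obtain L2 where L2: "\<And>m. m \<in> ?MM2 \<Longrightarrow> 0 \<le> L2 m" "\<And>m. m \<in> ?MM2 \<Longrightarrow> supp (L2 m) \<subseteq> ?I2" "(\<Sum>m\<in>?MM2. L2 m)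
      = unit_op ?I2"
    "\<And>m. m \<in> ?MM2 \<Longrightarrow> unit_op ?I2 - L2 m \<le> 2 *\<^sub>R (unit_op ?I2 - T2' m) + 4 *\<^sub>R ((\<Sum>m'\<in>?MM2 - {m}. T2' m')
        + \<eta> *\<^sub>R unit_op ?I2)"
    by (rule square_root_measurement[OF fin(4) _ MMne(2) \<eta> T2']) auto
  have part: "L m \<le> unit_op I" if "finite S" "m \<in> S" "\<And>m. m \<in> S \<Longrightarrow> 0 \<le> L m" "(\<Sum>m\<in>S. L m) = unit_op I"
    for L :: "nat \<times> nat \<Rightarrow> nat list op" and S m I
  proof -
    have "unit_op I = L m + (\<Sum>m\<in>S - {m}. L m)" using that by (simp add: sum.remove[of S m L] flip: that(4))
    moreover have "0 \<le> (\<Sum>m\<in>S - {m}. L m)" using that by (intro sum_nonneg) auto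
    ultimately show ?thesis by simp
  qed
  have dens_x: "density_op (d1 * d2) (\<rho> a)" "\<rho> a \<in> carrier_mat (d1 * d2) (d1 * d2)" if "a \<in> set (x m m1)" "m
      < M" "m1 < M1" for a m m1
  proof -
    have "a < nX" using x[OF that(2,3)] that(1) by (auto simp: seqs_def)
    then show "density_op (d1 * d2) (\<rho> a)" by (rule dens)
    then show "\<rho> a \<in> carrier_mat (d1 * d2) (d1 * d2)" unfolding density_op_def psd_mat_def hermitian_mat_def
        by blast
  qed
  define err where "err m m1 = Re (mtrace ((1\<^sub>m (d1 ^ n * d2 ^ n) - kron (mat_op n d1 (L (m1, m)))
      (mat_op n d2 (L2 (m, 0))))
      * out_state d1 d2 \<rho> n (\<lambda>i. x m m1 ! i)))" for m m1
  have err: "err m m1 \<le> G (w m) (x m m1) + (\<Sum>m1'\<in>{..<M1} - {m1}. H1 (w m) (x m m1) (x m m1'))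
       + (\<Sum>m'\<in>{..<M} - {m}. (\<Sum>m1'<M1. H2 (w m') (x m' m1') (x m m1)) + H3 (w m') (x m m1))"
    if m: "m < M" "m1 < M1" for m m1
  proof -
    let ?x = "x m m1"
    let ?T12 = "tensor (map (\<lambda>a. \<sigma>12 d1 d2 (\<rho> a)) ?x)"
    have mm: "(m1, m) \<in> ?MM" "(m, 0) \<in> ?MM2" using m by auto
    have xX: "?x \<in> ?X" using x m by blast
    have len: "length ?x = n" using xX by (rule seqs_length)
    have "0 \<le> ?T12"
    proof (rule tensor_nonneg[THEN conjunct1, of _ "{..<d1} \<times> {..<d2}"])
      fix A assume "A \<in> set (map (\<lambda>a. \<sigma>12 d1 d2 (\<rho> a)) ?x)"
      then obtain a where a: "a \<in> set ?x" "A = \<sigma>12 d1 d2 (\<rho> a)" by auto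
      show "0 \<le> A \<and> supp A \<subseteq> {..<d1} \<times> {..<d2}"
        using \<sigma>12_nonneg[OF dens_x(1)[OF a(1) m]] by (simp add: a(2) supp_\<sigma>12)
    qed simp
    have Lle: "L (m1, m) \<le> unit_op ?I1" "L2 (m, 0) \<le> unit_op ?I2"
      by (rule part[of ?MM], use L mm in auto, rule part[of ?MM2], use L2 mm in auto)
    have sL: "supp (unit_op ?I1 - L (m1, m)) \<subseteq> ?I1" "supp (unit_op ?I2 - L2 (m, 0)) \<subseteq> ?I2"
      using supp_diff[of "unit_op ?I1" "L (m1, m)"] supp_unit[of ?I1] L(2)[OF mm(1)]
        supp_diff[of "unit_op ?I2" "L2 (m, 0)"] supp_unit[of ?I2] L2(2)[OF mm(2)] by blast+
    have "err m m1 = rtr ((unit_op (Z n d1 d2) - pairs_op (Z n d1 d2) (L (m1, m)) (L2 (m, 0))) * ?T12)"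
      unfolding err_def by (subst mtrace_code_error[OF _ len]) (use dens_x(2)[OF _ m] in auto)
    also have "\<dots> \<le> rtr (pairs_op (Z n d1 d2) (unit_op ?I1 - L (m1, m)) (unit_op ?I2) * ?T12)
        + rtr (pairs_op (Z n d1 d2) (unit_op ?I1) (unit_op ?I2 - L2 (m, 0)) * ?T12)"
      by (rule pairs_op_union_bound)
        (fact L(1)[OF mm(1)] Lle L(2)[OF mm(1)] L2(1)[OF mm(2)] L2(2)[OF mm(2)] \<open>0 \<le> ?T12\<close>)+
    also have "tr (pairs_op (Z n d1 d2) (unit_op ?I1 - L (m1, m)) (unit_op ?I2) * ?T12) = tr ((unit_op ?I1
        - L (m1, m)) * \<rho>1 ?x)"
      unfolding \<rho>1_def \<sigma>1_def[abs_def]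
      by (rule tr_pairs_op_unit(1)[OF len]) (rule sL)
    also have "tr (pairs_op (Z n d1 d2) (unit_op ?I1) (unit_op ?I2 - L2 (m, 0)) * ?T12) = tr ((unit_op ?I2
        - L2 (m, 0)) * \<rho>2 ?x)"
      unfolding \<rho>2_def \<sigma>2_def[abs_def]
      by (rule tr_pairs_op_unit(2)[OF len]) (rule sL)
    finally have 0: "err m m1 \<le> rtr ((unit_op ?I1 - L (m1, m)) * \<rho>1 ?x) + rtr ((unit_op ?I2 - L2 (m, 0))
        * \<rho>2 ?x)" .
    have u: "unit_op ?I1 * \<rho>1 ?x = \<rho>1 ?x" "unit_op ?I2 * \<rho>2 ?x = \<rho>2 ?x"
      using \<rho>1(2)[OF xX] \<rho>2(2)[OF xX] fin by (simp_all add: supp_subset_iff)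
    have "rtr ((unit_op ?I1 - L (m1, m)) * \<rho>1 ?x) \<le>
        2 * rtr ((unit_op ?I1 - T' (m1, m)) * \<rho>1 ?x) + 4 * ((\<Sum>m'\<in>?MM - {(m1, m)}. rtr (T' m' * \<rho>1 ?x)) + \<eta>)"
      using rtr_mult_mono[OF L(4)[OF mm(1)] \<rho>1(1)[OF xX]] \<rho>1(3)[OF xX]
      by (simp add: distrib_right sum_distrib_right tr_sum u)
    also have "(\<Sum>m'\<in>?MM - {(m1, m)}. rtr (T' m' * \<rho>1 ?x)) =
        (\<Sum>m1'\<in>{..<M1} - {m1}. rtr (T (w m) (x m m1') * \<rho>1 ?x)) + (\<Sum>m'\<in>{..<M} - {m}. \<Sum>m1'<M1. rtr (T (w m')
            (x m' m1') * \<rho>1 ?x))"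
    proof -
      \<comment> \<open>Wrong messages split into other satellites of the sent cloud, which lead to
        \<open>H1\<close>, and all satellites of other clouds, which lead to
        \<open>H2\<close>.\<close>
      have "?MM - {(m1, m)} = ({..<M1} - {m1}) \<times> {m} \<union> {..<M1} \<times> ({..<M} - {m})" using m by auto
      then have "(\<Sum>m'\<in>?MM - {(m1, m)}. rtr (T' m' * \<rho>1 ?x)) =
          (\<Sum>m'\<in>({..<M1} - {m1}) \<times> {m}. rtr (T' m' * \<rho>1 ?x)) + (\<Sum>m'\<in>{..<M1} \<times> ({..<M} - {m}). rtr (T' m'
              * \<rho>1 ?x))"
        by (simp only:) (rule sum.union_disjoint, auto)
      also have "(\<Sum>m'\<in>({..<M1} - {m1}) \<times> {m}. rtr (T' m' * \<rho>1 ?x)) = (\<Sum>m1'\<in>{..<M1} - {m1}. rtr (T (w m)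
          (x m m1') * \<rho>1 ?x))"
        unfolding sum.cartesian_product' by (simp add: T'_def)
      also have "(\<Sum>m'\<in>{..<M1} \<times> ({..<M} - {m}). rtr (T' m' * \<rho>1 ?x)) = (\<Sum>m'\<in>{..<M} - {m}. \<Sum>m1'<M1. rtr (T
          (w m') (x m' m1') * \<rho>1 ?x))"
        unfolding sum.cartesian_product' by (subst sum.swap) (simp add: T'_def)
      finally show ?thesis .
    qed
    finally have 1: "rtr ((unit_op ?I1 - L (m1, m)) * \<rho>1 ?x) \<le> (2 * rtr ((E1 - T (w m) ?x) * \<rho>1 ?x) + 4 * \<eta>)
        + (\<Sum>m1'\<in>{..<M1} - {m1}. H1 (w m) ?x (x m m1')) + (\<Sum>m'\<in>{..<M} - {m}. \<Sum>m1'<M1. H2 (w m') (x m' m1') ?x)"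
      by (simp add: T'_def H1_def H2_def sum_distrib_left E1_def algebra_simps)
    have "rtr ((unit_op ?I2 - L2 (m, 0)) * \<rho>2 ?x) \<le>
        2 * rtr ((unit_op ?I2 - T2' (m, 0)) * \<rho>2 ?x) + 4 * ((\<Sum>m'\<in>?MM2 - {(m, 0)}. rtr (T2' m' * \<rho>2 ?x)) + \<eta>)"
      using rtr_mult_mono[OF L2(4)[OF mm(2)] \<rho>2(1)[OF xX]] \<rho>2(3)[OF xX]
      by (simp add: distrib_right sum_distrib_right tr_sum u)
    also have "(\<Sum>m'\<in>?MM2 - {(m, 0)}. rtr (T2' m' * \<rho>2 ?x)) = (\<Sum>m'\<in>{..<M} - {m}. rtr (T2 (w m') * \<rho>2 ?x))"
    proof -
      have "?MM2 - {(m, 0)} = ({..<M} - {m}) \<times> {0}" by auto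
      then show ?thesis by (simp only: sum.cartesian_product') (simp add: T2'_def)
    qed
    finally have 2: "rtr ((unit_op ?I2 - L2 (m, 0)) * \<rho>2 ?x) \<le> (2 * rtr ((E2 - T2 (w m)) * \<rho>2 ?x) + 4 * \<eta>)
        + (\<Sum>m'\<in>{..<M} - {m}. H3 (w m') ?x)"
      by (simp add: T2'_def H3_def sum_distrib_left E2_def algebra_simps)
    show ?thesis using 0 1 2 by (simp add: G_def sum.distrib)
  qed
  have "(\<Sum>m1<M1. \<Sum>m<M. err m m1) = (\<Sum>m<M. \<Sum>m1<M1. err m m1)" by (rule sum.swap)
  also have "\<dots> \<le> (\<Sum>m<M. \<Sum>m1<M1. G (w m) (x m m1) + (\<Sum>m1'\<in>{..<M1} - {m1}. H1 (w m) (x m m1) (x m m1'))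
       + (\<Sum>m'\<in>{..<M} - {m}. (\<Sum>m1'<M1. H2 (w m') (x m' m1') (x m m1)) + H3 (w m') (x m m1)))"
    by (intro sum_mono err) auto
  also have "\<dots> \<le> real M * real M1 * \<epsilon>"
    using code \<epsilon> by (meson mult_left_mono mult_nonneg_nonneg of_nat_0_le_iff order_trans)
  finally have tot: "(\<Sum>m1<M1. \<Sum>m<M. err m m1) \<le> real M * real M1 * \<epsilon>" .
  have fin_err: "1 / (real M1 * real M * real 1) * (\<Sum>m1<M1. \<Sum>m<M. \<Sum>m2<(1::nat). err m m1) \<le> \<epsilon>"
  proof -
    have "0 < real M1 * real M" using M_pos by simp
    then show ?thesis using tot by (simp add: divide_simps mult_ac)
  qed
  show ?thesis
    unfolding has_code_def Let_def M2 M_def[symmetric] M1_def[symmetric]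
  proof (rule exI[of _ "\<lambda>m1 m m2 i. x m m1 ! i"], rule exI[of _ "\<lambda>mm. mat_op n d1 (L mm)"],
      rule exI[of _ "\<lambda>mm. mat_op n d2 (L2 mm)"], intro conjI)
    show "\<forall>m1<M1. \<forall>m<M. \<forall>m2<1::nat. \<forall>i<n. x m m1 ! i < nX"
      using x by (auto simp: seqs_def subset_iff)
    show "povm (d1 ^ n) ?MM (\<lambda>mm. mat_op n d1 (L mm))" by (rule povm_mat_op) (use L in auto)
    show "povm (d2 ^ n) ?MM2 (\<lambda>mm. mat_op n d2 (L2 mm))" by (rule povm_mat_op) (use L2 in auto)
    show "1 / (real M1 * real M * real 1) * (\<Sum>m1<M1. \<Sum>m<M. \<Sum>m2<1.
      Re (mtrace ((1\<^sub>m (d1 ^ n * d2 ^ n) - kron (mat_op n d1 (L (m1, m))) (mat_op n d2 (L2 (m, m2))))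
        * out_state d1 d2 \<rho> n (\<lambda>i. x m m1 ! i)))) \<le> \<epsilon>"
      using fin_err by (simp add: err_def)
  qed
qed

end

section \<open>Message numbers and exponents\<close>

lemma msg_size_pos: "1 \<le> msg_size n r"
proof -
  have "0 < (2::real) powr (real n * r)" by simp
  then show ?thesis unfolding msg_size_def by linarith
qed

text \<open>The ceiling adds less than 1 and only wrong messages are counted, so rounding up the
  number of messages costs nothing.\<close>

lemma msg_size_le: "real (msg_size n r - 1) \<le> 2 powr (real n * r)"
proof -
  have "0 < (2::real) powr (real n * r)" by simp
  then show ?thesis unfolding msg_size_def by linarith
qed

text \<open>Covers the personal rate \<open>0 - \<delta>\<close> of Receiver 2: a nonpositive rate
  still means one message.\<close>

lemma msg_size_neg: "r \<le> 0 \<Longrightarrow> msg_size n r = 1"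
proof -
  assume "r \<le> 0"
  then have "(2::real) powr (real n * r) \<le> 2 powr 0" by (intro powr_mono) (auto simp: mult_nonneg_nonpos)
  then have "(2::real) powr (real n * r) \<le> 1" by simp
  moreover have "0 < (2::real) powr (real n * r)" by simp
  ultimately have "\<lceil>(2::real) powr (real n * r)\<rceil> = 1" by linarith
  then show ?thesis by (simp add: msg_size_def)
qed

lemma powr_le_power: "x \<le> - s \<Longrightarrow> 2 powr (real n * x) \<le> (2 powr (- s)) ^ n" for x s :: real
proof -
  assume "x \<le> - s"
  then have "2 powr (real n * x) \<le> 2 powr (real n * - s)" by (intro powr_mono mult_left_mono) auto
  also have "\<dots> = (2 powr (- s)) ^ n" by (simp add: powr_powr mult.commute flip: powr_realpow)
  finally show ?thesis .
qed

text \<open>With slack \<open>\<gamma> = \<delta> / 4\<close> in each of the two entropies involved, every rate constraint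
  leaves the exponent \<open>2 \<gamma> - \<delta> = - \<delta> / 2\<close>.\<close>

lemma rate_term_bound:
  fixes R' s t \<delta> :: real
  assumes "R' - \<delta> + s - t \<le> - \<delta> / 2" "N \<le> 2 powr (real n * (R' - \<delta>))"
  shows "N * (4 * (2 powr (real n * s) * 2 powr (- real n * t))) \<le> 4 * (2 powr (- (\<delta> / 2))) ^ n"
proof -
  have "N * (4 * (2 powr (real n * s) * 2 powr (- real n * t))) \<le>
      2 powr (real n * (R' - \<delta>)) * (4 * (2 powr (real n * s) * 2 powr (- real n * t)))"
    using assms(2) by (rule mult_right_mono) simp
  also have "\<dots> = 4 * 2 powr (real n * (R' - \<delta> + s - t))"
    by (simp add: powr_add[symmetric] algebra_simps)
  also have "\<dots> \<le> 4 * (2 powr (- (\<delta> / 2))) ^ n"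
    using powr_le_power[of "R' - \<delta> + s - t" "\<delta> / 2" n] assms(1) by simp
  finally show ?thesis .
qed

theorem theorem6p1:
  fixes nX d1 d2 nW :: nat and \<rho> :: "nat \<Rightarrow> complex mat"
    and pW :: "nat \<Rightarrow> real" and pXW :: "nat \<Rightarrow> nat \<Rightarrow> real" and R1 R :: real
  assumes chan: "cq_bc nX d1 d2 \<rho>"
    and pW_nonneg: "\<forall>w<nW. 0 \<le> pW w"
    and pW_sum: "(\<Sum>w<nW. pW w) = 1"
    and pXW_nonneg: "\<forall>w<nW. \<forall>x<nX. 0 \<le> pXW w x"
    and pXW_sum: "\<forall>w<nW. (\<Sum>x<nX. pXW w x) = 1"
    and R1_nonneg: "0 \<le> R1" and R_nonneg: "0 \<le> R"
    and bound1: "R1 \<le> qcmi [nW, nX, d1, d2] [1] [2] [0] (theta nW nX d1 d2 pW pXW \<rho>)"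
    and bound2: "R \<le> qmi [nW, nX, d1, d2] [0] [3] (theta nW nX d1 d2 pW pXW \<rho>)"
    and bound3: "R1 + R \<le> qmi [nW, nX, d1, d2] [1] [2] (theta nW nX d1 d2 pW pXW \<rho>)"
  shows "achievable nX d1 d2 \<rho> R1 R 0"
proof -
  interpret broadcast nX d1 d2 nW \<rho> pW pXW
    by (rule broadcast.intro) (use chan pW_nonneg pW_sum pXW_nonneg pXW_sum in \<open>auto simp: cq_bc_def\<close>)
  define h1X where "h1X = (\<Sum>x<nX. pX x * entr d1 (\<sigma>1 x))"
  define h1W where "h1W = (\<Sum>w<nW. pW w * entr d1 (\<omega>1 w))"
  define h2W where "h2W = (\<Sum>w<nW. pW w * entr d2 (\<omega>2 w))"
  have b1: "R1 \<le> h1W - h1X" using bound1 unfolding qcmi_theta h1W_def h1X_def .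
  have b2: "R \<le> entr d2 \<tau>2 - h2W" using bound2 unfolding qmi_theta_W h2W_def .
  have b3: "R1 + R \<le> entr d1 \<tau>1 - h1X" using bound3 unfolding qmi_theta_X h1X_def .
  show ?thesis
    unfolding achievable_def
  proof (intro allI impI)
    fix \<epsilon> \<delta> :: real assume pos: "0 < \<epsilon>" "0 < \<delta>"
    define \<gamma> where "\<gamma> = \<delta> / 4"
    have \<gamma>: "0 < \<gamma>" using pos by (simp add: \<gamma>_def)
    have sX: "h1X < h1X + \<gamma>" "h2W < h2W + \<gamma>" "h1W - \<gamma> < h1W" "entr d1 \<tau>1 - \<gamma> < entr d1 \<tau>1"
      "entr d2 \<tau>2 - \<gamma> < entr d2 \<tau>2" using \<gamma> by auto
    obtain P r3 where P: "upper_typical {..<d1} {..<nX} pX \<sigma>1 (h1X + \<gamma>) P r3"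
      using typical_exists(1)[of "{..<nX}" pX d1 \<sigma>1 "h1X + \<gamma>"] pX0 pX1 st_\<sigma> sX by (auto simp: h1X_def)
    obtain S r2 where S: "lower_typical {..<d1} {..<nW} pW \<omega>1 (h1W - \<gamma>) S r2"
      using typical_exists(2)[of "{..<nW}" pW d1 \<omega>1 "h1W - \<gamma>"] pW0 pW1 st_\<omega> sX by (auto simp: h1W_def)
    obtain Q r1 where Q: "lower_typical {..<d1} {0::nat} (\<lambda>_. 1) (\<lambda>_. \<tau>1) (entr d1 \<tau>1 - \<gamma>) Q r1"
      using typical_exists(2)[of "{0::nat}" "\<lambda>_. 1" d1 "\<lambda>_. \<tau>1" "entr d1 \<tau>1 - \<gamma>"] st_\<tau> sX by auto
    obtain P2 r5 where P2: "upper_typical {..<d2} {..<nW} pW \<omega>2 (h2W + \<gamma>) P2 r5"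
      using typical_exists(1)[of "{..<nW}" pW d2 \<omega>2 "h2W + \<gamma>"] pW0 pW1 st_\<omega> sX by (auto simp: h2W_def)
    obtain Q2 r4 where Q2: "lower_typical {..<d2} {0::nat} (\<lambda>_. 1) (\<lambda>_. \<tau>2) (entr d2 \<tau>2 - \<gamma>) Q2 r4"
      using typical_exists(2)[of "{0::nat}" "\<lambda>_. 1" d2 "\<lambda>_. \<tau>2" "entr d2 \<tau>2 - \<gamma>"] st_\<tau> sX by auto
    have r1: "0 \<le> r1" "r1 < 1" and r4: "0 \<le> r4" "r4 < 1"
      using lower_typical_single[OF Q] lower_typical_single[OF Q2] by auto
    have r2: "0 \<le> r2" "r2 < 1" and r3: "0 \<le> r3" "r3 < 1" and r5: "0 \<le> r5" "r5 < 1"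
      using S P P2 by (auto simp: lower_typical_def upper_typical_def)
    define r6 where "r6 = 2 powr (- (\<delta> / 2))"
    have r6: "0 \<le> r6" "r6 < 1"
    proof -
      have "2 powr (- (\<delta> / 2)) < 2 powr (0::real)" using pos by (intro powr_less_mono) auto
      then show "r6 < 1" by (simp add: r6_def)
    qed (simp add: r6_def)
    \<comment> \<open>The coefficient 16 gathers four rate terms of weight 4: one for wrong
      satellites, two for wrong clouds at Receiver 1, one for Receiver 2.\<close>
    define tail where "tail n = 6 * r1 ^ n + 12 * r2 ^ n + 8 * r3 ^ n + 6 * r4 ^ n + 8 * r5 ^ n + 16
        * r6 ^ n" for n :: nat
    have "tail \<longlonglongrightarrow> 6 * 0 + 12 * 0 + 8 * 0 + 6 * 0 + 8 * 0 + 16 * 0"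
      unfolding tail_def by (intro tendsto_add tendsto_mult tendsto_const LIMSEQ_power_zero) (use r1 r2 r3
          r4 r5 r6 in auto)
    then have "eventually (\<lambda>n. tail n < \<epsilon> / 2) sequentially"
      using pos by (intro order_tendstoD(2)) auto
    then obtain N where N: "\<And>n. N \<le> n \<Longrightarrow> tail n < \<epsilon> / 2" unfolding eventually_sequentially by blast
    show "\<exists>N. \<forall>n\<ge>N. has_code nX d1 d2 \<rho> n (R1 - \<delta>) (R - \<delta>) (0 - \<delta>) \<epsilon>"
    proof (intro exI[of _ N] allI impI)
      fix n assume n: "N \<le> n"
      let ?M1 = "msg_size n (R1 - \<delta>)" and ?M = "msg_size n (R - \<delta>)"
      let ?a = "2 powr (real n * (h1X + \<gamma>))" and ?b = "2 powr (- real n * (h1W - \<gamma>))"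
        and ?c = "2 powr (- real n * (entr d1 \<tau>1 - \<gamma>))"
        and ?a2 = "2 powr (real n * (h2W + \<gamma>))" and ?c2 = "2 powr (- real n * (entr d2 \<tau>2 - \<gamma>))"
      have t1: "real (?M1 - 1) * (4 * (?a * ?b)) \<le> 4 * r6 ^ n"
        unfolding r6_def by (rule rate_term_bound[OF _ msg_size_le]) (use b1 in \<open>simp add: \<gamma>_def\<close>)
      \<comment> \<open>Since \<open>R1\<close> is nonnegative, the sum-rate bound also limits
        \<open>R\<close> alone.\<close>
      have t2: "real (?M - 1) * (4 * (?a * ?c)) \<le> 4 * r6 ^ n"
        unfolding r6_def by (rule rate_term_bound[OF _ msg_size_le]) (use b3 R1_nonneg in \<open>simp add: \<gamma>_def\<close>)
      have t3: "(real (?M - 1) * real (?M1 - 1)) * (4 * (?a * ?c)) \<le> 4 * r6 ^ n"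
        unfolding r6_def
      proof (rule rate_term_bound[where R' = "R1 + R - \<delta>"])
        show "R1 + R - \<delta> - \<delta> + (h1X + \<gamma>) - (entr d1 \<tau>1 - \<gamma>) \<le> - \<delta> / 2"
          using b3 pos by (simp add: \<gamma>_def)
        have "real (?M - 1) * real (?M1 - 1) \<le> 2 powr (real n * (R - \<delta>)) * 2 powr (real n * (R1 - \<delta>))"
          by (intro mult_mono msg_size_le) auto
        also have "\<dots> = 2 powr (real n * (R1 + R - \<delta> - \<delta>))"
          by (simp add: powr_add[symmetric] algebra_simps)
        finally show "real (?M - 1) * real (?M1 - 1) \<le> 2 powr (real n * (R1 + R - \<delta> - \<delta>))" .
      qed
      have t4: "real (?M - 1) * (4 * (?a2 * ?c2)) \<le> 4 * r6 ^ n"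
        unfolding r6_def by (rule rate_term_bound[OF _ msg_size_le]) (use b2 in \<open>simp add: \<gamma>_def\<close>)
      \<comment> \<open>A wrong cloud contributes all of its satellites, one more than
        \<open>msg_size_le\<close> controls; the extra one is the term bounded in \<open>t2\<close>,
        the others are those of \<open>t3\<close>.\<close>
      have M1_eq: "real ?M1 = real (?M1 - 1) + 1" using msg_size_pos[of n "R1 - \<delta>"] by simp
      have t23: "real (?M - 1) * (real ?M1 * (4 * (?a * ?c)) + 4 * (?a2 * ?c2)) \<le> 12 * r6 ^ n"
        unfolding M1_eq using t2 t3 t4 by (simp only: algebra_simps)
      show "has_code nX d1 d2 \<rho> n (R1 - \<delta>) (R - \<delta>) (0 - \<delta>) \<epsilon>"
      \<comment> \<open>With this \<open>\<eta>\<close> the term \<open>8 * \<eta>\<close> takes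
        half of \<open>\<epsilon>\<close>; the other half is left for \<open>tail n\<close>.\<close>
      proof (rule code_from_tests[where \<eta> = "\<epsilon> / 16" and Q = "Q n (replicate n 0)" and S = "S n" and P =
          "P n" and ?Q2.0 = "Q2 n (replicate n 0)" and ?P2.0 = "P2 n"
            and a = ?a and b = ?b and c = ?c and ?a2.0 = ?a2 and ?c2.0 = ?c2
            and ?e1.0 = "r1 ^ n" and ?e2.0 = "r2 ^ n" and ?e3.0 = "r3 ^ n" and ?e4.0 = "r4 ^ n" and ?e5.0 =
                "r5 ^ n"])
        show "(6 * r1 ^ n + 12 * r2 ^ n + 8 * r3 ^ n + 6 * r4 ^ n + 8 * r5 ^ n + 8 * (\<epsilon> / 16)) + real (?M1
            - 1) * (4 * (?a * ?b))
          + real (?M - 1) * (real ?M1 * (4 * (?a * ?c)) + 4 * (?a2 * ?c2)) \<le> \<epsilon>"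
          using t1 t23 N[OF n] unfolding tail_def by linarith
      qed (use P S P2 lower_typical_single[OF Q] lower_typical_single[OF Q2] pos msg_size_pos msg_size_neg
          in \<open>simp_all add: upper_typical_def lower_typical_def\<close>)
    qed
  qed
qed

end
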